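(* Let $k\geq 0$ and $l\geq 1$ be integers and let $T_0,\dots,T_k$ be integer matrices, where $T_s$ has $l$ rows and $n_s\geq 1$ columns. Let $G_0,\dots,G_k$ be the sets computed by the algorithm to compute $\mathcal{H}_{k,\infty}$ (described in the context) for given input $k$. Then, for each $i=0,\dots,k$, $G_i$ is a finite symmetric set of finite vector-trees of height $i$ with $G(A_{i,N})\subseteq\langle G_i\rangle_N$ for all $N\geq 1$. (In particular, the set consisting of the building blocks, i.e. labels, of vector-trees in $G_k$ contains $\mathcal{H}_{k,\infty}$.)
   Context: **Matrices and Graver bases.** For $N\geq 1$ put $A_{0,N}:=T_0$, and for $s=1,\dots,k$ let $$A_{s,N}:=\begin{pmatrix} T_{s,N} & A_{s-1,N} & 0 & \cdots & 0\\ T_{s,N} & 0 & A_{s-1,N} & \cdots & 0\\ \vdots & \vdots & \vdots & \ddots & \vdots\\ T_{s,N} & 0 & 0 & \cdots & A_{s-1,N}\end{pmatrix}$$ with $N$ block rows, where $T_{s,N}$ is the vertical stack of $N^{s-1}$ copies of $T_s$. $A_{s,N}$ has $d_{s,N}=\sum_{i=0}^s N^{s-i}n_i$ columns. Put $n(h):=n_0+\cdots+n_h=d_{h,1}$; so $A_{h,1}=(T_h|T_{h-1}|\cdots|T_0)$. For integer $A$, $\ker(A)=\{z\in\mathbb{Z}^d:Az=0\}$. On $\mathbb{Z}^d$: $a\sqsubseteq b$ iff $a_jb_j\geq 0$ and $|a_j|\leq|b_j|$ for all $j$. The Graver basis $G(A)$ is the set of $\sqsubseteq$-minimal non-zero elements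 of $\ker(A)$. **Building blocks.** Let $[1,N]=\{1,\dots,N\}$ and $\varepsilon$ be the empty sequence. A vector $z\in\mathbb{Z}^{d_{h,N}}$ is decomposed into blocks $z_\alpha\in\mathbb{Z}^{n_{h-s}}$ ($\alpha\in[1,N]^s$, $s=0,\dots,h$): $z_\varepsilon$ consists of the first $n_h$ coordinates, and if $h>0$ the remaining coordinates form $N$ consecutive vectors $z_{(1)},\dots,z_{(N)}\in\mathbb{Z}^{d_{h-1,N}}$ such that the block of $z$ with index $(i,\alpha_2,\dots,\alpha_s)$ is the block of $z_{(i)}$ with index $(\alpha_2,\dots,\alpha_s)$. $\mathcal{H}_{k,\infty}$ is the disjoint union over $s=0,\dots,k$ of the sets $\mathcal{H}^s_{k,\infty}=\{z_\alpha: N\geq 1,\ z\in G(A_{k,N}),\ \alpha\in[1,N]^s\}\subseteq\mathbb{Z}^{n_{k-s}}$. **Vector-trees.** A vector-tree of height $h$ is a non-empty countable rooted (directed) tree in which every path from the root to a leaf has length exactly $h$, and whose nodes at distance $s$ from the root are labeled by vectors in $\mathbb{Z}^{n_{h-s}}$ ($s=0,\dots,h$); isomorphic vector-trees are identified. $\mathrm{root}(\mathcal{T})\in\mathbb{Z}^{n_h}$ is the label of the root. An immediate sub-vector-tree of $\mathcal{T}$ is the vector-tree of height $h-1$ consisting of a child of the root and all its descendants. $\mathrm{paths}(\mathcal{T})\subseteq\mathbb{Z}^{n_h}\times\cdots\times\mathbb{Z}^{n_0}=\mathbb{Z}^{n(h)}$ is the set of sequences $(v_0,\dots,v_h)$ of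 successive labels along paths from the root to a leaf. For $z\in\mathbb{Z}^{d_{h,N}}$, $\mathcal{T}(z)$ is the full $N$-ary vector-tree of height $h$ with nodes $\alpha\in[1,N]^s$ ($s\le h$) labeled $z_\alpha$, the children of $\alpha\in[1,N]^s$ ($s<h$) being its extensions $(\alpha,i)$, $i\in[1,N]$. Put $\langle\mathcal{T}\rangle_N:=\{z\in\mathbb{Z}^{d_{h,N}}:\mathrm{paths}(\mathcal{T}(z))\subseteq\mathrm{paths}(\mathcal{T})\}$ and, for a set $G$ of vector-trees of height $h$, $\langle G\rangle_N:=\bigcup_{\mathcal{T}\in G}\langle\mathcal{T}\rangle_N$. A vector-tree is tight if the labels of the children of each internal node are pairwise distinct. For a non-empty $V\subseteq\mathbb{Z}^{n(h)}$ all of whose elements have the same component in $\mathbb{Z}^{n_h}$, $\mathcal{T}(V)$ denotes the unique tight vector-tree of height $h$ with $\mathrm{paths}(\mathcal{T}(V))=V$; for $v\in\mathbb{Z}^{n(h)}$, $\mathcal{T}(v):=\mathcal{T}(\{v\})$. **Reducibility.** For vector-trees of height $0$: $\mathcal{S}\sqsubseteq_0\mathcal{T}$ iff $\mathrm{root}(\mathcal{S})\sqsubseteq\mathrm{root}(\mathcal{T})$. For height $h>0$: $\mathcal{S}\sqsubseteq_h\mathcal{T}$ iff $\mathrm{root}(\mathcal{S})\sqsubseteq\mathrm{root}(\mathcal{T})$ and for every immediate sub-vector-tree $\mathcal{T}'$ of $\mathcal{T}$ there is an immediate sub-vector-tree $\mathcal{S}'$ of $\mathcal{S}$ with $\mathcal{S}'\sqsubseteq_{h-1}\mathcal{T}'$.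 **Operations** (vector-trees of height $h$). $-\mathcal{S}:=\mathcal{T}(\{-v:v\in\mathrm{paths}(\mathcal{S})\})$; $\mathcal{S}+\mathcal{T}:=\mathcal{T}(\{v+w:v\in\mathrm{paths}(\mathcal{S}),w\in\mathrm{paths}(\mathcal{T})\})$; and if $\mathcal{T}\sqsubseteq_h\mathcal{S}$, $\mathcal{S}-\mathcal{T}:=\mathcal{T}(\{v-w:v\in\mathrm{paths}(\mathcal{S}),w\in\mathrm{paths}(\mathcal{T}),w\sqsubseteq v\})$ (this set is non-empty). A set $G$ of vector-trees is symmetric if $\mathcal{S}\in G$ implies $-\mathcal{S}\in G$; a set $F$ of vectors is symmetric if $v\in F$ implies $-v\in F$. **Normal form procedure** $\mathrm{normalForm}(\mathcal{S},G)$: while there is $\mathcal{T}\in G$ with $\mathcal{T}\sqsubseteq_h\mathcal{S}$ and $\mathrm{root}(\mathcal{T})\neq 0$, replace $\mathcal{S}$ by $\mathcal{S}-\mathcal{T}$; return $\mathcal{S}$. **Completion procedure.** Input: a finite set $G$ of finite vector-trees of height $h$. Set $C:=\{\mathcal{S}+\mathcal{T}:\mathcal{S},\mathcal{T}\in G\}$. While $C\neq\emptyset$: choose $\mathcal{S}\in C$, remove it from $C$, put $\mathcal{T}:=\mathrm{normalForm}(\mathcal{S},G)$; if $\mathrm{root}(\mathcal{T})\neq 0$, then set $G:=G\cup\{\mathcal{T},-\mathcal{T}\}$ and afterwards $C:=C\cup\{\mathcal{S}'+\mathcal{T},\mathcal{S}'+(-\mathcal{T}):\mathcal{S}'\in G\}$.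 Return $G$. **Algorithm to compute $\mathcal{H}_{k,\infty}$.** For $i=0,\dots,k$: if $i=0$, let $F_0$ be a finite symmetric generating set for the $\mathbb{Z}$-module $\ker(A_{0,1})$ and $G:=\{\mathcal{T}(v):v\in F_0\}$. If $i>0$, let $F_i$ be a finite symmetric generating set for $\ker(A_{i,1})\subseteq\mathbb{Z}^{n(i)}$ which contains a generating set for $\ker(A_{i,1})\cap(\{0\}\times\mathbb{Z}^{n(i-1)})$ (where $0\in\mathbb{Z}^{n_i}$), let $\mathcal{T}_0:=\mathcal{T}\bigl(\{(0,v): v=0\text{ or }v\in\mathrm{paths}(\mathcal{S})\text{ for some }\mathcal{S}\in G_{i-1}\}\bigr)$ and $G:=\{\mathcal{T}_0\}\cup\{\mathcal{T}(v):v\in F_i\}$. Let $G_i$ be the output of the completion procedure applied to $G$. *)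

theory Defs
  imports "Jordan_Normal_Form.Matrix_Kernel" "HOL-Library.Countable_Set"
begin

section \<open>Matrices and Graver bases\<close>

text \<open>Throughout, \<open>T s\<close> is the matrix $T_s$ and \<open>n s\<close> its number of columns. Vectors in
  $\mathbb{Z}^d$ are elements of \<open>carrier_vec d\<close>.\<close>

definition stack :: "nat \<Rightarrow> int mat \<Rightarrow> int mat" where
  "stack m M = foldr append_rows (replicate m M) (0\<^sub>m 0 (dim_col M))"

definition beside :: "int mat \<Rightarrow> int mat \<Rightarrow> int mat" where
  "beside M M' = four_block_mat M M' (0\<^sub>m 0 (dim_col M)) (0\<^sub>m 0 (dim_col M'))"

fun stage_mat :: "(nat \<Rightarrow> int mat) \<Rightarrow> nat \<Rightarrow> nat \<Rightarrow> int mat" where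
  "stage_mat T 0 N = T 0"
| "stage_mat T (Suc s) N =
     beside (stack N (stack (N ^ s) (T (Suc s)))) (diag_block_mat (replicate N (stage_mat T s N)))"

definition stage_dim :: "(nat \<Rightarrow> nat) \<Rightarrow> nat \<Rightarrow> nat \<Rightarrow> nat" where
  "stage_dim n s N = (\<Sum>i\<le>s. N ^ (s - i) * n i)"

definition path_dim :: "(nat \<Rightarrow> nat) \<Rightarrow> nat \<Rightarrow> nat" where
  "path_dim n h = (\<Sum>i\<le>h. n i)"

lemma stack_dim: "stack m M \<in> carrier_mat (m * dim_row M) (dim_col M)"
  unfolding stack_def by (induction m) auto

lemma stage_mat_dim:
  assumes "\<And>s. s \<le> k \<Longrightarrow> T s \<in> carrier_mat l (n s)" 
  shows "stage_mat T k N \<in> carrier_mat (l * N ^ k) (stage_dim n k N)"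
  using assms
proof (induction k)
  case 0 then show ?case by (auto simp: stage_dim_def)
next
  case (Suc k)
  have "stage_dim n (Suc k) N = n (Suc k) + N * stage_dim n k N"
    by (simp add: stage_dim_def sum_distrib_left Suc_diff_le mult_ac)
  moreover have "T (Suc k) \<in> carrier_mat l (n (Suc k))" using Suc by auto
  moreover note stack_dim[of N "stack (N^k) (T (Suc k))"] stack_dim[of "N^k" "T (Suc k)"]
  ultimately show ?case using Suc
   by (intro carrier_matI) (auto simp: beside_def dim_diag_block_mat sum_list_replicate mult_ac)
qed

definition conformal :: "int vec \<Rightarrow> int vec \<Rightarrow> bool" (infix "\<sqsubseteq>\<^sub>c" 50) where
  "a \<sqsubseteq>\<^sub>c b \<longleftrightarrow> dim_vec a = dim_vec b \<and>
     (\<forall>j<dim_vec a. a $ j * b $ j \<ge> 0 \<and> \<bar>a $ j\<bar> \<le> \<bar>b $ j\<bar>)"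

definition graver_basis :: "int mat \<Rightarrow> int vec set" where
  "graver_basis A = {z \<in> mat_kernel A. z \<noteq> 0\<^sub>v (dim_col A) \<and>
     (\<forall>y \<in> mat_kernel A. y \<noteq> 0\<^sub>v (dim_col A) \<longrightarrow> y \<sqsubseteq>\<^sub>c z \<longrightarrow> y = z)}"

section \<open>Building blocks\<close>

text \<open>\<open>block n N h z \<alpha>\<close> is the block $z_\alpha$ of a vector $z\in\mathbb{Z}^{d_{h,N}}$;
  indices are lists over \<open>{1..N}\<close> of length at most \<open>h\<close> (the value on longer lists is junk).\<close>

fun block :: "(nat \<Rightarrow> nat) \<Rightarrow> nat \<Rightarrow> nat \<Rightarrow> int vec \<Rightarrow> nat list \<Rightarrow> int vec" where
  "block n N h z [] = vec_first z (n h)"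
| "block n N (Suc h) z (i # \<alpha>) =
     block n N h
       (vec (stage_dim n h N) (\<lambda>j. z $ (n (Suc h) + (i - 1) * stage_dim n h N + j))) \<alpha>"
| "block n N 0 z (i # \<alpha>) = 0\<^sub>v 0"

definition indices :: "nat \<Rightarrow> nat \<Rightarrow> nat list set" where
  "indices N s = {\<alpha>. length \<alpha> = s \<and> set \<alpha> \<subseteq> {1..N}}"

definition blocks_at :: "(nat \<Rightarrow> int mat) \<Rightarrow> (nat \<Rightarrow> nat) \<Rightarrow> nat \<Rightarrow> nat \<Rightarrow> int vec set" where
  "blocks_at T n k s =
     {block n N k z \<alpha> | N z \<alpha>. N \<ge> 1 \<and> z \<in> graver_basis (stage_mat T k N) \<and> \<alpha> \<in> indices N s}"

text \<open>$\mathcal{H}_{k,\infty}$; the disjoint union over \<open>s\<close> is a dependent sum.\<close>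

definition H_inf :: "(nat \<Rightarrow> int mat) \<Rightarrow> (nat \<Rightarrow> nat) \<Rightarrow> nat \<Rightarrow> (nat \<times> int vec) set" where
  "H_inf T n k = (SIGMA s:{0..k}. blocks_at T n k s)"

section \<open>Countable labeled rooted trees up to isomorphism\<close>

text \<open>Every non-empty countable rooted tree without infinite paths is isomorphic to one in which
  the children of each node are indexed by a subset of the natural numbers, the domain of the
  partial function \<open>rkids\<close>. The indexing carries no information: it is removed by passing to the
  quotient by isomorphism of labeled rooted trees.\<close>

datatype raw_tree = RNode (rlabel: "int vec") (rkids: "nat \<Rightarrow> raw_tree option")

inductive riso :: "raw_tree \<Rightarrow> raw_tree \<Rightarrow> bool" where
  riso: "bij_betw \<pi> (dom f) (dom g) \<Longrightarrow>
    (\<And>i s t. f i = Some s \<Longrightarrow> g (\<pi> i) = Some t \<Longrightarrow> riso s t) \<Longrightarrow>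
    riso (RNode v f) (RNode v g)"

lemma riso_refl: "riso t t"
proof (induction t)
  case (RNode v f)
  show ?case
  proof (rule riso.intros[where \<pi> = id])
    show "bij_betw id (dom f) (dom f)" by simp
  next
    fix i s t assume "f i = Some s" "f (id i) = Some t"
    moreover have "f i \<in> range f" by (rule rangeI)
    ultimately show "riso s t" using RNode.IH[of "f i" s] by auto
  qed
qed

lemma riso_sym: "riso s t \<Longrightarrow> riso t s"
proof (induction rule: riso.induct)
  case (riso \<pi> f g v)
  let ?\<rho> = "inv_into (dom f) \<pi>"
  show ?case
  proof (rule riso.intros[where \<pi> = ?\<rho>])
    show "bij_betw ?\<rho> (dom g) (dom f)"
      using riso.hyps(1) by (rule bij_betw_inv_into)
  next
    fix i s t assume a: "g i = Some s" "f (?\<rho> i) = Some t"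
    then have "i \<in> dom g" by auto
    then have "\<pi> (?\<rho> i) = i"
      using riso.hyps(1) by (simp add: bij_betw_inv_into_right)
    then show "riso s t" using riso.IH a by auto
  qed
qed

lemma riso_trans: "riso s t \<Longrightarrow> riso t u \<Longrightarrow> riso s u"
proof (induction arbitrary: u rule: riso.induct)
  case (riso \<pi> f g v)
  from riso.prems obtain \<rho> e where u: "u = RNode v e"
    and \<rho>: "bij_betw \<rho> (dom g) (dom e)"
    and r: "\<And>i s t. g i = Some s \<Longrightarrow> e (\<rho> i) = Some t \<Longrightarrow> riso s t"
    by (cases rule: riso.cases) auto
  show ?case unfolding u
  proof (rule riso.intros[where \<pi> = "\<rho> \<circ> \<pi>"])
    show "bij_betw (\<rho> \<circ> \<pi>) (dom f) (dom e)"
      using riso.hyps(1) \<rho> by (rule bij_betw_trans)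
  next
    fix i s t assume a: "f i = Some s" "e ((\<rho> \<circ> \<pi>) i) = Some t"
    then have "\<pi> i \<in> dom g" using riso.hyps(1) by (auto dest: bij_betwE)
    then obtain m where m: "g (\<pi> i) = Some m" by auto
    show "riso s t" using riso.IH[OF a(1) m] r[OF m] a(2) by simp
  qed
qed

text \<open>Leaves are the nodes without children; \<open>rpath t p\<close> says that \<open>p\<close> is the concatenation of the
  labels along a path of \<open>t\<close> from the root to a leaf.\<close>

inductive rpath :: "raw_tree \<Rightarrow> int vec \<Rightarrow> bool" where
  "rpath (RNode v Map.empty) v"
| "f i = Some t \<Longrightarrow> rpath t p \<Longrightarrow> rpath (RNode v f) (v @\<^sub>v p)"

inductive raddress :: "raw_tree \<Rightarrow> nat list \<Rightarrow> bool" where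
  "raddress t []"
| "f i = Some t \<Longrightarrow> raddress t p \<Longrightarrow> raddress (RNode v f) (i # p)"

inductive rtight :: "raw_tree \<Rightarrow> bool" where
  "(\<And>i j s t. f i = Some s \<Longrightarrow> f j = Some t \<Longrightarrow> i \<noteq> j \<Longrightarrow> rlabel s \<noteq> rlabel t) \<Longrightarrow>
   (\<And>i s. f i = Some s \<Longrightarrow> rtight s) \<Longrightarrow>
   rtight (RNode v f)"

lemma riso_label: "riso s t \<Longrightarrow> rlabel s = rlabel t"
  by (auto elim: riso.cases)

lemma riso_path: "riso s t \<Longrightarrow> rpath s p \<Longrightarrow> rpath t p"
proof (induction arbitrary: p rule: riso.induct)
  case (riso \<pi> f g v)
  from riso.prems show ?case
  proof (cases rule: rpath.cases)
    case 1
    then have "dom g = {}" using riso.hyps(1) by (simp add: bij_betw_def)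
    then have "g = Map.empty" by simp
    then show ?thesis using 1 by (auto intro: rpath.intros)
  next
    case (2 i t q)
    then have "\<pi> i \<in> dom g" using riso.hyps(1) by (auto dest: bij_betwE)
    then obtain m where m: "g (\<pi> i) = Some m" by auto
    then have "rpath m q" using riso.IH[OF 2(2) m] 2(3) by simp
    then show ?thesis using m 2(1) by (auto intro: rpath.intros)
  qed
qed

lemma raddress_RNode:
  "{p. raddress (RNode v f) p} = insert [] (\<Union>i\<in>dom f. (#) i ` {p. raddress (the (f i)) p})"
proof (intro equalityI subsetI)
  fix p assume "p \<in> {p. raddress (RNode v f) p}"
  then have "raddress (RNode v f) p" by simp
  then show "p \<in> insert [] (\<Union>i\<in>dom f. (#) i ` {p. raddress (the (f i)) p})"
    by (cases rule: raddress.cases) (auto intro!: bexI)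
next
  fix p assume "p \<in> insert [] (\<Union>i\<in>dom f. (#) i ` {p. raddress (the (f i)) p})"
  then show "p \<in> {p. raddress (RNode v f) p}" by (auto intro: raddress.intros)
qed

lemma finite_raddress_RNode:
  "finite {p. raddress (RNode v f) p} \<longleftrightarrow>
     finite (dom f) \<and> (\<forall>i t. f i = Some t \<longrightarrow> finite {p. raddress t p})"
proof
  assume fin: "finite {p. raddress (RNode v f) p}"
  have "(\<lambda>i. [i]) ` dom f \<subseteq> {p. raddress (RNode v f) p}"
    by (auto intro: raddress.intros)
  then have "finite ((\<lambda>i. [i]) ` dom f)" using fin finite_subset by blast
  then have "finite (dom f)" by (rule finite_imageD) (auto simp: inj_on_def)
  moreover have "finite {p. raddress t p}" if "f i = Some t" for i t
  proof -
    have "(#) i ` {p. raddress t p} \<subseteq> {p. raddress (RNode v f) p}"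
      using that by (auto intro: raddress.intros)
    then have "finite ((#) i ` {p. raddress t p})" using fin finite_subset by blast
    then show ?thesis by (rule finite_imageD) (auto simp: inj_on_def)
  qed
  ultimately show "finite (dom f) \<and> (\<forall>i t. f i = Some t \<longrightarrow> finite {p. raddress t p})" by blast
next
  assume "finite (dom f) \<and> (\<forall>i t. f i = Some t \<longrightarrow> finite {p. raddress t p})"
  then show "finite {p. raddress (RNode v f) p}"
    unfolding raddress_RNode by auto
qed

lemma riso_finite: "riso s t \<Longrightarrow> finite {p. raddress s p} \<Longrightarrow> finite {p. raddress t p}"
proof (induction rule: riso.induct)
  case (riso \<pi> f g v)
  from riso.prems have fin: "finite (dom f)"
    and kids: "\<And>i t. f i = Some t \<Longrightarrow> finite {p. raddress t p}"
    by (auto simp: finite_raddress_RNode)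
  have "finite (dom g)" using fin riso.hyps(1) bij_betw_finite by blast
  moreover have "finite {p. raddress t p}" if t: "g j = Some t" for j t
  proof -
    have "j \<in> \<pi> ` dom f" using t riso.hyps(1) by (auto simp: bij_betw_def)
    then obtain i s where "f i = Some s" "\<pi> i = j" by auto
    then show ?thesis using riso.IH kids t by blast
  qed
  ultimately show ?case by (simp add: finite_raddress_RNode)
qed

lemma riso_tight: "riso s t \<Longrightarrow> rtight s \<Longrightarrow> rtight t"
proof (induction rule: riso.induct)
  case (riso \<pi> f g v)
  have pre: "\<exists>i s. f i = Some s \<and> \<pi> i = j" if "g j = Some t" for j t
  proof -
    have "j \<in> \<pi> ` dom f" using that riso.hyps(1) by (auto simp: bij_betw_def)
    then show ?thesis by auto
  qed
  from riso.prems have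
    d: "\<And>i j s t. f i = Some s \<Longrightarrow> f j = Some t \<Longrightarrow> i \<noteq> j \<Longrightarrow> rlabel s \<noteq> rlabel t" and
    r: "\<And>i s. f i = Some s \<Longrightarrow> rtight s"
    by (auto elim: rtight.cases)
  show ?case
  proof (rule rtight.intros)
    fix i j s t assume a: "g i = Some s" "g j = Some t" "i \<noteq> j"
    obtain i' s' where i': "f i' = Some s'" "\<pi> i' = i" using pre[OF a(1)] by blast
    obtain j' t' where j': "f j' = Some t'" "\<pi> j' = j" using pre[OF a(2)] by blast
    have "rlabel s' = rlabel s" "rlabel t' = rlabel t"
      using riso.hyps(2) i' j' a riso_label by blast+
    then show "rlabel s \<noteq> rlabel t" using d[OF i'(1) j'(1)] i' j' a(3) by auto
  next
    fix i s assume a: "g i = Some s"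
    then show "rtight s" using pre[OF a] riso.IH r by blast
  qed
qed

quotient_type vtree = raw_tree / riso
  by (rule equivpI) (auto simp: reflp_def symp_def transp_def
      intro: riso_refl riso_sym riso_trans)

lift_definition tree_root :: "vtree \<Rightarrow> int vec" is rlabel
  by (rule riso_label)

lift_definition paths :: "vtree \<Rightarrow> int vec set" is "\<lambda>t. {p. rpath t p}"
  using riso_path riso_sym by blast

lift_definition finite_tree :: "vtree \<Rightarrow> bool" is "\<lambda>t. finite {p. raddress t p}"
  using riso_finite riso_sym by blast

lift_definition tight :: "vtree \<Rightarrow> bool" is rtight
  using riso_tight riso_sym by blast

definition subtrees :: "vtree \<Rightarrow> vtree set" where
  "subtrees S = {abs_vtree t | r i t. S = abs_vtree r \<and> rkids r i = Some t}"

section \<open>Vector-trees\<close>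

fun vector_tree :: "(nat \<Rightarrow> nat) \<Rightarrow> nat \<Rightarrow> vtree \<Rightarrow> bool" where
  "vector_tree n 0 S \<longleftrightarrow> tree_root S \<in> carrier_vec (n 0) \<and> subtrees S = {}"
| "vector_tree n (Suc h) S \<longleftrightarrow> tree_root S \<in> carrier_vec (n (Suc h)) \<and> subtrees S \<noteq> {} \<and>
     (\<forall>S'\<in>subtrees S. vector_tree n h S')"

fun labels_at :: "nat \<Rightarrow> vtree \<Rightarrow> int vec set" where
  "labels_at 0 S = {tree_root S}"
| "labels_at (Suc s) S = (\<Union>S'\<in>subtrees S. labels_at s S')"

text \<open>The labels of a set of vector-trees, tagged with the distance from the root, so that
  they live in the same disjoint union as \<^const>\<open>H_inf\<close>.\<close>

definition tree_blocks :: "vtree set \<Rightarrow> (nat \<times> int vec) set" where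
  "tree_blocks G = {(s, v). \<exists>S\<in>G. v \<in> labels_at s S}"

text \<open>\<open>block_subtree n N h z r \<alpha>\<close> is the part of $\mathcal{T}(z)$ below the node \<open>\<alpha>\<close>, where \<open>r\<close> is
  the number of levels below \<open>\<alpha>\<close>, that is, \<open>length \<alpha> + r = h\<close>.\<close>

primrec block_subtree ::
  "(nat \<Rightarrow> nat) \<Rightarrow> nat \<Rightarrow> nat \<Rightarrow> int vec \<Rightarrow> nat \<Rightarrow> nat list \<Rightarrow> raw_tree" where
  "block_subtree n N h z 0 \<alpha> = RNode (block n N h z \<alpha>) Map.empty"
| "block_subtree n N h z (Suc r) \<alpha> = RNode (block n N h z \<alpha>)
     (\<lambda>i. if i \<in> {1..N} then Some (block_subtree n N h z r (\<alpha> @ [i])) else None)"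

definition tree_of_vec :: "(nat \<Rightarrow> nat) \<Rightarrow> nat \<Rightarrow> nat \<Rightarrow> int vec \<Rightarrow> vtree" where
  "tree_of_vec n N h z = abs_vtree (block_subtree n N h z h [])"

definition tree_span :: "(nat \<Rightarrow> nat) \<Rightarrow> nat \<Rightarrow> nat \<Rightarrow> vtree \<Rightarrow> int vec set" where
  "tree_span n h N S =
     {z \<in> carrier_vec (stage_dim n h N). paths (tree_of_vec n N h z) \<subseteq> paths S}"

definition trees_span :: "(nat \<Rightarrow> nat) \<Rightarrow> nat \<Rightarrow> nat \<Rightarrow> vtree set \<Rightarrow> int vec set" where
  "trees_span n h N G = (\<Union>S\<in>G. tree_span n h N S)"

text \<open>$\mathcal{T}(V)$, for non-empty $V\subseteq\mathbb{Z}^{n(h)}$ whose elements agree in the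
  first \<open>n h\<close> coordinates.\<close>

definition tree_of_paths :: "(nat \<Rightarrow> nat) \<Rightarrow> nat \<Rightarrow> int vec set \<Rightarrow> vtree" where
  "tree_of_paths n h V = (THE S. vector_tree n h S \<and> tight S \<and> paths S = V)"

text \<open>Existence and uniqueness of $\mathcal{T}(V)$.\<close>

lemma subtrees_abs: "subtrees (abs_vtree (RNode v f)) = {abs_vtree t | t i. f i = Some t}"
proof (intro equalityI subsetI)
  fix S assume "S \<in> subtrees (abs_vtree (RNode v f))"
  then obtain r i t where r: "abs_vtree (RNode v f) = abs_vtree r" "rkids r i = Some t" "S = abs_vtree t"
    unfolding subtrees_def by blast
  have "riso r (RNode v f)" using r(1) by (metis vtree.abs_eq_iff)
  then show "S \<in> {abs_vtree t | t i. f i = Some t}"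
  proof (cases rule: riso.cases)
    case (riso \<pi> g)
    have "\<pi> i \<in> dom f" using riso r(2) by (auto dest: bij_betwE)
    then obtain t' where "f (\<pi> i) = Some t'" by auto
    moreover from this have "riso t t'" using riso r(2) by auto
    ultimately show ?thesis using r(3) vtree.abs_eq_iff by blast
  qed
next
  fix S assume "S \<in> {abs_vtree t | t i. f i = Some t}"
  then obtain t i where "f i = Some t" "S = abs_vtree t" by blast
  then show "S \<in> subtrees (abs_vtree (RNode v f))"
    unfolding subtrees_def by (intro CollectI exI[of _ t] exI[of _ "RNode v f"] exI[of _ i]) simp
qed

lemma vector_tree_abs_Suc: "vector_tree n (Suc h) (abs_vtree (RNode v f)) \<longleftrightarrow>
  v \<in> carrier_vec (n (Suc h)) \<and> dom f \<noteq> {} \<and> (\<forall>i t. f i = Some t \<longrightarrow> vector_tree n h (abs_vtree t))"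
proof -
  have "{abs_vtree t | t i. f i = Some t} \<noteq> {} \<longleftrightarrow> dom f \<noteq> {}" by (auto simp: dom_def)
  then show ?thesis by (auto simp: subtrees_abs tree_root.abs_eq)
qed

lemma vector_tree_abs_0: "vector_tree n 0 (abs_vtree (RNode v f)) \<longleftrightarrow> v \<in> carrier_vec (n 0) \<and> f = Map.empty"
proof -
  have "{abs_vtree t | t i. f i = Some t} = {} \<longleftrightarrow> f = Map.empty"
    by (auto simp: fun_eq_iff) (metis not_None_eq)
  then show ?thesis by (simp add: subtrees_abs tree_root.abs_eq)
qed

declare vector_tree.simps [simp del]

lemma rtight_RNode: "rtight (RNode v f) \<longleftrightarrow> (\<forall>i j s t. f i = Some s \<longrightarrow> f j = Some t \<longrightarrow> rlabel s = rlabel t \<longrightarrow> i = j) \<and> (\<forall>i s. f i = Some s \<longrightarrow> rtight s)"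
  by (subst rtight.simps) blast

lemma rpath_RNode: "rpath (RNode v f) p \<longleftrightarrow>
  (f = Map.empty \<and> p = v) \<or> (\<exists>i t q. f i = Some t \<and> rpath t q \<and> p = v @\<^sub>v q)"
  by (subst rpath.simps) auto

lemma rpath_ex: "vector_tree n h (abs_vtree t) \<Longrightarrow> \<exists>p. rpath t p"
proof (induction h arbitrary: t)
  case 0 then show ?case by (cases t) (auto simp: vector_tree_abs_0 rpath_RNode)
next
  case (Suc h)
  obtain v f where t: "t = RNode v f" by (cases t)
  from Suc.prems obtain i s where "f i = Some s" "vector_tree n h (abs_vtree s)"
    unfolding t vector_tree_abs_Suc dom_def by blast
  then show ?case using Suc.IH[of s] unfolding t rpath_RNode by blast
qed

lemma vec_first_app: "v \<in> carrier_vec m \<Longrightarrow> vec_first (v @\<^sub>v p) m = v"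
  by (auto simp: vec_first_def)

lemma rpath_first: "vector_tree n h (abs_vtree t) \<Longrightarrow> rpath t p \<Longrightarrow> vec_first p (n h) = rlabel t"
proof (cases h)
  case 0
  assume "vector_tree n h (abs_vtree t)" "rpath t p"
  then show ?thesis using 0 by (cases t) (auto simp: vector_tree_abs_0 rpath_RNode vec_first_def)
next
  case (Suc m)
  assume "vector_tree n h (abs_vtree t)" "rpath t p"
  then show ?thesis using Suc by (cases t) (auto simp: vector_tree_abs_Suc rpath_RNode vec_first_app)
qed

lemma rlabel_carrier: "vector_tree n h (abs_vtree t) \<Longrightarrow> rlabel t \<in> carrier_vec (n h)"
  by (cases h; cases t) (auto simp: vector_tree_abs_Suc vector_tree_abs_0)

lemma path_dim_Suc: "path_dim n (Suc h) = n (Suc h) + path_dim n h"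
  by (simp add: path_dim_def)

lemma rpath_carrier: "vector_tree n h (abs_vtree t) \<Longrightarrow> rpath t p \<Longrightarrow> p \<in> carrier_vec (path_dim n h)"
proof (induction h arbitrary: t p)
  case 0 then show ?case by (cases t) (auto simp: vector_tree_abs_0 rpath_RNode path_dim_def)
next
  case (Suc h)
  obtain v f where t: "t = RNode v f" by (cases t)
  then show ?case using Suc by (auto simp: vector_tree_abs_Suc rpath_RNode path_dim_Suc intro!: append_carrier_vec) 
qed

lemma riso_of_paths: 
  "vector_tree n h (abs_vtree s) \<Longrightarrow> vector_tree n h (abs_vtree t) \<Longrightarrow> rtight s \<Longrightarrow> rtight t \<Longrightarrow>
   Collect (rpath s) = Collect (rpath t) \<Longrightarrow> riso s t"
proof (induction h arbitrary: s t)
  case 0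
  then obtain v w where st: "s = RNode v Map.empty" "t = RNode w Map.empty"
    by (cases s; cases t) (auto simp: vector_tree_abs_0)
  have "v = w" using 0 unfolding st by (auto simp: rpath_RNode)
  then show ?case using st riso_refl by simp
next
  case (Suc h)
  obtain v f where s: "s = RNode v f" by (cases s)
  obtain w g where t: "t = RNode w g" by (cases t)
  from Suc.prems(1) have v: "v \<in> carrier_vec (n (Suc h))" and fne: "dom f \<noteq> {}" 
    and ft: "\<And>i t. f i = Some t \<Longrightarrow> vector_tree n h (abs_vtree t)" by (auto simp: s vector_tree_abs_Suc)
  from Suc.prems(2) have w: "w \<in> carrier_vec (n (Suc h))" and gne: "dom g \<noteq> {}" 
    and gt: "\<And>i t. g i = Some t \<Longrightarrow> vector_tree n h (abs_vtree t)" by (auto simp: t vector_tree_abs_Suc)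
  from Suc.prems(3) have fd: "\<And>i j a b. f i = Some a \<Longrightarrow> f j = Some b \<Longrightarrow> rlabel a = rlabel b \<Longrightarrow> i = j"
    and fr: "\<And>i a. f i = Some a \<Longrightarrow> rtight a" unfolding s rtight_RNode by blast+
  from Suc.prems(4) have gd: "\<And>i j a b. g i = Some a \<Longrightarrow> g j = Some b \<Longrightarrow> rlabel a = rlabel b \<Longrightarrow> i = j"
    and gr: "\<And>i a. g i = Some a \<Longrightarrow> rtight a" unfolding t rtight_RNode by blast+
  have vw: "v = w"
    using rpath_first[OF Suc.prems(1)] rpath_first[OF Suc.prems(2)] rpath_ex[OF Suc.prems(1)] Suc.prems(5)
    unfolding s t by auto
  have P: "(\<exists>i a. f i = Some a \<and> rpath a q) \<longleftrightarrow> (\<exists>i a. g i = Some a \<and> rpath a q)" for q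
  proof -
    have "rpath s (v @\<^sub>v q) \<longleftrightarrow> rpath t (v @\<^sub>v q)" using Suc.prems(5) by auto
    moreover have "rpath s (v @\<^sub>v q) \<longleftrightarrow> (\<exists>i a. f i = Some a \<and> rpath a q)"
      using fne unfolding s rpath_RNode using append_vec_eq[OF v v] by auto
    moreover have "rpath t (v @\<^sub>v q) \<longleftrightarrow> (\<exists>i a. g i = Some a \<and> rpath a q)"
      using gne unfolding t rpath_RNode vw using append_vec_eq[OF w w] by auto
    ultimately show ?thesis by blast
  qed
  have fg: "\<exists>j b. g j = Some b \<and> rlabel b = rlabel a" if th: "f i = Some a" for i a
  proof -
    obtain q where q: "rpath a q" using rpath_ex[OF ft[OF th]] by blast
    then obtain j b where b: "g j = Some b" "rpath b q" using P th by blast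
    then show ?thesis using rpath_first[OF ft[OF th] q] rpath_first[OF gt[OF b(1)] b(2)] by auto
  qed
  have gf: "\<exists>j b. f j = Some b \<and> rlabel b = rlabel a" if th: "g i = Some a" for i a
  proof -
    obtain q where q: "rpath a q" using rpath_ex[OF gt[OF th]] by blast
    then obtain j b where b: "f j = Some b" "rpath b q" using P th by blast
    then show ?thesis using rpath_first[OF gt[OF th] q] rpath_first[OF ft[OF b(1)] b(2)] by auto
  qed
  define \<pi> where "\<pi> i = (SOME j. \<exists>b. g j = Some b \<and> rlabel b = rlabel (the (f i)))" for i
  have pi: "\<exists>b. g (\<pi> i) = Some b \<and> rlabel b = rlabel a" if "f i = Some a" for i a
    using someI_ex[OF fg[OF that]] that unfolding \<pi>_def by simp
  have bij: "bij_betw \<pi> (dom f) (dom g)"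
    unfolding bij_betw_def
  proof
    show "inj_on \<pi> (dom f)"
    proof (rule inj_onI)
      fix i j assume "i \<in> dom f" "j \<in> dom f" and e: "\<pi> i = \<pi> j"
      then obtain a b where "f i = Some a" "f j = Some b" by auto
      then show "i = j" using pi[of i a] pi[of j b] fd e by auto
    qed
    show "\<pi> ` dom f = dom g"
    proof
      show "\<pi> ` dom f \<subseteq> dom g" using pi by fastforce
      show "dom g \<subseteq> \<pi> ` dom f"
      proof
        fix j assume "j \<in> dom g"
        then obtain b where b: "g j = Some b" by auto
        obtain i a where a: "f i = Some a" "rlabel a = rlabel b" using gf[OF b] by blast
        then have "\<pi> i = j" using pi[OF a(1)] gd[OF _ b] a(2) by auto
        then show "j \<in> \<pi> ` dom f" using a by auto
      qed
    qed
  qed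
  show ?case unfolding s t vw
  proof (rule riso.intros[OF bij])
    fix i a b assume a: "f i = Some a" and b: "g (\<pi> i) = Some b"
    have l: "rlabel a = rlabel b" using pi[OF a] b by auto
    have "Collect (rpath a) = Collect (rpath b)"
    proof (intro Collect_cong iffI)
      fix q assume q: "rpath a q"
      then obtain j b' where b': "g j = Some b'" "rpath b' q" using P a by blast
      then have "rlabel b' = rlabel b" using rpath_first[OF ft[OF a] q] rpath_first[OF gt[OF b'(1)] b'(2)] l by simp
      then show "rpath b q" using gd[OF b'(1) b] b' b by auto
    next
      fix q assume q: "rpath b q"
      then obtain j b' where b': "f j = Some b'" "rpath b' q" using P b by blast
      then have "rlabel b' = rlabel a" using rpath_first[OF gt[OF b] q] rpath_first[OF ft[OF b'(1)] b'(2)] l by simp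
      then show "rpath a q" using fd[OF b'(1) a] b' a by auto
    qed
    then show "riso a b" using Suc.IH[OF ft[OF a] gt[OF b] fr[OF a] gr[OF b]] by blast
  qed
qed

lemma countable_carrier_vec: "countable (carrier_vec d :: int vec set)"
proof -
  have "carrier_vec d \<subseteq> range (vec_of_list :: int list \<Rightarrow> _)"
    by (metis UNIV_I image_eqI subsetI vec_list)
  then show ?thesis by (metis countable_subset countable_image countableI_type)
qed

lemma tree_of_paths_ex: "V \<noteq> {} \<Longrightarrow> V \<subseteq> carrier_vec (path_dim n h) \<Longrightarrow> \<forall>v\<in>V. vec_first v (n h) = r \<Longrightarrow>
  \<exists>t. vector_tree n h (abs_vtree t) \<and> rtight t \<and> Collect (rpath t) = V \<and> rlabel t = r"
proof (induction h arbitrary: V r)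
  case 0
  have "v = r" if "v \<in> V" for v
  proof -
    have "v \<in> carrier_vec (n 0)" using 0 that by (auto simp: path_dim_def)
    then have "vec_first v (n 0) = v" by (auto simp: vec_first_def)
    then show ?thesis using 0 that by auto
  qed
  then have "V = {r}" "r \<in> carrier_vec (n 0)" using 0 by (auto simp: path_dim_def)
  then show ?case
    by (intro exI[of _ "RNode r Map.empty"]) (auto simp: vector_tree_abs_0 rpath_RNode intro: rtight.intros)
next
  case (Suc h)
  have dec: "r \<in> carrier_vec (n (Suc h)) \<and> v = r @\<^sub>v vec_last v (path_dim n h)" if "v \<in> V" for v
  proof -
    have "v \<in> carrier_vec (n (Suc h) + path_dim n h)" using Suc.prems that by (auto simp: path_dim_Suc)
    then have "vec_first v (n (Suc h)) @\<^sub>v vec_last v (path_dim n h) = v" by simp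
    then show ?thesis using Suc.prems that by (metis vec_first_carrier)
  qed
  have r: "r \<in> carrier_vec (n (Suc h))" using dec Suc.prems by blast
  define Q where "Q = (\<lambda>v. vec_last v (path_dim n h)) ` V"
  have Qc: "Q \<subseteq> carrier_vec (path_dim n h)" by (auto simp: Q_def)
  have Qne: "Q \<noteq> {}" using Suc.prems by (simp add: Q_def)
  have VQ: "V = (\<lambda>q. r @\<^sub>v q) ` Q" unfolding Q_def using dec by force
  define W where "W = (\<lambda>q. vec_first q (n h)) ` Q"
  have Wc: "countable W" unfolding W_def
    by (intro countable_image countable_subset[OF Qc] countable_carrier_vec)
  have "\<forall>w\<in>W. \<exists>t. vector_tree n h (abs_vtree t) \<and> rtight t \<and>
      Collect (rpath t) = {q\<in>Q. vec_first q (n h) = w} \<and> rlabel t = w"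
    using Qc by (intro ballI Suc.IH) (auto simp: W_def)
  from bchoice[OF this] obtain F where F0: "\<forall>w\<in>W. vector_tree n h (abs_vtree (F w)) \<and> rtight (F w) \<and>
      Collect (rpath (F w)) = {q\<in>Q. vec_first q (n h) = w} \<and> rlabel (F w) = w" by blast
  have F: "\<And>w. w \<in> W \<Longrightarrow> vector_tree n h (abs_vtree (F w))" "\<And>w. w \<in> W \<Longrightarrow> rtight (F w)"
      "\<And>w. w \<in> W \<Longrightarrow> Collect (rpath (F w)) = {q\<in>Q. vec_first q (n h) = w}" "\<And>w. w \<in> W \<Longrightarrow> rlabel (F w) = w"
    using F0 by simp_all
  define f where "f i = (if i \<in> to_nat_on W ` W then Some (F (from_nat_into W i)) else None)" for i
  have f: "f i = Some t \<longleftrightarrow> (\<exists>w\<in>W. i = to_nat_on W w \<and> t = F w)" for i t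
    unfolding f_def using Wc by auto
  have dom: "dom f \<noteq> {}" using Qne unfolding f_def W_def by (auto simp: dom_def)
  have rp: "rpath (RNode r f) p \<longleftrightarrow> p \<in> V" for p
  proof -
    have "rpath (RNode r f) p \<longleftrightarrow> (\<exists>w\<in>W. \<exists>q. rpath (F w) q \<and> p = r @\<^sub>v q)"
      using dom unfolding rpath_RNode f by auto
    also have "\<dots> \<longleftrightarrow> (\<exists>w\<in>W. \<exists>q. q \<in> Q \<and> vec_first q (n h) = w \<and> p = r @\<^sub>v q)"
      using F(3) by (auto simp: set_eq_iff)
    also have "\<dots> \<longleftrightarrow> p \<in> V" unfolding VQ W_def by auto
    finally show ?thesis .
  qed
  have tt: "rtight (RNode r f)"
  proof (rule rtight.intros)
    fix i j s t assume "f i = Some s" "f j = Some t" "i \<noteq> j"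
    then show "rlabel s \<noteq> rlabel t" unfolding f using F(4) by auto
  next
    fix i s assume "f i = Some s" then show "rtight s" unfolding f using F(2) by auto
  qed
  show ?case
    using rp tt dom r F(1) by (intro exI[of _ "RNode r f"]) (auto simp: vector_tree_abs_Suc f)
qed

lemma tree_of_paths_ex1:
  assumes "V \<noteq> {}" "V \<subseteq> carrier_vec (path_dim n h)" "\<forall>v\<in>V. vec_first v (n h) = r"
  shows "\<exists>!S. vector_tree n h S \<and> tight S \<and> paths S = V"
proof -
  obtain t where t: "vector_tree n h (abs_vtree t)" "rtight t" "Collect (rpath t) = V" using tree_of_paths_ex[OF assms] by blast
  show ?thesis
  proof (rule ex1I[of _ "abs_vtree t"])
    show "vector_tree n h (abs_vtree t) \<and> tight (abs_vtree t) \<and> paths (abs_vtree t) = V"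
      using t by (simp add: tight.abs_eq paths.abs_eq)
    fix S assume S: "vector_tree n h S \<and> tight S \<and> paths S = V"
    obtain s where s: "S = abs_vtree s" by (metis Quotient_abs_rep Quotient_vtree)
    have "riso s t" using S t unfolding s by (intro riso_of_paths) (auto simp: tight.abs_eq paths.abs_eq)
    then show "S = abs_vtree t" using s by (simp add: vtree.abs_eq_iff)
  qed
qed

declare vector_tree.simps [simp]

fun reduces :: "nat \<Rightarrow> vtree \<Rightarrow> vtree \<Rightarrow> bool" where
  "reduces 0 S U \<longleftrightarrow> tree_root S \<sqsubseteq>\<^sub>c tree_root U"
| "reduces (Suc h) S U \<longleftrightarrow> tree_root S \<sqsubseteq>\<^sub>c tree_root U \<and>
     (\<forall>U'\<in>subtrees U. \<exists>S'\<in>subtrees S. reduces h S' U')"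

definition tree_neg :: "(nat \<Rightarrow> nat) \<Rightarrow> nat \<Rightarrow> vtree \<Rightarrow> vtree" where
  "tree_neg n h S = tree_of_paths n h {- v | v. v \<in> paths S}"

definition tree_add :: "(nat \<Rightarrow> nat) \<Rightarrow> nat \<Rightarrow> vtree \<Rightarrow> vtree \<Rightarrow> vtree" where
  "tree_add n h S U = tree_of_paths n h {v + w | v w. v \<in> paths S \<and> w \<in> paths U}"

text \<open>Only meaningful when \<open>reduces h U S\<close>.\<close>

definition tree_diff :: "(nat \<Rightarrow> nat) \<Rightarrow> nat \<Rightarrow> vtree \<Rightarrow> vtree \<Rightarrow> vtree" where
  "tree_diff n h S U =
     tree_of_paths n h {v - w | v w. v \<in> paths S \<and> w \<in> paths U \<and> w \<sqsubseteq>\<^sub>c v}"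

definition symmetric_trees :: "(nat \<Rightarrow> nat) \<Rightarrow> nat \<Rightarrow> vtree set \<Rightarrow> bool" where
  "symmetric_trees n h G \<longleftrightarrow> (\<forall>S\<in>G. tree_neg n h S \<in> G)"

definition symmetric_vecs :: "int vec set \<Rightarrow> bool" where
  "symmetric_vecs F \<longleftrightarrow> (\<forall>v\<in>F. - v \<in> F)"

section \<open>The procedures\<close>

text \<open>All procedures are non-deterministic and are therefore given by relations. A procedure
  with step relation \<open>R\<close> terminates from a state if it has no infinite run from there.\<close>

definition terminates_from :: "('s \<Rightarrow> 's \<Rightarrow> bool) \<Rightarrow> 's \<Rightarrow> bool" where
  "terminates_from R x \<longleftrightarrow> \<not> (\<exists>f. f 0 = x \<and> (\<forall>i::nat. R (f i) (f (Suc i))))"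

definition nf_step :: "(nat \<Rightarrow> nat) \<Rightarrow> nat \<Rightarrow> vtree set \<Rightarrow> vtree \<Rightarrow> vtree \<Rightarrow> bool" where
  "nf_step n h G S S' \<longleftrightarrow>
     (\<exists>U\<in>G. reduces h U S \<and> tree_root U \<noteq> 0\<^sub>v (n h) \<and> S' = tree_diff n h S U)"

definition normal_form :: "(nat \<Rightarrow> nat) \<Rightarrow> nat \<Rightarrow> vtree \<Rightarrow> vtree set \<Rightarrow> vtree \<Rightarrow> bool" where
  "normal_form n h S G U \<longleftrightarrow> (nf_step n h G)\<^sup>*\<^sup>* S U \<and> (\<nexists>U'. nf_step n h G U U')"

inductive completion_step ::
  "(nat \<Rightarrow> nat) \<Rightarrow> nat \<Rightarrow> vtree set \<times> vtree set \<Rightarrow> vtree set \<times> vtree set \<Rightarrow> bool"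
  for n h where
  discard: "S \<in> C \<Longrightarrow> normal_form n h S G U \<Longrightarrow> tree_root U = 0\<^sub>v (n h) \<Longrightarrow>
    completion_step n h (G, C) (G, C - {S})"
| enlarge: "S \<in> C \<Longrightarrow> normal_form n h S G U \<Longrightarrow> tree_root U \<noteq> 0\<^sub>v (n h) \<Longrightarrow>
    G' = G \<union> {U, tree_neg n h U} \<Longrightarrow>
    C' = (C - {S}) \<union> (\<Union>S'\<in>G'. {tree_add n h S' U, tree_add n h S' (tree_neg n h U)}) \<Longrightarrow>
    completion_step n h (G, C) (G', C')"

definition completion_init ::
  "(nat \<Rightarrow> nat) \<Rightarrow> nat \<Rightarrow> vtree set \<Rightarrow> vtree set \<times> vtree set" where
  "completion_init n h G = (G, {tree_add n h S U | S U. S \<in> G \<and> U \<in> G})"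

definition completion_output ::
  "(nat \<Rightarrow> nat) \<Rightarrow> nat \<Rightarrow> vtree set \<Rightarrow> vtree set \<Rightarrow> bool" where
  "completion_output n h G G' \<longleftrightarrow>
     (completion_step n h)\<^sup>*\<^sup>* (completion_init n h G) (G', {})"

text \<open>Neither the while loop of the completion procedure nor any of the calls of the normal form
  procedure made in it runs forever.\<close>

definition completion_terminates :: "(nat \<Rightarrow> nat) \<Rightarrow> nat \<Rightarrow> vtree set \<Rightarrow> bool" where
  "completion_terminates n h G \<longleftrightarrow>
     terminates_from (completion_step n h) (completion_init n h G) \<and>
     (\<forall>G' C' S. (completion_step n h)\<^sup>*\<^sup>* (completion_init n h G) (G', C') \<longrightarrow> S \<in> C' \<longrightarrow>
        terminates_from (nf_step n h G') S)"

definition generates :: "nat \<Rightarrow> int vec set \<Rightarrow> int vec set \<Rightarrow> bool" where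
  "generates d F M \<longleftrightarrow>
     F \<subseteq> M \<and> LinearCombinations.module.span class_ring (module_vec TYPE(int) d) F = M"

text \<open>\<open>stage_input T n i G' G\<close>: the completion procedure may be called with input \<open>G\<close> in stage \<open>i\<close>,
  if \<open>G'\<close> is the output of the previous stage (irrelevant for \<open>i = 0\<close>).\<close>

fun stage_input ::
  "(nat \<Rightarrow> int mat) \<Rightarrow> (nat \<Rightarrow> nat) \<Rightarrow> nat \<Rightarrow> vtree set \<Rightarrow> vtree set \<Rightarrow> bool" where
  "stage_input T n 0 G' G \<longleftrightarrow>
     (\<exists>F. finite F \<and> symmetric_vecs F \<and>
        generates (path_dim n 0) F (mat_kernel (stage_mat T 0 1)) \<and>
        G = {tree_of_paths n 0 {v} | v. v \<in> F})"
| "stage_input T n (Suc i) G' G \<longleftrightarrow>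
     (\<exists>F. finite F \<and> symmetric_vecs F \<and>
        generates (path_dim n (Suc i)) F (mat_kernel (stage_mat T (Suc i) 1)) \<and>
        (\<exists>B\<subseteq>F. generates (path_dim n (Suc i)) B
           (mat_kernel (stage_mat T (Suc i) 1) \<inter>
             {0\<^sub>v (n (Suc i)) @\<^sub>v v | v. v \<in> carrier_vec (path_dim n i)})) \<and>
        G = {tree_of_paths n (Suc i)
               {0\<^sub>v (n (Suc i)) @\<^sub>v v | v. v = 0\<^sub>v (path_dim n i) \<or> (\<exists>S\<in>G'. v \<in> paths S)}}
            \<union> {tree_of_paths n (Suc i) {v} | v. v \<in> F})"

text \<open>\<open>stages_computed T n m Gs\<close>: some run of the algorithm yields \<open>Gs i\<close> in stage \<open>i\<close>, for all
  \<open>i < m\<close>.\<close>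

definition stages_computed ::
  "(nat \<Rightarrow> int mat) \<Rightarrow> (nat \<Rightarrow> nat) \<Rightarrow> nat \<Rightarrow> (nat \<Rightarrow> vtree set) \<Rightarrow> bool" where
  "stages_computed T n m Gs \<longleftrightarrow>
     (\<forall>i<m. \<exists>G. stage_input T n i (Gs (i - 1)) G \<and> completion_output n i G (Gs i))"

definition algorithm_output ::
  "(nat \<Rightarrow> int mat) \<Rightarrow> (nat \<Rightarrow> nat) \<Rightarrow> nat \<Rightarrow> (nat \<Rightarrow> vtree set) \<Rightarrow> bool" where
  "algorithm_output T n k Gs \<longleftrightarrow> stages_computed T n (Suc k) Gs"

definition algorithm_terminates :: "(nat \<Rightarrow> int mat) \<Rightarrow> (nat \<Rightarrow> nat) \<Rightarrow> nat \<Rightarrow> bool" where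
  "algorithm_terminates T n k \<longleftrightarrow>
     (\<forall>i\<le>k. \<forall>Gs G. stages_computed T n i Gs \<longrightarrow> stage_input T n i (Gs (i - 1)) G \<longrightarrow>
        completion_terminates n i G)"

end

theory Submission
  imports Defs "HOL-Library.Ramsey"
begin

text \<open>
  The blocks of a vector \<open>z\<close> along the path of \<open>T(z)\<close> from the root to a leaf \<open>\<alpha>\<close> form a
  vector \<open>path_vec n N h z \<alpha>\<close> of dimension \<open>n(h)\<close>. Membership in the kernel of \<open>A\<^sub>h\<^sub>,\<^sub>N\<close> means
  that all these path vectors lie in the kernel of \<open>A\<^sub>h\<^sub>,\<^sub>1\<close> (\<open>mat_kernel_iff_paths\<close>), and
  membership in \<open>\<langle>S\<rangle>\<^sub>N\<close> means that they are all paths of \<open>S\<close> (\<open>tree_span_iff\<close>). So a finite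
  tree describes kernel vectors for all \<open>N\<close> at once, and the operations on trees imitate those
  on vectors: sums of members of \<open>\<langle>S\<rangle>\<^sub>N\<close> and \<open>\<langle>U\<rangle>\<^sub>N\<close> lie in \<open>\<langle>S + U\<rangle>\<^sub>N\<close>, and if \<open>U\<close> reduces
  \<open>S\<close>, then every \<open>z\<close> in \<open>\<langle>S\<rangle>\<^sub>N\<close> splits conformally into some \<open>y\<close> in \<open>\<langle>U\<rangle>\<^sub>N\<close> and the
  difference of \<open>z\<close> and \<open>y\<close>, which lies in \<open>\<langle>S - U\<rangle>\<^sub>N\<close> (\<open>tree_span_diff\<close>).

  Correctness of one stage is Pottier's argument. Let \<open>X\<close> generate the kernel additively and
  let every sum of two elements of \<open>X\<close> be a conformal sum of elements of \<open>X\<close>. Given a kernel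
  vector as a sum of elements of \<open>X\<close>, replace two summands with opposite signs in some
  coordinate by a conformal sum for their sum. The total norm decreases, so in the end the
  kernel vector is a conformal sum of elements of \<open>X\<close> (\<open>conformal_sum_of_mset_sum\<close>); if it is
  in the Graver basis, then by minimality it is one of the summands
  (\<open>graver_in_conformal_generators\<close>). Take \<open>X = \<langle>G\<rangle>\<^sub>N\<close> for the output \<open>G\<close> of a stage. The
  completion procedure has reduced each \<open>S + U\<close> to a tree that is in \<open>G\<close> or has root \<open>0\<close>, so
  only kernel vectors with first block \<open>0\<close> are left to be decomposed. They fall apart into \<open>N\<close>
  kernel vectors of the previous stage, whose Graver basis elements are described by the tree
  \<open>T\<^sub>0\<close> in the input (\<open>stage_input_Suc_admissible\<close>). Such vectors also suffice to see that \<open>X\<close>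
  generates the kernel: subtracting vectors all of whose path vectors are the same generator
  in \<open>F\<close> leads to first block \<open>0\<close>.

  Termination of the normal form procedure is clear from the norm of the root. In an infinite
  run of the completion procedure, infinitely many trees would be added, none of them
  reducible by an earlier one. That this is impossible says that the reducibility order is a
  well-quasi-order on trees of height \<open>h\<close>. An induction on \<open>h\<close> needs a stronger property: sets
  of children are compared by asking for each element on the right for one below it on the
  left, and this need not be a well-quasi-order even if the order on the elements is one
  (Rado). As for better-quasi-orders, the induction works after replacing sequences by arrays
  indexed by \<open>m\<close>-element sets of natural numbers: passing to sets costs one index
  (\<open>array_wqo_powerset\<close>), and the order on vectors has the property for every \<open>m\<close>.
\<close>

section \<open>Reducibility is a well-quasi-order\<close>

text \<open>The order \<open>R\<close> is a well-quasi-order on \<open>A\<close> if this holds for \<open>m = 1\<close>: a sequence in \<open>A\<close> is a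
  family indexed by one-element sets, and \<open>X = {i, j}\<close> with \<open>i < j\<close> yields \<open>R (f {i}) (f
  {j})\<close>. For larger \<open>m\<close> the requirement is stronger; together they are the instance of being a
  better-quasi-order in which all index sets have a fixed finite size. The infinite index set
  \<open>Z\<close> is a parameter because Ramsey's theorem passes to infinite subsets.\<close>

definition array_wqo :: "nat \<Rightarrow> 'a set \<Rightarrow> ('a \<Rightarrow> 'a \<Rightarrow> bool) \<Rightarrow> bool" where
  "array_wqo m A R \<longleftrightarrow> (\<forall>Z f. infinite Z \<longrightarrow> (\<forall>X\<subseteq>Z. finite X \<longrightarrow> card X = m \<longrightarrow> f X \<in> A) \<longrightarrow>
     (\<exists>X\<subseteq>Z. finite X \<and> card X = Suc m \<and> R (f (X - {Max X})) (f (X - {Min X :: nat}))))"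

definition bad_array :: "nat \<Rightarrow> nat set \<Rightarrow> ('a \<Rightarrow> 'a \<Rightarrow> bool) \<Rightarrow> (nat set \<Rightarrow> 'a) \<Rightarrow> bool" where
  "bad_array m Z R f \<longleftrightarrow>
     (\<forall>X\<subseteq>Z. finite X \<longrightarrow> card X = Suc m \<longrightarrow> \<not> R (f (X - {Max X})) (f (X - {Min X})))"

lemma array_wqo_iff:
  "array_wqo m A R \<longleftrightarrow>
     (\<forall>Z f. infinite Z \<longrightarrow> (\<forall>X\<subseteq>Z. finite X \<longrightarrow> card X = m \<longrightarrow> f X \<in> A) \<longrightarrow> \<not> bad_array m Z R f)"
  unfolding array_wqo_def bad_array_def by simp

lemma array_wqoE:
  fixes Z :: "nat set"
  assumes "array_wqo m A R" "infinite Z" "\<And>X. X \<subseteq> Z \<Longrightarrow> finite X \<Longrightarrow> card X = m \<Longrightarrow> f X \<in> A"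
  obtains X where "X \<subseteq> Z" "finite X" "card X = Suc m" "R (f (X - {Max X})) (f (X - {Min X}))"
  using assms(1)[unfolded array_wqo_def, rule_format, of Z f] assms(2,3) by auto

lemma array_wqo_mono:
  assumes w: "array_wqo m A R" and imp: "\<And>x y. x \<in> A \<Longrightarrow> y \<in> A \<Longrightarrow> R x y \<Longrightarrow> R' x y"
  shows "array_wqo m A R'"
  unfolding array_wqo_def
proof (intro allI impI)
  fix Z :: "nat set" and f assume Z: "infinite Z" and f: "\<forall>X\<subseteq>Z. finite X \<longrightarrow> card X = m \<longrightarrow> f X \<in> A"
  obtain X where X: "X \<subseteq> Z" "finite X" "card X = Suc m" "R (f (X - {Max X})) (f (X - {Min X}))"
    by (rule array_wqoE[OF w Z, of f]) (simp add: f)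
  then have ne: "X \<noteq> {}" by auto
  have "f (X - {x}) \<in> A" if "x \<in> X" for x
    by (rule f[rule_format]) (use X that in auto)
  then have "R' (f (X - {Max X})) (f (X - {Min X}))"
    using X ne by (intro imp) simp_all
  then show "\<exists>X\<subseteq>Z. finite X \<and> card X = Suc m \<and> R' (f (X - {Max X})) (f (X - {Min X}))"
    using X by (intro exI[of _ X]) simp
qed

lemma array_wqo_image:
  assumes w: "array_wqo m B R" and g: "\<And>x. x \<in> A \<Longrightarrow> g x \<in> B"
  shows "array_wqo m A (\<lambda>x y. R (g x) (g y))"
  unfolding array_wqo_def
proof (intro allI impI)
  fix Z :: "nat set" and f assume Z: "infinite Z" and f: "\<forall>X\<subseteq>Z. finite X \<longrightarrow> card X = m \<longrightarrow> f X \<in> A"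
  obtain X where X: "X \<subseteq> Z" "finite X" "card X = Suc m" "R (g (f (X - {Max X}))) (g (f (X - {Min X})))"
    by (rule array_wqoE[OF w Z, of "\<lambda>X. g (f X)"]) (simp add: f g)
  then show "\<exists>X\<subseteq>Z. finite X \<and> card X = Suc m \<and> R (g (f (X - {Max X}))) (g (f (X - {Min X})))"
    by (intro exI[of _ X]) simp
qed

text \<open>Shifting a window of \<open>m\<close> consecutive elements of \<open>Z\<close> along \<open>Z\<close> turns an array without the
  required inequality into an infinite descent.\<close>

lemma array_wqo_nat: "array_wqo m (UNIV :: nat set) (\<le>)"
  unfolding array_wqo_def
proof (intro allI impI, rule ccontr)
  fix Z :: "nat set" and f :: "nat set \<Rightarrow> nat"
  assume Z: "infinite Z" and
    bad: "\<not> (\<exists>X\<subseteq>Z. finite X \<and> card X = Suc m \<and> f (X - {Max X}) \<le> f (X - {Min X}))"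
  define e where "e = enumerate Z"
  have e: "strict_mono e" "\<And>i. e i \<in> Z"
    using strict_mono_enumerate[OF Z] enumerate_in_set[OF Z] by (auto simp: e_def)
  then have inj: "inj e" by (simp add: strict_mono_imp_inj_on)
  define X where "X i = e ` {i..<i+m}" for i
  have "f (X (Suc i)) < f (X i)" for i
  proof -
    let ?Y = "e ` {i..i+m}"
    have mono: "mono e" using e(1) by (rule strict_mono_mono)
    have "Max ?Y = e (i+m)" by (rule Max_eqI) (use mono in \<open>auto simp: monoD\<close>)
    moreover have "Min ?Y = e i" by (rule Min_eqI) (use mono in \<open>auto simp: monoD\<close>)
    moreover have "?Y - {e (i+m)} = X i" "?Y - {e i} = X (Suc i)"
    proof -
      have "{i..i+m} - {i+m} = {i..<i+m}" "{i..i+m} - {i} = {Suc i..<Suc i+m}" by auto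
      then show "?Y - {e (i+m)} = X i" "?Y - {e i} = X (Suc i)"
        unfolding X_def using image_set_diff[OF inj, of "{i..i+m}" "{i+m}"]
          image_set_diff[OF inj, of "{i..i+m}" "{i}"] by simp_all
    qed
    moreover have "card ?Y = Suc m" using inj by (simp add: card_image inj_on_subset)
    moreover have "?Y \<subseteq> Z" using e by auto
    ultimately have "\<not> f (X i) \<le> f (X (Suc i))"
      using bad[unfolded not_ex, rule_format, of ?Y] by simp
    then show ?thesis by (auto simp: not_le)
  qed
  then show False
    using wf_less_than[unfolded wf_iff_no_infinite_down_chain, simplified, rule_format, of "\<lambda>i. f (X i)"]
    by blast
qed

lemma homogeneous_subset:
  fixes c :: "nat set \<Rightarrow> nat"
  assumes "infinite Z" "\<And>X. X \<subseteq> Z \<Longrightarrow> finite X \<Longrightarrow> card X = r \<Longrightarrow> c X < s"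
  obtains Y t where "Y \<subseteq> Z" "infinite Y" "t < s" "\<And>X. X \<subseteq> Y \<Longrightarrow> finite X \<Longrightarrow> card X = r \<Longrightarrow> c X = t"
proof -
  have "\<forall>X. X \<subseteq> Z \<and> finite X \<and> card X = r \<longrightarrow> c X < s" using assms(2) by simp
  from Ramsey[OF assms(1) this] obtain Y t where "Y \<subseteq> Z" "infinite Y" "t < s"
      "\<forall>X. X \<subseteq> Y \<and> finite X \<and> card X = r \<longrightarrow> c X = t" by blast
  then show thesis by (intro that[of Y t]) simp_all
qed

text \<open>In a bad array every \<open>m + 1\<close>-element set \<open>X\<close> violates one of the \<open>s\<close> conditions. By Ramsey's
  theorem it is the same condition for all \<open>X\<close> in some infinite subset.\<close>

lemma array_wqo_conj:
  fixes s :: nat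
  assumes w: "\<And>c. c < s \<Longrightarrow> array_wqo m A (R c)"
  shows "array_wqo m A (\<lambda>x y. \<forall>c<s. R c x y)"
  unfolding array_wqo_iff
proof (intro allI impI notI)
  fix Z :: "nat set" and f assume Z: "infinite Z" and f: "\<forall>X\<subseteq>Z. finite X \<longrightarrow> card X = m \<longrightarrow> f X \<in> A"
    and bad: "bad_array m Z (\<lambda>x y. \<forall>c<s. R c x y) f"
  let ?P = "\<lambda>X c. c < s \<and> \<not> R c (f (X - {Max X})) (f (X - {Min X}))"
  define c where "c X = (SOME c. ?P X c)" for X
  have c: "?P X (c X)" if "X \<subseteq> Z" "finite X" "card X = Suc m" for X
  proof -
    have "\<exists>c. ?P X c" using bad[unfolded bad_array_def, rule_format, OF that] by simp
    then show ?thesis unfolding c_def by (rule someI_ex)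
  qed
  obtain Y t where Y: "Y \<subseteq> Z" "infinite Y" "t < s"
      "\<And>X. X \<subseteq> Y \<Longrightarrow> finite X \<Longrightarrow> card X = Suc m \<Longrightarrow> c X = t"
    by (rule homogeneous_subset[OF Z, of "Suc m" c s]) (use c in auto)
  have "bad_array m Y (R t) f"
    unfolding bad_array_def
  proof (intro allI impI)
    fix X assume X: "X \<subseteq> Y" "finite X" "card X = Suc m"
    then show "\<not> R t (f (X - {Max X})) (f (X - {Min X}))"
      using c[of X] Y(4)[OF X] Y(1) by auto
  qed
  moreover have "\<forall>X\<subseteq>Y. finite X \<longrightarrow> card X = m \<longrightarrow> f X \<in> A" using f Y(1) by auto
  ultimately show False using w[OF Y(3), unfolded array_wqo_iff, rule_format, of Y f] Y(2) by simp
qed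

lemma array_wqo_finite_class:
  assumes "\<And>x. x \<in> A \<Longrightarrow> g x < (s::nat)"
  shows "array_wqo m A (\<lambda>x y. g x = g y)"
  unfolding array_wqo_def
proof (intro allI impI)
  fix Z :: "nat set" and f assume Z: "infinite Z" and f: "\<forall>X\<subseteq>Z. finite X \<longrightarrow> card X = m \<longrightarrow> f X \<in> A"
  obtain Y t where Y: "Y \<subseteq> Z" "infinite Y" "\<And>X. X \<subseteq> Y \<Longrightarrow> finite X \<Longrightarrow> card X = m \<Longrightarrow> g (f X) = t"
    by (rule homogeneous_subset[OF Z, of m "\<lambda>X. g (f X)" s]) (use assms f in auto)
  obtain X where X: "X \<subseteq> Y" "finite X" "card X = Suc m" using infinite_arbitrarily_large[OF Y(2)] by blast
  have ne: "X \<noteq> {}" using X by auto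
  have "g (f (X - {x})) = t" if "x \<in> X" for x
    by (rule Y(3)) (use X that in auto)
  then have "g (f (X - {Max X})) = g (f (X - {Min X}))" using X(2) ne by simp
  then show "\<exists>X\<subseteq>Z. finite X \<and> card X = Suc m \<and> g (f (X - {Max X})) = g (f (X - {Min X}))"
    using X Y(1) by (meson subset_trans)
qed

text \<open>It is enough that both numbers or none of them are negative, which leaves two classes, and
  that their absolute values are ordered.\<close>

lemma array_wqo_int: "array_wqo m (UNIV :: int set) (\<lambda>a b. a * b \<ge> 0 \<and> \<bar>a\<bar> \<le> \<bar>b\<bar>)"
proof -
  \<comment> \<open>Condition \<open>0\<close> compares negativity, condition \<open>1\<close> the absolute values.\<close>
  let ?R = "\<lambda>c a b. if c = (0::nat) then (if a < (0::int) then 1 else 0::nat) = (if b < 0 then 1 else 0)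
     else nat \<bar>a\<bar> \<le> nat \<bar>b\<bar>"
  have "array_wqo m (UNIV :: int set) (?R c)" for c
    by (cases "c = 0")
      (simp_all add: array_wqo_finite_class[where s = 2] array_wqo_image[OF array_wqo_nat])
  then have "array_wqo m (UNIV :: int set) (\<lambda>x y. \<forall>c<2. ?R c x y)" by (rule array_wqo_conj)
  then show ?thesis
  proof (rule array_wqo_mono)
    fix a b :: int assume "\<forall>c<2. ?R c a b"
    from this[rule_format, of 0] this[rule_format, of 1]
    show "a * b \<ge> 0 \<and> \<bar>a\<bar> \<le> \<bar>b\<bar>" by (auto split: if_splits simp: zero_le_mult_iff)
  qed
qed

lemma array_wqo_conformal: "array_wqo m (carrier_vec d) (\<sqsubseteq>\<^sub>c)"
proof -
  have "array_wqo m (carrier_vec d) (\<lambda>a b. a $ j * b $ j \<ge> 0 \<and> \<bar>a $ j\<bar> \<le> \<bar>b $ j :: int\<bar>)" for j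
    using array_wqo_image[OF array_wqo_int, of "carrier_vec d" "\<lambda>a. a $ j" m] by simp
  then have "array_wqo m (carrier_vec d) (\<lambda>a b. \<forall>j<d. a $ j * b $ j \<ge> 0 \<and> \<bar>a $ j\<bar> \<le> \<bar>b $ j :: int\<bar>)"
    by (intro array_wqo_conj)
  then show ?thesis by (rule array_wqo_mono) (auto simp: conformal_def)
qed

text \<open>If \<open>X\<close> is bad for the order on sets, choose a witness \<open>g X\<close>: an element of \<open>F (f (X - {Min
  X}))\<close> that has nothing below it in \<open>F (f (X - {Max X}))\<close>. The witnesses depend on \<open>m + 1\<close>
  indices. For \<open>Y\<close> with \<open>m + 2\<close> elements, the set \<open>Y - {Min Y, Max Y}\<close> arises both by deleting
  the minimum of \<open>Y - {Max Y}\<close> and by deleting the maximum of \<open>Y - {Min Y}\<close>, so \<open>g (Y - {Max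
  Y})\<close> is among the elements that are not below \<open>g (Y - {Min Y})\<close>: the array \<open>g\<close> is bad.\<close>

lemma array_wqo_powerset:
  assumes w: "array_wqo (Suc m) B R" and sub: "\<And>x. x \<in> A \<Longrightarrow> F x \<subseteq> B" and m: "m \<ge> 1"
  shows "array_wqo m A (\<lambda>x y. \<forall>b\<in>F y. \<exists>a\<in>F x. R a b)"
  unfolding array_wqo_iff
proof (intro allI impI notI)
  fix Z :: "nat set" and f assume Z: "infinite Z" and f: "\<forall>X\<subseteq>Z. finite X \<longrightarrow> card X = m \<longrightarrow> f X \<in> A"
    and bad: "bad_array m Z (\<lambda>x y. \<forall>b\<in>F y. \<exists>a\<in>F x. R a b) f"
  let ?P = "\<lambda>X b. b \<in> F (f (X - {Min X})) \<and> (\<forall>a\<in>F (f (X - {Max X})). \<not> R a b)"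
  define g where "g X = (SOME b. ?P X b)" for X
  have g: "?P X (g X)" if "X \<subseteq> Z" "finite X" "card X = Suc m" for X
  proof -
    have "\<exists>b. ?P X b" using bad[unfolded bad_array_def, rule_format, OF that] by auto
    then show ?thesis unfolding g_def by (rule someI_ex)
  qed
  have "bad_array (Suc m) Z R g"
    unfolding bad_array_def
  proof (intro allI impI)
    fix Y assume Y: "Y \<subseteq> Z" "finite Y" "card Y = Suc (Suc m)"
    then have ne: "Y \<noteq> {}" by auto
    let ?L = "Y - {Max Y}" and ?U = "Y - {Min Y}"
    have mm: "Min Y \<noteq> Max Y"
    proof
      assume eq: "Min Y = Max Y"
      have "y = Min Y" if "y \<in> Y" for y
        using Min_le[OF Y(2) that] Max_ge[OF Y(2) that] eq by simp
      then have "Y \<subseteq> {Min Y}" by blast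
      then have "card Y \<le> 1" using card_mono[of "{Min Y}" Y] by simp
      then show False using Y by simp
    qed
    have L: "?L \<subseteq> Z" "finite ?L" "card ?L = Suc m" and U: "?U \<subseteq> Z" "finite ?U" "card ?U = Suc m"
      using Y ne by auto
    have "Min ?L = Min Y" by (rule Min_eqI) (use Y ne mm in auto)
    moreover have "Max ?U = Max Y" by (rule Max_eqI) (use Y ne mm in auto)
    moreover have "?L - {Min Y} = ?U - {Max Y}" by auto
    ultimately show "\<not> R (g ?L) (g ?U)" using g[OF L] g[OF U] by auto
  qed
  moreover have "\<forall>X\<subseteq>Z. finite X \<longrightarrow> card X = Suc m \<longrightarrow> g X \<in> B"
  proof (intro allI impI)
    fix X assume X: "X \<subseteq> Z" "finite X" "card X = Suc m"
    then have ne: "X \<noteq> {}" by auto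
    have "X - {Min X} \<subseteq> Z" "finite (X - {Min X})" "card (X - {Min X}) = m" using X ne by auto
    then have "f (X - {Min X}) \<in> A" using f by simp
    then show "g X \<in> B" using g[OF X] sub[of "f (X - {Min X})"] by auto
  qed
  ultimately show False using w[unfolded array_wqo_iff, rule_format, of Z g] Z by simp
qed

lemma vector_tree_root: "vector_tree n h S \<Longrightarrow> tree_root S \<in> carrier_vec (n h)"
  by (cases h) auto

text \<open>The induction on the height uses all \<open>m\<close>, since the children are compared by the order on
  sets.\<close>

lemma array_wqo_reduces: "m \<ge> 1 \<Longrightarrow> array_wqo m {S. vector_tree n h S} (reduces h)"
proof (induction h arbitrary: m)
  case 0
  have "array_wqo m {S. vector_tree n 0 S} (\<lambda>S U. tree_root S \<sqsubseteq>\<^sub>c tree_root U)"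
    by (rule array_wqo_image[OF array_wqo_conformal[of m "n 0"]]) auto
  then show ?case by simp
next
  case (Suc h)
  let ?A = "{S. vector_tree n (Suc h) S}"
  \<comment> \<open>Condition \<open>0\<close> compares the roots, condition \<open>1\<close> the children.\<close>
  let ?R = "\<lambda>c S U. if c = (0::nat) then tree_root S \<sqsubseteq>\<^sub>c tree_root U
    else \<forall>U'\<in>subtrees U. \<exists>S'\<in>subtrees S. reduces h S' U'"
  have "array_wqo m ?A (\<lambda>S U. tree_root S \<sqsubseteq>\<^sub>c tree_root U)"
    by (rule array_wqo_image[OF array_wqo_conformal[of m "n (Suc h)"]]) auto
  moreover have "array_wqo m ?A (\<lambda>S U. \<forall>U'\<in>subtrees U. \<exists>S'\<in>subtrees S. reduces h S' U')"
    by (rule array_wqo_powerset[OF Suc.IH[of "Suc m"]]) (use Suc.prems in auto)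
  ultimately have "array_wqo m ?A (?R c)" for c by (cases "c = 0") simp_all
  then have "array_wqo m ?A (\<lambda>x y. \<forall>c<2. ?R c x y)" by (rule array_wqo_conj)
  then show ?case by (rule array_wqo_mono) (force simp: less_2_cases_iff)
qed

lemma reduces_good_sequence:
  assumes "\<And>i::nat. vector_tree n h (f i)"
  obtains i j where "i < j" "reduces h (f i) (f j)"
proof -
  obtain X where X: "finite X" "card X = Suc 1"
      "reduces h (f (the_elem (X - {Max X}))) (f (the_elem (X - {Min X})))"
    by (rule array_wqoE[OF array_wqo_reduces[of 1 n h], of UNIV "\<lambda>X. f (the_elem X)"])
      (use assms in auto)
  obtain a b where ab: "X = {a, b}" "a \<noteq> b" using X(2) by (auto simp: card_Suc_eq)
  obtain i j where ij: "X = {i, j}" "i < j"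
  proof (cases "a < b")
    case True then show thesis using ab that by blast
  next
    case False then show thesis using ab that[of b a] by auto
  qed
  then have "Max X = j" "Min X = i" by auto
  moreover from ij this have "X - {j} = {i}" "X - {i} = {j}" by auto
  ultimately show thesis using X(3) ij(2) that by simp
qed

section \<open>Paths and operations of vector-trees\<close>

lemma vtree_cases:
  obtains v f where "S = abs_vtree (RNode v f)"
  by (metis Quotient_abs_rep Quotient_vtree raw_tree.exhaust)

lemma vector_tree_subtree: "vector_tree n (Suc h) S \<Longrightarrow> S' \<in> subtrees S \<Longrightarrow> vector_tree n h S'"
  by simp

lemma paths_0: "vector_tree n 0 S \<Longrightarrow> paths S = {tree_root S}"
  by (cases S rule: vtree_cases)
    (auto simp: vector_tree_abs_0 paths.abs_eq tree_root.abs_eq rpath_RNode simp del: vector_tree.simps)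

text \<open>The inductions on the height for reducibility and for spans go through this recursion,
  without representatives of the quotient type.\<close>

lemma paths_Suc:
  "vector_tree n (Suc h) S \<Longrightarrow> paths S = {tree_root S @\<^sub>v p | S' p. S' \<in> subtrees S \<and> p \<in> paths S'}"
proof (cases S rule: vtree_cases)
  case (1 v f)
  assume "vector_tree n (Suc h) S"
  then have "dom f \<noteq> {}" unfolding 1 vector_tree_abs_Suc by simp
  then show ?thesis
    unfolding 1 paths.abs_eq tree_root.abs_eq subtrees_abs rpath_RNode
    by (auto simp: paths.abs_eq) (metis mem_Collect_eq paths.abs_eq, blast)
qed

lemma paths_carrier: "vector_tree n h S \<Longrightarrow> p \<in> paths S \<Longrightarrow> p \<in> carrier_vec (path_dim n h)"
  by (cases S rule: vtree_cases) (auto simp: paths.abs_eq intro: rpath_carrier)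

lemma paths_first: "vector_tree n h S \<Longrightarrow> p \<in> paths S \<Longrightarrow> vec_first p (n h) = tree_root S"
  by (cases S rule: vtree_cases) (auto simp: paths.abs_eq tree_root.abs_eq dest: rpath_first)

lemma paths_nonempty: "vector_tree n h S \<Longrightarrow> paths S \<noteq> {}"
  by (cases S rule: vtree_cases) (auto simp: paths.abs_eq dest: rpath_ex)

lemma tight_subtree: "tight S \<Longrightarrow> S' \<in> subtrees S \<Longrightarrow> tight S'"
  by (cases S rule: vtree_cases) (auto simp: tight.abs_eq subtrees_abs rtight_RNode)

lemma tight_subtree_unique:
  "tight S \<Longrightarrow> S' \<in> subtrees S \<Longrightarrow> S'' \<in> subtrees S \<Longrightarrow> tree_root S' = tree_root S'' \<Longrightarrow> S' = S''"
proof (cases S rule: vtree_cases)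
  case (1 v f)
  assume "tight S" "S' \<in> subtrees S" "S'' \<in> subtrees S" and r: "tree_root S' = tree_root S''"
  then obtain t i t' j where t: "f i = Some t" "S' = abs_vtree t" "f j = Some t'" "S'' = abs_vtree t'"
    unfolding 1 subtrees_abs by blast
  then have "i = j" using \<open>tight S\<close> r unfolding 1 tight.abs_eq rtight_RNode by (simp add: tree_root.abs_eq)
  then show ?thesis using t by simp
qed

lemma tree_of_paths_spec:
  assumes "V \<noteq> {}" "V \<subseteq> carrier_vec (path_dim n h)" "\<And>v. v \<in> V \<Longrightarrow> vec_first v (n h) = r"
  shows "vector_tree n h (tree_of_paths n h V)" "tight (tree_of_paths n h V)"
    "paths (tree_of_paths n h V) = V" "tree_root (tree_of_paths n h V) = r"
proof -
  have *: "vector_tree n h (tree_of_paths n h V) \<and> tight (tree_of_paths n h V)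
      \<and> paths (tree_of_paths n h V) = V"
    unfolding tree_of_paths_def by (rule theI', rule tree_of_paths_ex1) (use assms in auto)
  then show "vector_tree n h (tree_of_paths n h V)" "tight (tree_of_paths n h V)"
    "paths (tree_of_paths n h V) = V" by auto
  then show "tree_root (tree_of_paths n h V) = r"
    using paths_first[of n h "tree_of_paths n h V"] assms(1,3) by fastforce
qed

lemma tree_of_paths_paths:
  assumes "vector_tree n h S" "tight S"
  shows "tree_of_paths n h (paths S) = S"
  unfolding tree_of_paths_def
proof (rule the1_equality[OF tree_of_paths_ex1])
  show "\<forall>v\<in>paths S. vec_first v (n h) = tree_root S" using paths_first assms by blast
qed (use assms paths_nonempty paths_carrier in blast)+

text \<open>In a tight tree distinct children of the root have distinct labels, hence lie on distinct
  paths.\<close>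

lemma finite_tree_of_finite_paths:
  assumes "vector_tree n h S" "tight S" "finite (paths S)"
  shows "finite_tree S"
proof -
  have "finite {p. raddress t p}"
    if "vector_tree n h (abs_vtree t)" "rtight t" "finite {p. rpath t p}" for t
    using that
  proof (induction h arbitrary: t)
    case 0
    then show ?case
      by (cases t) (auto simp: vector_tree_abs_0 finite_raddress_RNode simp del: vector_tree.simps)
  next
    case (Suc h)
    obtain v f where t: "t = RNode v f" by (cases t)
    have v: "v \<in> carrier_vec (n (Suc h))"
      and kids: "\<And>i s. f i = Some s \<Longrightarrow> vector_tree n h (abs_vtree s)"
      using Suc.prems(1) unfolding t vector_tree_abs_Suc by auto
    have tight: "\<And>i j s s'. f i = Some s \<Longrightarrow> f j = Some s' \<Longrightarrow> rlabel s = rlabel s' \<Longrightarrow> i = j"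
      "\<And>i s. f i = Some s \<Longrightarrow> rtight s" using Suc.prems(2) unfolding t rtight_RNode by auto
    have sub: "(@\<^sub>v) v ` {p. rpath s p} \<subseteq> {p. rpath t p}" if "f i = Some s" for i s
      using that unfolding t rpath_RNode by auto
    have inj: "inj_on ((@\<^sub>v) v) A" for A using v by (auto simp: inj_on_def)
    have fin: "finite {p. rpath s p}" if "f i = Some s" for i s
      using finite_subset[OF sub[OF that] Suc.prems(3)] inj by (rule finite_imageD)
    have "finite (dom f)"
    proof -
      define q where "q i = (SOME q. rpath (the (f i)) q)" for i
      have q: "rpath s (q i)" if "f i = Some s" for i s
        using someI_ex[OF rpath_ex[OF kids[OF that]]] that unfolding q_def by simp
      have "(\<lambda>i. v @\<^sub>v q i) ` dom f \<subseteq> {p. rpath t p}" using sub q by blast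
      then have "finite ((\<lambda>i. v @\<^sub>v q i) ` dom f)" using Suc.prems(3) by (rule finite_subset)
      moreover have "inj_on (\<lambda>i. v @\<^sub>v q i) (dom f)"
      proof (rule inj_onI)
        fix i j assume "i \<in> dom f" "j \<in> dom f" and eq: "v @\<^sub>v q i = v @\<^sub>v q j"
        then obtain s s' where s: "f i = Some s" "f j = Some s'" by auto
        have "q i = q j" using eq append_vec_eq[OF v v] by simp
        then have "rlabel s = rlabel s'"
          using rpath_first[OF kids[OF s(1)] q[OF s(1)]] rpath_first[OF kids[OF s(2)] q[OF s(2)]] by simp
        then show "i = j" using tight(1) s by blast
      qed
      ultimately show ?thesis by (rule finite_imageD)
    qed
    then show ?case
      unfolding t finite_raddress_RNode using Suc.IH[OF kids tight(2) fin] by blast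
  qed
  then show ?thesis using assms
    by (cases S rule: vtree_cases) (simp add: finite_tree.abs_eq paths.abs_eq tight.abs_eq)
qed

lemma conformal_append:
  assumes "a \<in> carrier_vec k" "b \<in> carrier_vec k"
  shows "a @\<^sub>v x \<sqsubseteq>\<^sub>c b @\<^sub>v y \<longleftrightarrow> a \<sqsubseteq>\<^sub>c b \<and> x \<sqsubseteq>\<^sub>c y"
proof -
  have d: "dim_vec a = k" "dim_vec b = k" using assms by auto
  have all_add: "(\<forall>j<k + m. P j) \<longleftrightarrow> (\<forall>j<k. P j) \<and> (\<forall>j<m. P (k + j))" for P and m :: nat
    by (metis add_less_cancel_left le_add_diff_inverse not_le_imp_less trans_less_add1)
  show ?thesis
    unfolding conformal_def index_append_vec(2) d all_add using d by (auto simp: d)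
qed

lemma reduces_root: "reduces h U S \<Longrightarrow> tree_root U \<sqsubseteq>\<^sub>c tree_root S"
  by (cases h) auto

text \<open>This makes the set of paths that defines \<open>S - U\<close> non-empty.\<close>

lemma reduces_paths:
  "vector_tree n h U \<Longrightarrow> vector_tree n h S \<Longrightarrow> reduces h U S \<Longrightarrow> v \<in> paths S \<Longrightarrow> \<exists>w\<in>paths U. w \<sqsubseteq>\<^sub>c v"
proof (induction h arbitrary: U S v)
  case 0
  then show ?case using paths_0[of n U] paths_0[of n S] by simp
next
  case (Suc h)
  from Suc.prems(4) obtain S' p where v: "v = tree_root S @\<^sub>v p" "S' \<in> subtrees S" "p \<in> paths S'"
    unfolding paths_Suc[OF Suc.prems(2)] by blast
  obtain U' where U': "U' \<in> subtrees U" "reduces h U' S'" using Suc.prems(3) v(2) by auto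
  obtain w where w: "w \<in> paths U'" "w \<sqsubseteq>\<^sub>c p"
    using Suc.IH[OF vector_tree_subtree[OF Suc.prems(1) U'(1)] vector_tree_subtree[OF Suc.prems(2) v(2)] U'(2) v(3)]
    by blast
  have "tree_root U \<in> carrier_vec (n (Suc h))" "tree_root S \<in> carrier_vec (n (Suc h))"
    using Suc.prems by auto
  then have "tree_root U @\<^sub>v w \<sqsubseteq>\<^sub>c v"
    unfolding v(1) using conformal_append w(2) reduces_root[OF Suc.prems(3)] by blast
  moreover have "tree_root U @\<^sub>v w \<in> paths U" unfolding paths_Suc[OF Suc.prems(1)] using U'(1) w(1) by blast
  ultimately show ?case by blast
qed

definition additive_subgroup :: "nat \<Rightarrow> int vec set \<Rightarrow> bool" where
  "additive_subgroup d K \<longleftrightarrow> K \<subseteq> carrier_vec d \<and> 0\<^sub>v d \<in> K \<and>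
     (\<forall>v\<in>K. \<forall>w\<in>K. v + w \<in> K) \<and> (\<forall>v\<in>K. - v \<in> K)"

lemma additive_subgroup_minus:
  assumes "additive_subgroup d K" "v \<in> K" "w \<in> K"
  shows "v - w \<in> K"
proof -
  have "v - w = v + - w" using assms minus_add_uminus_vec[of v d w]
    unfolding additive_subgroup_def by blast
  then show ?thesis using assms unfolding additive_subgroup_def by simp
qed

text \<open>The trees that occur in a stage; \<open>K\<close> will be the kernel of \<open>A\<^sub>h\<^sub>,\<^sub>1\<close>.\<close>

definition tree_over :: "(nat \<Rightarrow> nat) \<Rightarrow> nat \<Rightarrow> int vec set \<Rightarrow> vtree \<Rightarrow> bool" where
  "tree_over n h K S \<longleftrightarrow> vector_tree n h S \<and> tight S \<and> finite (paths S) \<and> paths S \<subseteq> K"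

lemma vec_first_add:
  "dim_vec v = dim_vec w \<Longrightarrow> k \<le> dim_vec w \<Longrightarrow> vec_first (v + w) k = vec_first v k + vec_first (w :: int vec) k"
  by (auto simp: vec_first_def)

lemma vec_first_minus:
  "dim_vec v = dim_vec w \<Longrightarrow> k \<le> dim_vec w \<Longrightarrow> vec_first (v - w) k = vec_first v k - vec_first (w :: int vec) k"
  by (auto simp: vec_first_def)

lemma vec_first_uminus:
  "k \<le> dim_vec w \<Longrightarrow> vec_first (- w) k = - vec_first (w :: int vec) k"
  by (auto simp: vec_first_def)

lemma path_dim_ge: "n h \<le> path_dim n h"
  by (cases h) (auto simp: path_dim_def)

lemma tree_over_tree_of_paths:
  assumes "additive_subgroup (path_dim n h) K" "V \<noteq> {}" "finite V" "V \<subseteq> K"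
    and r: "\<And>v. v \<in> V \<Longrightarrow> vec_first v (n h) = r"
  shows "tree_over n h K (tree_of_paths n h V)" "paths (tree_of_paths n h V) = V"
    "tree_root (tree_of_paths n h V) = r"
proof -
  have "V \<subseteq> carrier_vec (path_dim n h)" using assms(1,4) unfolding additive_subgroup_def by blast
  note spec = tree_of_paths_spec[OF assms(2) this r]
  show "tree_over n h K (tree_of_paths n h V)" "paths (tree_of_paths n h V) = V"
    "tree_root (tree_of_paths n h V) = r"
    using spec assms(3,4) unfolding tree_over_def by auto
qed

lemma tree_over_pathsD:
  assumes "tree_over n h K S" "v \<in> paths S"
  shows "v \<in> K" "dim_vec v = path_dim n h" "vec_first v (n h) = tree_root S"
  using assms paths_carrier[of n h S v] paths_first[of n h S v] unfolding tree_over_def by auto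

lemma tree_over_paths_nonempty: "tree_over n h K S \<Longrightarrow> paths S \<noteq> {}"
  unfolding tree_over_def by (auto dest: paths_nonempty)

lemma tree_add_over:
  assumes K: "additive_subgroup (path_dim n h) K" and S: "tree_over n h K S" and U: "tree_over n h K U"
  shows "tree_over n h K (tree_add n h S U)"
    "paths (tree_add n h S U) = {v + w | v w. v \<in> paths S \<and> w \<in> paths U}"
proof -
  let ?V = "{v + w | v w. v \<in> paths S \<and> w \<in> paths U}"
  have "?V = (\<lambda>(v, w). v + w) ` (paths S \<times> paths U)" by auto
  then have fin: "finite ?V" using S U unfolding tree_over_def by simp
  have sub: "?V \<subseteq> K" using K S U unfolding additive_subgroup_def tree_over_def by blast
  have ne: "?V \<noteq> {}" using tree_over_paths_nonempty[OF S] tree_over_paths_nonempty[OF U] by auto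
  have "vec_first v (n h) = tree_root S + tree_root U" if "v \<in> ?V" for v
    using that tree_over_pathsD[OF S] tree_over_pathsD[OF U] by (auto simp: vec_first_add path_dim_ge)
  note spec = tree_over_tree_of_paths[OF K ne fin sub this]
  show "tree_over n h K (tree_add n h S U)" "paths (tree_add n h S U) = ?V"
    unfolding tree_add_def using spec by auto
qed

lemma tree_add_commute:
  assumes "tree_over n h K S" "tree_over n h K U"
  shows "tree_add n h S U = tree_add n h U S"
proof -
  have comm: "v + w = w + v" if "v \<in> paths S" "w \<in> paths U" for v w
    using comm_add_vec[of v "path_dim n h" w] that assms paths_carrier unfolding tree_over_def by blast
  have "{v + w | v w. v \<in> paths S \<and> w \<in> paths U} = {w + v | v w. v \<in> paths S \<and> w \<in> paths U}"
    using comm by (intro Collect_cong) metis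
  also have "\<dots> = {v + w | v w. v \<in> paths U \<and> w \<in> paths S}" by blast
  finally show ?thesis unfolding tree_add_def by simp
qed

lemma tree_neg_over:
  assumes K: "additive_subgroup (path_dim n h) K" and S: "tree_over n h K S"
  shows "tree_over n h K (tree_neg n h S)" "paths (tree_neg n h S) = uminus ` paths S"
    "tree_root (tree_neg n h S) = - tree_root S"
proof -
  let ?V = "{- v | v. v \<in> paths S}"
  have im: "?V = uminus ` paths S" by auto
  then have fin: "finite ?V" using S unfolding tree_over_def by simp
  have sub: "?V \<subseteq> K" using K S unfolding additive_subgroup_def tree_over_def by blast
  have ne: "?V \<noteq> {}" using tree_over_paths_nonempty[OF S] by auto
  have "vec_first v (n h) = - tree_root S" if "v \<in> ?V" for v
    using that tree_over_pathsD[OF S] by (auto simp: vec_first_uminus path_dim_ge)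
  note spec = tree_over_tree_of_paths[OF K ne fin sub this]
  show "tree_over n h K (tree_neg n h S)" "paths (tree_neg n h S) = uminus ` paths S"
    "tree_root (tree_neg n h S) = - tree_root S"
    unfolding tree_neg_def using spec im by auto
qed

text \<open>Tightness is essential: \<open>- S\<close> only remembers the paths of \<open>S\<close>.\<close>

lemma tree_neg_neg:
  assumes K: "additive_subgroup (path_dim n h) K" and S: "tree_over n h K S"
  shows "tree_neg n h (tree_neg n h S) = S"
proof -
  have "{- v | v. v \<in> uminus ` paths S} = uminus ` uminus ` paths S" by blast
  also have "\<dots> = paths S" by (simp add: image_image)
  finally have "{- v | v. v \<in> uminus ` paths S} = paths S" .
  then show ?thesis
    unfolding tree_neg_def[of n h "tree_neg n h S"] tree_neg_over(2)[OF K S]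
    using S tree_of_paths_paths unfolding tree_over_def by simp
qed

lemma tree_diff_over:
  assumes K: "additive_subgroup (path_dim n h) K" and S: "tree_over n h K S" and U: "tree_over n h K U"
    and red: "reduces h U S"
  shows "tree_over n h K (tree_diff n h S U)"
    "paths (tree_diff n h S U) = {v - w | v w. v \<in> paths S \<and> w \<in> paths U \<and> w \<sqsubseteq>\<^sub>c v}"
    "tree_root (tree_diff n h S U) = tree_root S - tree_root U"
proof -
  let ?V = "{v - w | v w. v \<in> paths S \<and> w \<in> paths U \<and> w \<sqsubseteq>\<^sub>c v}"
  have "?V \<subseteq> (\<lambda>(v, w). v - w) ` (paths S \<times> paths U)" by auto
  then have fin: "finite ?V" by (rule finite_subset) (use S U in \<open>simp add: tree_over_def\<close>)
  have sub: "?V \<subseteq> K" using additive_subgroup_minus[OF K] S U unfolding tree_over_def by blast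
  have ne: "?V \<noteq> {}"
  proof -
    obtain v where v: "v \<in> paths S" using tree_over_paths_nonempty[OF S] by auto
    then obtain w where "w \<in> paths U" "w \<sqsubseteq>\<^sub>c v"
      using reduces_paths[of n h U S v] red S U unfolding tree_over_def by auto
    then show ?thesis using v by blast
  qed
  have "vec_first v (n h) = tree_root S - tree_root U" if "v \<in> ?V" for v
    using that tree_over_pathsD[OF S] tree_over_pathsD[OF U] by (auto simp: vec_first_minus path_dim_ge)
  note spec = tree_over_tree_of_paths[OF K ne fin sub this]
  show "tree_over n h K (tree_diff n h S U)" "paths (tree_diff n h S U) = ?V"
    "tree_root (tree_diff n h S U) = tree_root S - tree_root U"
    unfolding tree_diff_def using spec by auto
qed

section \<open>Conformal sums and Graver bases\<close>

definition vec_norm :: "int vec \<Rightarrow> nat" where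
  "vec_norm v = (\<Sum>j<dim_vec v. nat \<bar>v $ j\<bar>)"

text \<open>Sums of vectors are formed coordinatewise, so that the sums over multisets live in the
  integers.\<close>

definition mset_sum_of :: "nat \<Rightarrow> int vec multiset \<Rightarrow> int vec \<Rightarrow> bool" where
  "mset_sum_of d M z \<longleftrightarrow> (\<forall>j<d. z $ j = (\<Sum>x\<in>#M. x $ j))"

text \<open>The equation for the absolute values says that no cancellation takes place.\<close>

definition conformal_sum :: "nat \<Rightarrow> int vec set \<Rightarrow> int vec \<Rightarrow> bool" where
  "conformal_sum d X z \<longleftrightarrow> (\<exists>M. set_mset M \<subseteq> X \<and> mset_sum_of d M z \<and>
     (\<forall>j<d. \<bar>z $ j\<bar> = (\<Sum>x\<in>#M. \<bar>x $ j\<bar>)))"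

lemma conformal_sum_mono: "conformal_sum d X z \<Longrightarrow> X \<subseteq> Y \<Longrightarrow> conformal_sum d Y z"
  unfolding conformal_sum_def by blast

lemma conformal_sum_single: "x \<in> X \<Longrightarrow> conformal_sum d X x"
  unfolding conformal_sum_def by (rule exI[of _ "{#x#}"]) (simp add: mset_sum_of_def)

lemma conformal_sum_zero: "conformal_sum d X (0\<^sub>v d)"
  unfolding conformal_sum_def by (rule exI[of _ "{#}"]) (simp add: mset_sum_of_def)

lemma conformal_abs_split:
  fixes a b :: int assumes "a * b \<ge> 0" "\<bar>a\<bar> \<le> \<bar>b\<bar>" shows "\<bar>b\<bar> = \<bar>a\<bar> + \<bar>b - a\<bar>"
  using assms by (auto simp: zero_le_mult_iff abs_if split: if_splits)

lemma conformal_sum_split: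
  assumes z: "z \<in> carrier_vec d" and y: "y \<sqsubseteq>\<^sub>c z"
    and "conformal_sum d X y" "conformal_sum d X (z - y)"
  shows "conformal_sum d X z"
proof -
  obtain M where M: "set_mset M \<subseteq> X" "mset_sum_of d M y" "\<forall>j<d. \<bar>y $ j\<bar> = (\<Sum>x\<in>#M. \<bar>x $ j\<bar>)"
    using assms(3) unfolding conformal_sum_def by blast
  obtain M' where M': "set_mset M' \<subseteq> X" "mset_sum_of d M' (z - y)"
      "\<forall>j<d. \<bar>(z - y) $ j\<bar> = (\<Sum>x\<in>#M'. \<bar>x $ j\<bar>)"
    using assms(4) unfolding conformal_sum_def by blast
  have d: "dim_vec y = d" "dim_vec z = d" using z y unfolding conformal_def by auto
  show ?thesis unfolding conformal_sum_def
  proof (intro exI[of _ "M + M'"] conjI allI impI)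
    show "set_mset (M + M') \<subseteq> X" using M M' by simp
    have "z $ j = (\<Sum>x\<in>#M + M'. x $ j)" if "j < d" for j
    proof -
      have "z $ j = y $ j + (z - y) $ j" using that d by simp
      then show ?thesis using that M(2) M'(2) unfolding mset_sum_of_def by simp
    qed
    then show "mset_sum_of d (M + M') z" unfolding mset_sum_of_def by blast
    fix j assume j: "j < d"
    then have "\<bar>z $ j\<bar> = \<bar>y $ j\<bar> + \<bar>(z - y) $ j\<bar>"
      using y d conformal_abs_split[of "y $ j" "z $ j"] unfolding conformal_def by simp
    then show "\<bar>z $ j\<bar> = (\<Sum>x\<in>#M + M'. \<bar>x $ j\<bar>)" using M(3) M'(3) j by simp
  qed
qed

lemma int_vec_norm: "x \<in> carrier_vec d \<Longrightarrow> int (vec_norm x) = (\<Sum>j<d. \<bar>x $ j\<bar>)"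
  by (auto simp: vec_norm_def)

lemma vec_norm_mset:
  assumes "set_mset M \<subseteq> carrier_vec d"
  shows "int (\<Sum>x\<in>#M. vec_norm x) = (\<Sum>j<d. \<Sum>x\<in>#M. \<bar>x $ j\<bar>)"
  using assms
proof (induction M)
  case (add x M)
  then have "int (vec_norm x) = (\<Sum>j<d. \<bar>x $ j\<bar>)" by (simp add: int_vec_norm)
  then show ?case using add by (simp add: sum.distrib)
qed simp

text \<open>If no two members of \<open>M\<close> have opposite signs, then one of the two signs does not occur at
  all.\<close>

lemma same_sign_sum_abs:
  fixes f :: "'a \<Rightarrow> int"
  assumes sign: "\<And>x y. x \<in># M \<Longrightarrow> y \<in># M - {#x#} \<Longrightarrow> f x * f y \<ge> 0"
  shows "\<bar>\<Sum>x\<in>#M. f x\<bar> = (\<Sum>x\<in>#M. \<bar>f x\<bar>)"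
proof -
  have nonneg: "0 \<le> (\<Sum>x\<in>#M. g x) \<and> (\<Sum>x\<in>#M. g x) = (\<Sum>x\<in>#M. \<bar>g x\<bar>)"
    if "\<forall>x\<in>#M. g x \<ge> 0" for g :: "'a \<Rightarrow> int"
    using that by (induction M) auto
  show ?thesis
  proof (cases "\<exists>x\<in>#M. f x > 0")
    case True
    then obtain x where x: "x \<in># M" "f x > 0" by blast
    have "f y \<ge> 0" if "y \<in># M" for y
    proof (cases "y = x")
      case False
      then have "y \<in># M - {#x#}" using that by (metis insert_DiffM insert_noteq_member x(1))
      then show ?thesis using sign[OF x(1)] x(2) by (simp add: zero_le_mult_iff)
    qed (use x in simp)
    then show ?thesis using nonneg[of f] by simp
  next
    case False
    then have "\<forall>x\<in>#M. - f x \<ge> 0" by auto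
    moreover have "(\<Sum>x\<in>#N. - f x) = - (\<Sum>x\<in>#N. f x)" for N by (induction N) auto
    ultimately show ?thesis using nonneg[of "\<lambda>x. - f x"] by simp
  qed
qed

lemma abs_sum_eq_conformal:
  fixes f :: "'a \<Rightarrow> int"
  assumes eq: "\<bar>\<Sum>x\<in>#M. f x\<bar> = (\<Sum>x\<in>#M. \<bar>f x\<bar>)" and x: "x \<in># M"
  shows "f x * (\<Sum>x\<in>#M. f x) \<ge> 0" "\<bar>f x\<bar> \<le> \<bar>\<Sum>x\<in>#M. f x\<bar>"
proof -
  have tri: "\<bar>\<Sum>x\<in>#N. f x\<bar> \<le> (\<Sum>x\<in>#N. \<bar>f x\<bar>)" for N by (induction N) auto
  obtain N where M: "M = add_mset x N" using x by (metis multi_member_split)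
  show "f x * (\<Sum>x\<in>#M. f x) \<ge> 0" "\<bar>f x\<bar> \<le> \<bar>\<Sum>x\<in>#M. f x\<bar>"
    using eq tri[of N] unfolding M by (auto simp: zero_le_mult_iff)
qed

text \<open>Pottier's argument: a pair of summands with opposite signs in some coordinate can be
  replaced by a conformal sum for \<open>x + y\<close>, whose total norm is that of \<open>x + y\<close> and hence less
  than that of \<open>x\<close> and \<open>y\<close> together.\<close>

lemma conformal_sum_of_mset_sum:
  assumes X: "X \<subseteq> carrier_vec d"
    and pairs: "\<And>x y. x \<in> X \<Longrightarrow> y \<in> X \<Longrightarrow> conformal_sum d X (x + y)"
  shows "set_mset M \<subseteq> X \<Longrightarrow> mset_sum_of d M z \<Longrightarrow> conformal_sum d X z"
proof (induction "\<Sum>x\<in>#M. vec_norm x" arbitrary: M rule: less_induct)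
  case less
  show ?case
  proof (cases "\<exists>x y j. x \<in># M \<and> y \<in># M - {#x#} \<and> j < d \<and> x $ j * y $ j < 0")
    case False
    then have "\<bar>\<Sum>x\<in>#M. x $ j\<bar> = (\<Sum>x\<in>#M. \<bar>x $ j\<bar>)" if "j < d" for j
      using that by (intro same_sign_sum_abs) (meson not_le)
    then show ?thesis using less.prems unfolding conformal_sum_def mset_sum_of_def by auto
  next
    case True
    then obtain x y i where xy: "x \<in># M" "y \<in># M - {#x#}" and i: "i < d" "x $ i * y $ i < 0" by blast
    obtain N where M: "M = add_mset x (add_mset y N)"
      using xy by (metis insert_DiffM multi_member_split)
    have xX: "x \<in> X" "y \<in> X" using less.prems(1) unfolding M by auto
    then have "x \<in> carrier_vec d" "y \<in> carrier_vec d" using X by auto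
    then have c: "x \<in> carrier_vec d" "y \<in> carrier_vec d" "x + y \<in> carrier_vec d" by simp_all
    obtain D where D: "set_mset D \<subseteq> X" "mset_sum_of d D (x + y)"
        "\<forall>j<d. \<bar>(x + y) $ j\<bar> = (\<Sum>x\<in>#D. \<bar>x $ j\<bar>)"
      using pairs[OF xX] unfolding conformal_sum_def by blast
    have "int (\<Sum>x\<in>#D. vec_norm x) = (\<Sum>j<d. \<bar>(x + y) $ j\<bar>)"
      using vec_norm_mset[of D d] D(1,3) X by simp
    also have "\<dots> < (\<Sum>j<d. \<bar>x $ j\<bar> + \<bar>y $ j\<bar>)"
    proof (rule sum_strict_mono_ex1)
      show "\<exists>j\<in>{..<d}. \<bar>(x + y) $ j\<bar> < \<bar>x $ j\<bar> + \<bar>y $ j\<bar>"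
        using i c by (intro bexI[of _ i]) (auto simp: mult_less_0_iff)
    qed (use c in auto)
    also have "\<dots> = int (vec_norm x + vec_norm y)" using c by (simp add: int_vec_norm sum.distrib)
    finally have "(\<Sum>x\<in>#D. vec_norm x) < vec_norm x + vec_norm y" by (simp only: of_nat_less_iff)
    then have "(\<Sum>x\<in>#D + N. vec_norm x) < (\<Sum>x\<in>#M. vec_norm x)" unfolding M by simp
    moreover have "set_mset (D + N) \<subseteq> X" using D(1) less.prems(1) unfolding M by auto
    moreover have "mset_sum_of d (D + N) z"
      unfolding mset_sum_of_def
    proof (intro allI impI)
      fix j assume "j < d"
      then have "z $ j = x $ j + y $ j + (\<Sum>x\<in>#N. x $ j)" "(x + y) $ j = (\<Sum>x\<in>#D. x $ j)"
        using less.prems(2) D(2) unfolding M mset_sum_of_def by auto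
      then show "z $ j = (\<Sum>x\<in>#D + N. x $ j)" using \<open>j < d\<close> c by simp
    qed
    ultimately show ?thesis by (rule less.hyps)
  qed
qed

lemma vec_norm_zero: "v \<in> carrier_vec d \<Longrightarrow> vec_norm v = 0 \<Longrightarrow> v = 0\<^sub>v d"
  by (intro eq_vecI) (auto simp: vec_norm_def)

lemma vec_norm_conformal:
  assumes "z \<in> carrier_vec d" "y \<sqsubseteq>\<^sub>c z"
  shows "vec_norm z = vec_norm y + vec_norm (z - y)"
proof -
  have d: "dim_vec y = d" "dim_vec z = d" using assms unfolding conformal_def by auto
  have "nat \<bar>z $ j\<bar> = nat \<bar>y $ j\<bar> + nat \<bar>(z - y) $ j\<bar>" if "j < d" for j
    using conformal_abs_split[of "y $ j" "z $ j"] assms(2) that d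
    unfolding conformal_def by (auto simp flip: nat_add_distrib)
  then show ?thesis using d by (simp add: vec_norm_def sum.distrib)
qed

lemma vec_norm_diff_less:
  assumes "z \<in> carrier_vec d" "y \<sqsubseteq>\<^sub>c z" "y \<noteq> 0\<^sub>v d"
  shows "vec_norm (z - y) < vec_norm z"
proof -
  have "y \<in> carrier_vec d" using assms unfolding conformal_def by auto
  then have "vec_norm y \<noteq> 0" using vec_norm_zero assms(3) by blast
  then show ?thesis using vec_norm_conformal[OF assms(1,2)] by simp
qed

lemma mat_kernel_minus:
  fixes A :: "int mat"
  assumes A: "A \<in> carrier_mat nr d" and v: "v \<in> mat_kernel A" and w: "w \<in> mat_kernel A"
  shows "v - w \<in> mat_kernel A"
proof (rule mat_kernelI[OF A])
  note c = mat_kernelD[OF A v] mat_kernelD[OF A w]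
  then show "v - w \<in> carrier_vec d" by auto
  show "A *\<^sub>v (v - w) = 0\<^sub>v nr" using mult_minus_distrib_mat_vec[OF A c(1) c(3)] c by simp
qed

text \<open>A non-zero kernel element outside the Graver basis splits conformally into two kernel
  elements of smaller norm.\<close>

lemma conformal_sum_graver:
  assumes A: "A \<in> carrier_mat nr d"
  shows "z \<in> mat_kernel A \<Longrightarrow> conformal_sum d (graver_basis A) z"
proof (induction "vec_norm z" arbitrary: z rule: less_induct)
  case less
  have z: "z \<in> carrier_vec d" using mat_kernelD[OF A less.prems] by simp
  have d: "dim_col A = d" using A by simp
  show ?case
  proof (cases "z = 0\<^sub>v d \<or> z \<in> graver_basis A")
    case True
    then show ?thesis using conformal_sum_zero conformal_sum_single by auto
  next
    case False
    then obtain y where y: "y \<in> mat_kernel A" "y \<noteq> 0\<^sub>v d" "y \<sqsubseteq>\<^sub>c z" "y \<noteq> z"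
      using less.prems unfolding graver_basis_def d by blast
    have yc: "y \<in> carrier_vec d" using mat_kernelD[OF A y(1)] by simp
    have "vec_norm (z - y) \<noteq> 0"
    proof
      assume "vec_norm (z - y) = 0"
      then have "z - y = 0\<^sub>v d" using vec_norm_zero z yc by simp
      then have "(z - y) $ j = 0" if "j < d" for j using that by simp
      then have "y = z" using z yc by (intro eq_vecI) auto
      then show False using y(4) by simp
    qed
    then have "vec_norm y < vec_norm z" using vec_norm_conformal[OF z y(3)] by simp
    moreover have "vec_norm (z - y) < vec_norm z" using vec_norm_diff_less[OF z y(3,2)] .
    moreover have "z - y \<in> mat_kernel A" using mat_kernel_minus[OF A less.prems y(1)] .
    ultimately show ?thesis using conformal_sum_split[OF z y(3)] less.hyps y(1) by blast
  qed
qed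

lemma conformal_sum_restrict:
  assumes X: "X \<subseteq> carrier_vec d" and z: "z \<in> carrier_vec d" and sum: "conformal_sum d X z"
  shows "conformal_sum d {x \<in> X. x \<sqsubseteq>\<^sub>c z} z"
proof -
  obtain M where M: "set_mset M \<subseteq> X" "mset_sum_of d M z" "\<forall>j<d. \<bar>z $ j\<bar> = (\<Sum>x\<in>#M. \<bar>x $ j\<bar>)"
    using sum unfolding conformal_sum_def by blast
  have "x \<sqsubseteq>\<^sub>c z" if x: "x \<in># M" for x
    unfolding conformal_def
  proof (intro conjI allI impI)
    have xc: "x \<in> carrier_vec d" using x M(1) X by auto
    then show "dim_vec x = dim_vec z" using z by simp
    fix i assume "i < dim_vec x"
    then have i: "i < d" using xc by simp
    then have zi: "z $ i = (\<Sum>x\<in>#M. x $ i)" "\<bar>\<Sum>x\<in>#M. x $ i\<bar> = (\<Sum>x\<in>#M. \<bar>x $ i\<bar>)"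
      using M(2,3) unfolding mset_sum_of_def by auto
    show "x $ i * z $ i \<ge> 0" "\<bar>x $ i\<bar> \<le> \<bar>z $ i\<bar>"
      using abs_sum_eq_conformal[OF zi(2) x] unfolding zi(1) by auto
  qed
  then show ?thesis using M unfolding conformal_sum_def by blast
qed

lemma graver_in_conformal_generators:
  assumes A: "A \<in> carrier_mat nr d" and X: "X \<subseteq> mat_kernel A"
    and z: "z \<in> graver_basis A" and sum: "conformal_sum d X z"
  shows "z \<in> X"
proof -
  have d: "dim_col A = d" using A by simp
  have zk: "z \<in> mat_kernel A" "z \<noteq> 0\<^sub>v d"
    and min: "\<And>y. y \<in> mat_kernel A \<Longrightarrow> y \<noteq> 0\<^sub>v d \<Longrightarrow> y \<sqsubseteq>\<^sub>c z \<Longrightarrow> y = z"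
    using z unfolding graver_basis_def d by blast+
  have zc: "z \<in> carrier_vec d" using mat_kernelD[OF A zk(1)] by simp
  have Xc: "X \<subseteq> carrier_vec d" using X mat_kernel_carrier[OF A] by blast
  obtain M where M: "set_mset M \<subseteq> {x \<in> X. x \<sqsubseteq>\<^sub>c z}" "mset_sum_of d M z"
    using conformal_sum_restrict[OF Xc zc sum] unfolding conformal_sum_def by blast
  obtain j where j: "j < d" "z $ j \<noteq> 0" using zk(2) zc by (metis carrier_vecD eq_vecI index_zero_vec)
  have "\<exists>x\<in>#M. x $ j \<noteq> 0"
  proof (rule ccontr)
    assume "\<not> ?thesis"
    then have "(\<Sum>x\<in>#M. x $ j) = 0" by (intro sum_mset.neutral) simp
    then show False using M(2) j unfolding mset_sum_of_def by simp
  qed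
  then obtain x where x: "x \<in># M" "x $ j \<noteq> 0" by blast
  then have "x \<in> X" "x \<sqsubseteq>\<^sub>c z" using M(1) by auto
  moreover have "x \<noteq> 0\<^sub>v d" using x(2) j by auto
  ultimately show ?thesis using min X by blast
qed

section \<open>Path vectors\<close>

lemma stage_dim_Suc: "stage_dim n (Suc h) N = n (Suc h) + N * stage_dim n h N"
  by (simp add: stage_dim_def sum_distrib_left Suc_diff_le mult_ac)

lemma stage_dim_0: "stage_dim n 0 N = n 0"
  by (simp add: stage_dim_def)

lemma stage_dim_1: "stage_dim n h (Suc 0) = path_dim n h"
  by (simp add: stage_dim_def path_dim_def)

lemma indices_0: "indices N 0 = {[]}"
  by (auto simp: indices_def)

lemma indices_Suc: "indices N (Suc h) = {i # \<alpha> | i \<alpha>. i \<in> {1..N} \<and> \<alpha> \<in> indices N h}"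
  by (auto simp: indices_def length_Suc_conv)

lemma ball_indices_Suc:
  "(\<forall>\<alpha>\<in>indices N (Suc h). P \<alpha>) \<longleftrightarrow> (\<forall>i\<in>{1..N}. \<forall>\<alpha>\<in>indices N h. P (i # \<alpha>))"
  unfolding indices_Suc by blast

lemma indices_nonempty: "N \<ge> 1 \<Longrightarrow> indices N h \<noteq> {}"
  unfolding indices_def by (auto intro!: exI[of _ "replicate h 1"])

text \<open>The vector \<open>z\<^sub>(\<^sub>i\<^sub>)\<close> of the decomposition of \<open>z\<close> into its first block and \<open>N\<close> consecutive
  vectors; children are counted from \<open>1\<close>.\<close>

definition child_vec :: "(nat \<Rightarrow> nat) \<Rightarrow> nat \<Rightarrow> nat \<Rightarrow> int vec \<Rightarrow> nat \<Rightarrow> int vec" where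
  "child_vec n N h z i =
     vec (stage_dim n h N) (\<lambda>j. z $ (n (Suc h) + (i - 1) * stage_dim n h N + j))"

lemma child_vec_carrier [simp]: "child_vec n N h z i \<in> carrier_vec (stage_dim n h N)"
  by (simp add: child_vec_def)

lemma block_Cons: "block n N (Suc h) z (i # \<alpha>) = block n N h (child_vec n N h z i) \<alpha>"
  by (simp add: child_vec_def)

text \<open>The tree of a vector is defined through addresses relative to its root; this turns it into a
  recursion over \<^const>\<open>child_vec\<close>.\<close>

lemma block_subtree_Cons:
  "block_subtree n N (Suc h) z r (i # \<alpha>) = block_subtree n N h (child_vec n N h z i) r \<alpha>"
  by (induction r arbitrary: \<alpha>) (auto simp: block_Cons simp del: block.simps(2))

lemma tree_of_vec_Suc:
  "tree_of_vec n N (Suc h) z = abs_vtree (RNode (vec_first z (n (Suc h)))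
     (\<lambda>i. if i \<in> {1..N} then Some (block_subtree n N h (child_vec n N h z i) h []) else None))"
  unfolding tree_of_vec_def block_subtree.simps append_Nil block_subtree_Cons block.simps ..

lemma subtrees_tree_of_vec:
  "subtrees (tree_of_vec n N (Suc h) z) = (\<lambda>i. tree_of_vec n N h (child_vec n N h z i)) ` {1..N}"
  unfolding tree_of_vec_Suc subtrees_abs unfolding tree_of_vec_def by (auto, metis)

lemma root_tree_of_vec: "tree_root (tree_of_vec n N h z) = vec_first z (n h)"
  by (cases h) (simp_all add: tree_of_vec_def tree_root.abs_eq)

lemma vector_tree_of_vec: "N \<ge> 1 \<Longrightarrow> vector_tree n h (tree_of_vec n N h z)"
proof (induction h arbitrary: z)
  case 0
  show ?case by (simp add: tree_of_vec_def vector_tree_abs_0 del: vector_tree.simps)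
next
  case (Suc h)
  then show ?case unfolding vector_tree.simps root_tree_of_vec subtrees_tree_of_vec by auto
qed

text \<open>The concatenation of the blocks of \<open>z\<close> at the prefixes of the full address \<open>\<alpha>\<close>; the second
  equation supplies the case of height \<open>0\<close>.\<close>

fun path_vec :: "(nat \<Rightarrow> nat) \<Rightarrow> nat \<Rightarrow> nat \<Rightarrow> int vec \<Rightarrow> nat list \<Rightarrow> int vec" where
  "path_vec n N (Suc h) z (i # \<alpha>) = vec_first z (n (Suc h)) @\<^sub>v path_vec n N h (child_vec n N h z i) \<alpha>"
| "path_vec n N h z \<alpha> = z"

lemma path_vec_carrier:
  "z \<in> carrier_vec (stage_dim n h N) \<Longrightarrow> \<alpha> \<in> indices N h \<Longrightarrow> path_vec n N h z \<alpha> \<in> carrier_vec (path_dim n h)"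
proof (induction h arbitrary: z \<alpha>)
  case 0
  then show ?case by (simp add: stage_dim_0 path_dim_def)
next
  case (Suc h)
  then show ?case by (auto simp: indices_Suc path_dim_Suc)
qed

lemma coordinate_bound:
  assumes "i \<in> {1..N}" "j < d" shows "(i - 1) * d + j < N * (d :: nat)"
proof -
  have "(i - 1) * d + j < (i - 1) * d + d" using assms by simp
  also have "\<dots> = i * d" using assms by (cases i) auto
  also have "\<dots> \<le> N * d" using assms by simp
  finally show ?thesis .
qed

lemma coordinate_cases:
  assumes "j < stage_dim n (Suc h) N"
  obtains "j < n (Suc h)"
  | i j' where "i \<in> {1..N}" "j' < stage_dim n h N" "j = n (Suc h) + (i - 1) * stage_dim n h N + j'"
proof (cases "j < n (Suc h)")
  case False
  let ?d = "stage_dim n h N"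
  let ?j = "j - n (Suc h)"
  have lt: "?j < N * ?d" using assms False by (simp add: stage_dim_Suc)
  then have d: "?d > 0" by (cases ?d) auto
  have "?j div ?d < N" using lt by (simp add: less_mult_imp_div_less)
  then have "Suc (?j div ?d) \<in> {1..N}" by simp
  moreover have "?j mod ?d < ?d" using d by simp
  moreover have "j = n (Suc h) + (Suc (?j div ?d) - 1) * ?d + ?j mod ?d" using False by simp
  ultimately show thesis using that(2) by blast
qed (use that in blast)

lemma vec_first_index: "j < k \<Longrightarrow> vec_first v k $ j = v $ j"
  by (simp add: vec_first_def)

lemma child_vec_index:
  "j < stage_dim n h N \<Longrightarrow> child_vec n N h z i $ j = z $ (n (Suc h) + (i - 1) * stage_dim n h N + j)"
  by (simp add: child_vec_def)

lemma conformal_if_children: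
  assumes z: "z \<in> carrier_vec (stage_dim n (Suc h) N)" and y: "y \<in> carrier_vec (stage_dim n (Suc h) N)"
    and first: "vec_first y (n (Suc h)) \<sqsubseteq>\<^sub>c vec_first z (n (Suc h))"
    and children: "\<And>i. i \<in> {1..N} \<Longrightarrow> child_vec n N h y i \<sqsubseteq>\<^sub>c child_vec n N h z i"
  shows "y \<sqsubseteq>\<^sub>c z"
  unfolding conformal_def
proof (intro conjI allI impI)
  show "dim_vec y = dim_vec z" using z y by simp
  fix j assume "j < dim_vec y"
  then have "j < stage_dim n (Suc h) N" using y by simp
  then have "y $ j * z $ j \<ge> 0 \<and> \<bar>y $ j\<bar> \<le> \<bar>z $ j\<bar>"
  proof (cases rule: coordinate_cases)
    case 1
    then show ?thesis using first unfolding conformal_def by (auto simp: vec_first_index)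
  next
    case (2 i j')
    then show ?thesis using children[OF 2(1)] unfolding conformal_def
      by (auto simp: child_vec_index carrier_vecD[OF child_vec_carrier])
  qed
  then show "y $ j * z $ j \<ge> 0" "\<bar>y $ j\<bar> \<le> \<bar>z $ j\<bar>" by auto
qed

lemma stage_vec_eqI:
  assumes z: "z \<in> carrier_vec (stage_dim n (Suc h) N)" and y: "y \<in> carrier_vec (stage_dim n (Suc h) N)"
    and first: "vec_first y (n (Suc h)) = vec_first z (n (Suc h))"
    and children: "\<And>i. i \<in> {1..N} \<Longrightarrow> child_vec n N h y i = child_vec n N h z i"
  shows "y = z"
proof (rule eq_vecI)
  show "dim_vec y = dim_vec z" using z y by simp
  fix j assume "j < dim_vec z"
  then have "j < stage_dim n (Suc h) N" using z by simp
  then show "y $ j = z $ j"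
  proof (cases rule: coordinate_cases)
    case 1
    then show ?thesis using vec_first_index[of j "n (Suc h)"] first by metis
  next
    case (2 i j')
    then show ?thesis using child_vec_index[OF 2(2)] children[OF 2(1)] by metis
  qed
qed

lemma ex_vec_with_children:
  assumes w: "w \<in> carrier_vec (n (Suc h))" and Y: "\<And>i. i \<in> {1..N} \<Longrightarrow> Y i \<in> carrier_vec (stage_dim n h N)"
  obtains y where "y \<in> carrier_vec (stage_dim n (Suc h) N)" "vec_first y (n (Suc h)) = w"
    "\<And>i. i \<in> {1..N} \<Longrightarrow> child_vec n N h y i = Y i"
proof -
  let ?m = "n (Suc h)" and ?d = "stage_dim n h N"
  define y where "y = vec (stage_dim n (Suc h) N)
    (\<lambda>j. if j < ?m then w $ j else Y (Suc ((j - ?m) div ?d)) $ ((j - ?m) mod ?d))"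
  have "vec_first y ?m = w" using w by (intro eq_vecI) (auto simp: vec_first_def y_def stage_dim_Suc)
  moreover have "child_vec n N h y i = Y i" if i: "i \<in> {1..N}" for i
  proof (rule eq_vecI)
    show "dim_vec (child_vec n N h y i) = dim_vec (Y i)" using Y[OF i] by (simp add: child_vec_def)
    fix j assume "j < dim_vec (Y i)"
    then have j: "j < ?d" using Y[OF i] by simp
    have "child_vec n N h y i $ j = y $ (?m + ((i - 1) * ?d + j))" using j by (simp add: child_vec_def add.assoc)
    also have "\<dots> = Y (Suc (((i - 1) * ?d + j) div ?d)) $ (((i - 1) * ?d + j) mod ?d)"
      using coordinate_bound[OF i j] unfolding y_def by (simp add: stage_dim_Suc)
    also have "\<dots> = Y i $ j" using i j by simp
    finally show "child_vec n N h y i $ j = Y i $ j" .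
  qed
  ultimately show thesis using that[of y] by (simp add: y_def)
qed

lemma child_vec_minus:
  assumes "z \<in> carrier_vec (stage_dim n (Suc h) N)" "y \<in> carrier_vec (stage_dim n (Suc h) N)" "i \<in> {1..N}"
  shows "child_vec n N h (z - y) i = child_vec n N h z i - child_vec n N h y i"
  using assms coordinate_bound[OF assms(3)]
  by (intro eq_vecI) (auto simp: child_vec_def stage_dim_Suc add.assoc)

lemma child_vec_add:
  assumes "z \<in> carrier_vec (stage_dim n (Suc h) N)" "y \<in> carrier_vec (stage_dim n (Suc h) N)" "i \<in> {1..N}"
  shows "child_vec n N h (z + y) i = child_vec n N h z i + child_vec n N h y i"
  using assms coordinate_bound[OF assms(3)]
  by (intro eq_vecI) (auto simp: child_vec_def stage_dim_Suc add.assoc)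

lemma path_vec_add:
  "z \<in> carrier_vec (stage_dim n h N) \<Longrightarrow> y \<in> carrier_vec (stage_dim n h N) \<Longrightarrow> \<alpha> \<in> indices N h \<Longrightarrow>
   path_vec n N h (z + y) \<alpha> = path_vec n N h z \<alpha> + path_vec n N h y \<alpha>"
proof (induction h arbitrary: z y \<alpha>)
  case (Suc h)
  obtain i \<beta> where \<alpha>: "\<alpha> = i # \<beta>" "i \<in> {1..N}" "\<beta> \<in> indices N h" using Suc.prems(3) unfolding indices_Suc by blast
  have "vec_first (z + y) (n (Suc h)) = vec_first z (n (Suc h)) + vec_first y (n (Suc h))"
    using Suc.prems by (auto simp: vec_first_def stage_dim_Suc)
  then show ?case
    unfolding \<alpha>(1) path_vec.simps child_vec_add[OF Suc.prems(1,2) \<alpha>(2)] Suc.IH[OF child_vec_carrier child_vec_carrier \<alpha>(3)]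
    using append_vec_add[OF vec_first_carrier vec_first_carrier path_vec_carrier[OF child_vec_carrier \<alpha>(3)] path_vec_carrier[OF child_vec_carrier \<alpha>(3)]]
    by simp
qed simp

lemma append_vec_minus:
  fixes v :: "int vec"
  assumes "v \<in> carrier_vec k" "v' \<in> carrier_vec k" "w \<in> carrier_vec m" "w' \<in> carrier_vec m"
  shows "(v @\<^sub>v w) - (v' @\<^sub>v w') = (v - v') @\<^sub>v (w - w')"
  using assms by (intro eq_vecI) auto

lemma path_vec_minus:
  "z \<in> carrier_vec (stage_dim n h N) \<Longrightarrow> y \<in> carrier_vec (stage_dim n h N) \<Longrightarrow> \<alpha> \<in> indices N h \<Longrightarrow>
   path_vec n N h (z - y) \<alpha> = path_vec n N h z \<alpha> - path_vec n N h y \<alpha>"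
proof (induction h arbitrary: z y \<alpha>)
  case (Suc h)
  obtain i \<beta> where \<alpha>: "\<alpha> = i # \<beta>" "i \<in> {1..N}" "\<beta> \<in> indices N h" using Suc.prems(3) unfolding indices_Suc by blast
  have "vec_first (z - y) (n (Suc h)) = vec_first z (n (Suc h)) - vec_first y (n (Suc h))"
    using Suc.prems by (auto simp: vec_first_def stage_dim_Suc)
  then show ?case
    unfolding \<alpha>(1) path_vec.simps child_vec_minus[OF Suc.prems(1,2) \<alpha>(2)] Suc.IH[OF child_vec_carrier child_vec_carrier \<alpha>(3)]
    using append_vec_minus[OF vec_first_carrier vec_first_carrier path_vec_carrier[OF child_vec_carrier \<alpha>(3)] path_vec_carrier[OF child_vec_carrier \<alpha>(3)]]
    by simp
qed simp

lemma path_vec_first: "\<alpha> \<in> indices N h \<Longrightarrow> z \<in> carrier_vec (stage_dim n h N) \<Longrightarrow>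
  vec_first (path_vec n N h z \<alpha>) (n h) = vec_first z (n h)"
  by (cases h) (auto simp: indices_Suc vec_first_app)

section \<open>The kernel in terms of path vectors\<close>

fun repeat_vec :: "nat \<Rightarrow> int vec \<Rightarrow> int vec" where
  "repeat_vec 0 b = 0\<^sub>v 0"
| "repeat_vec (Suc m) b = b @\<^sub>v repeat_vec m b"

lemma repeat_vec_carrier: "b \<in> carrier_vec r \<Longrightarrow> repeat_vec m b \<in> carrier_vec (m * r)"
  by (induction m) auto

lemma append_vec_assoc: "(a @\<^sub>v b) @\<^sub>v c = a @\<^sub>v (b @\<^sub>v (c :: int vec))"
  by (intro eq_vecI) (auto simp: add.assoc)

lemma repeat_vec_add: "repeat_vec (m + m') b = repeat_vec m b @\<^sub>v repeat_vec m' b"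
  by (induction m) (auto simp: append_vec_assoc)

lemma repeat_vec_mult: "repeat_vec (m * m') b = repeat_vec m (repeat_vec m' b)"
  by (induction m) (auto simp: repeat_vec_add)

lemma repeat_vec_minus:
  "b \<in> carrier_vec r \<Longrightarrow> c \<in> carrier_vec r \<Longrightarrow> repeat_vec m (b - c) = repeat_vec m b - repeat_vec m c"
proof (induction m)
  case (Suc m)
  then show ?case
    using append_vec_minus[of b r c "repeat_vec m b" "m * r" "repeat_vec m c"] repeat_vec_carrier[of _ r m]
    by simp
qed auto

lemma repeat_vec_zero: "repeat_vec m (0\<^sub>v r) = 0\<^sub>v (m * r)"
  by (induction m) (auto intro!: eq_vecI)

lemma repeat_vec_1: "repeat_vec (Suc 0) b = b"
  by (intro eq_vecI) auto

lemma beside_mult_vec: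
  assumes M: "M \<in> carrier_mat r a" "M' \<in> carrier_mat r b" and z: "z \<in> carrier_vec (a + b)"
  shows "beside M M' *\<^sub>v z = M *\<^sub>v vec_first z a + M' *\<^sub>v vec_last z b"
proof -
  have dims: "dim_col M = a" "dim_col M' = b" using M by auto
  have "beside M M' *\<^sub>v (vec_first z a @\<^sub>v vec_last z b) = (M *\<^sub>v vec_first z a + M' *\<^sub>v vec_last z b) @\<^sub>v
      (0\<^sub>m 0 a *\<^sub>v vec_first z a + 0\<^sub>m 0 b *\<^sub>v vec_last z b)"
    unfolding beside_def dims by (rule four_block_mat_mult_vec) (use M in auto)
  also have "\<dots> = M *\<^sub>v vec_first z a + M' *\<^sub>v vec_last z b" by (intro eq_vecI) auto
  finally show ?thesis using z by simp
qed

lemma stack_mult_vec: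
  assumes M: "M \<in> carrier_mat r c" and w: "w \<in> carrier_vec c"
  shows "stack m M *\<^sub>v w = repeat_vec m (M *\<^sub>v w)"
proof (induction m)
  case 0
  show ?case by (intro eq_vecI) (auto simp: stack_def)
next
  case (Suc m)
  have "stack (Suc m) M = M @\<^sub>r stack m M" by (simp add: stack_def)
  moreover have "stack m M \<in> carrier_mat (m * r) c" using stack_dim[of m M] M by auto
  ultimately show ?case using mat_mult_append[OF M _ w] Suc by simp
qed

definition slice :: "nat \<Rightarrow> int vec \<Rightarrow> nat \<Rightarrow> int vec" where
  "slice c u i = vec c (\<lambda>j. u $ (i * c + j))"

text \<open>The block rows of the product with \<open>A\<^sub>h\<^sub>,\<^sub>N\<close> are independent of each other, because the
  contribution \<open>y\<close> of the first block column is the same in all of them.\<close>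

lemma diag_mult_vec_eq_iff:
  assumes B: "B \<in> carrier_mat r c" and y: "y \<in> carrier_vec r" and e: "e \<in> carrier_vec r"
  shows "u \<in> carrier_vec (m * c) \<Longrightarrow>
    repeat_vec m y + diag_block_mat (replicate m B) *\<^sub>v u = repeat_vec m e \<longleftrightarrow>
    (\<forall>i<m. y + B *\<^sub>v slice c u i = e)"
proof (induction m arbitrary: u)
  case 0
  then show ?case by (auto intro!: eq_vecI)
next
  case (Suc m)
  let ?D = "diag_block_mat (replicate m B)"
  let ?u = "vec_first u c" and ?v = "vec_last u (m * c)"
  have u: "u = ?u @\<^sub>v ?v" "?v \<in> carrier_vec (m * c)" using Suc.prems by simp_all
  have D: "?D \<in> carrier_mat (m * r) (m * c)"
    using B by (intro carrier_matI) (auto simp: dim_diag_block_mat sum_list_replicate)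
  have split: "diag_block_mat (replicate (Suc m) B) =
      four_block_mat B (0\<^sub>m r (m * c)) (0\<^sub>m (m * r) c) ?D"
    using B D by (simp add: Let_def carrier_matD[OF B] carrier_matD[OF D])
  have "diag_block_mat (replicate (Suc m) B) *\<^sub>v (?u @\<^sub>v ?v) =
      (B *\<^sub>v ?u + 0\<^sub>m r (m * c) *\<^sub>v ?v) @\<^sub>v (0\<^sub>m (m * r) c *\<^sub>v ?u + ?D *\<^sub>v ?v)"
    unfolding split by (rule four_block_mat_mult_vec[OF B _ _ D]) auto
  also have "\<dots> = (B *\<^sub>v ?u) @\<^sub>v (?D *\<^sub>v ?v)"
    using B D by (intro arg_cong2[of _ _ _ _ append_vec] eq_vecI) auto
  finally have mult: "diag_block_mat (replicate (Suc m) B) *\<^sub>v u = (B *\<^sub>v ?u) @\<^sub>v (?D *\<^sub>v ?v)"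
    using u(1) by simp
  have c: "B *\<^sub>v ?u \<in> carrier_vec r" "?D *\<^sub>v ?v \<in> carrier_vec (m * r)" using B D by auto
  have "repeat_vec (Suc m) y + diag_block_mat (replicate (Suc m) B) *\<^sub>v u =
      (y + B *\<^sub>v ?u) @\<^sub>v (repeat_vec m y + ?D *\<^sub>v ?v)"
    unfolding mult repeat_vec.simps using append_vec_add[OF y c(1) repeat_vec_carrier[OF y] c(2)] .
  moreover have "y + B *\<^sub>v ?u \<in> carrier_vec r" using y c by simp
  ultimately have "repeat_vec (Suc m) y + diag_block_mat (replicate (Suc m) B) *\<^sub>v u = repeat_vec (Suc m) e \<longleftrightarrow>
      y + B *\<^sub>v ?u = e \<and> repeat_vec m y + ?D *\<^sub>v ?v = repeat_vec m e"
    using append_vec_eq e by simp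
  also have "\<dots> \<longleftrightarrow> y + B *\<^sub>v slice c u 0 = e \<and> (\<forall>i<m. y + B *\<^sub>v slice c u (Suc i) = e)"
  proof -
    have "?u = slice c u 0" by (auto simp: slice_def vec_first_def)
    moreover have "slice c ?v i = slice c u (Suc i)" if "i < m" for i
    proof (rule eq_vecI)
      fix j assume "j < dim_vec (slice c u (Suc i))"
      then have j: "j < c" by (simp add: slice_def)
      have "i * c + j < m * c" using coordinate_bound[of "Suc i" m j c] that j by simp
      then have "?v $ (i * c + j) = u $ (c + (i * c + j))"
        using Suc.prems by (simp add: vec_last_def)
      then show "slice c ?v i $ j = slice c u (Suc i) $ j" using j by (simp add: slice_def add.assoc)
    qed (simp add: slice_def)
    ultimately show ?thesis using Suc.IH[OF u(2)] by simp
  qed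
  also have "\<dots> \<longleftrightarrow> (\<forall>i<Suc m. y + B *\<^sub>v slice c u i = e)"
    by (auto simp: less_Suc_eq_0_disj)
  finally show ?case .
qed

text \<open>The product of \<open>A\<^sub>h\<^sub>,\<^sub>1 = (T\<^sub>h | \<dots> | T\<^sub>0)\<close> with \<open>v\<close>, as the recursion over the height
  produces it.\<close>

fun path_value :: "(nat \<Rightarrow> int mat) \<Rightarrow> (nat \<Rightarrow> nat) \<Rightarrow> nat \<Rightarrow> int vec \<Rightarrow> int vec" where
  "path_value T n 0 v = T 0 *\<^sub>v v"
| "path_value T n (Suc h) v =
     T (Suc h) *\<^sub>v vec_first v (n (Suc h)) + path_value T n h (vec_last v (path_dim n h))"

lemma path_value_carrier:
  "(\<And>i. i \<le> h \<Longrightarrow> T i \<in> carrier_mat l (n i)) \<Longrightarrow> path_value T n h v \<in> carrier_vec l"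
proof (induction h arbitrary: v)
  case 0
  then have "T 0 \<in> carrier_mat l (n 0)" by simp
  then show ?case by (intro carrier_vecI) simp
next
  case (Suc h)
  have "T (Suc h) \<in> carrier_mat l (n (Suc h))" using Suc.prems by simp
  then have "T (Suc h) *\<^sub>v vec_first v (n (Suc h)) \<in> carrier_vec l" by (intro carrier_vecI) simp
  moreover have "path_value T n h (vec_last v (path_dim n h)) \<in> carrier_vec l"
    using Suc.IH Suc.prems by simp
  ultimately show ?case by simp
qed

lemma vec_last_append: "w \<in> carrier_vec b \<Longrightarrow> vec_last (v @\<^sub>v w) b = w"
  by (intro eq_vecI) (auto simp: vec_last_def)

text \<open>The \<open>N ^ h\<close> blocks of \<open>l\<close> rows of \<open>A\<^sub>h\<^sub>,\<^sub>N\<close> correspond to the full addresses, and the block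
  of \<open>\<alpha>\<close> involves only the blocks of \<open>z\<close> along \<open>\<alpha>\<close>. The right-hand side \<open>b\<close> is arbitrary
  because in the induction the contribution of the first block is moved to that side.\<close>

lemma stage_mat_mult_eq_iff:
  "(\<And>i. i \<le> h \<Longrightarrow> T i \<in> carrier_mat l (n i)) \<Longrightarrow> z \<in> carrier_vec (stage_dim n h N) \<Longrightarrow> b \<in> carrier_vec l \<Longrightarrow>
   stage_mat T h N *\<^sub>v z = repeat_vec (N ^ h) b \<longleftrightarrow>
   (\<forall>\<alpha>\<in>indices N h. path_value T n h (path_vec n N h z \<alpha>) = b)"
proof (induction h arbitrary: z b)
  case 0
  then show ?case by (auto simp: indices_0 repeat_vec_1 simp del: repeat_vec.simps)
next
  case (Suc h)
  let ?d = "stage_dim n h N" and ?w = "vec_first z (n (Suc h))" and ?u = "vec_last z (N * stage_dim n h N)"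
  let ?A = "stage_mat T h N" and ?T = "stack (N ^ h) (T (Suc h))"
  have T: "T (Suc h) \<in> carrier_mat l (n (Suc h))" and Tc: "\<And>i. i \<le> h \<Longrightarrow> T i \<in> carrier_mat l (n i)"
    using Suc.prems(1) by auto
  have A: "?A \<in> carrier_mat (l * N ^ h) ?d" by (rule stage_mat_dim) (use Tc in auto)
  have S: "?T \<in> carrier_mat (l * N ^ h) (n (Suc h))" using stack_dim[of "N ^ h" "T (Suc h)"] T by (auto simp: mult.commute)
  have z: "z \<in> carrier_vec (n (Suc h) + N * ?d)" using Suc.prems(2) by (simp add: stage_dim_Suc)
  have Tw: "T (Suc h) *\<^sub>v ?w \<in> carrier_vec l" using T by auto
  have c: "repeat_vec (N ^ h) x \<in> carrier_vec (l * N ^ h)" if "x \<in> carrier_vec l" for x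
    using repeat_vec_carrier[OF that] by (subst mult.commute)
  have SS: "stack N ?T \<in> carrier_mat (N * (l * N ^ h)) (n (Suc h))" using stack_dim[of N ?T] S by auto
  have DD: "diag_block_mat (replicate N ?A) \<in> carrier_mat (N * (l * N ^ h)) (N * ?d)"
    using A by (intro carrier_matI) (auto simp: dim_diag_block_mat sum_list_replicate)
  have "stage_mat T (Suc h) N *\<^sub>v z =
      repeat_vec N (repeat_vec (N ^ h) (T (Suc h) *\<^sub>v ?w)) + diag_block_mat (replicate N ?A) *\<^sub>v ?u"
    unfolding stage_mat.simps beside_mult_vec[OF SS DD z] stack_mult_vec[OF S vec_first_carrier]
      stack_mult_vec[OF T vec_first_carrier] ..
  then have "stage_mat T (Suc h) N *\<^sub>v z = repeat_vec (N ^ Suc h) b \<longleftrightarrow>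
      (\<forall>i<N. repeat_vec (N ^ h) (T (Suc h) *\<^sub>v ?w) + ?A *\<^sub>v slice ?d ?u i = repeat_vec (N ^ h) b)"
    unfolding power_Suc repeat_vec_mult
    using diag_mult_vec_eq_iff[OF A c[OF Tw] c[OF Suc.prems(3)], of ?u N] by simp
  also have "\<dots> \<longleftrightarrow> (\<forall>i<N. \<forall>\<alpha>\<in>indices N h. path_value T n (Suc h) (path_vec n N (Suc h) z (Suc i # \<alpha>)) = b)"
  proof (intro all_cong1 imp_cong refl)
    fix i assume i: "i < N"
    have slice: "slice ?d ?u i = child_vec n N h z (Suc i)"
    proof (rule eq_vecI)
      fix j assume "j < dim_vec (child_vec n N h z (Suc i))"
      then have j: "j < ?d" by (simp add: child_vec_def)
      have "i * ?d + j < N * ?d" using coordinate_bound[of "Suc i" N j ?d] i j by simp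
      then have "?u $ (i * ?d + j) = z $ (n (Suc h) + (i * ?d + j))"
        using z by (simp add: vec_last_def)
      then show "slice ?d ?u i $ j = child_vec n N h z (Suc i) $ j"
        using j by (simp add: slice_def child_vec_def add.assoc)
    qed (simp add: slice_def child_vec_def)
    let ?z = "child_vec n N h z (Suc i)"
    have Az: "?A *\<^sub>v ?z \<in> carrier_vec (l * N ^ h)" using A by auto
    have solve: "x + y = e \<longleftrightarrow> y = e - x" if "x \<in> carrier_vec r" "y \<in> carrier_vec r" "e \<in> carrier_vec r"
      for x y e :: "int vec" and r
      using that by (auto simp: vec_eq_iff)
    have "repeat_vec (N ^ h) (T (Suc h) *\<^sub>v ?w) + ?A *\<^sub>v slice ?d ?u i = repeat_vec (N ^ h) b \<longleftrightarrow>
        ?A *\<^sub>v ?z = repeat_vec (N ^ h) (b - T (Suc h) *\<^sub>v ?w)"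
      unfolding slice repeat_vec_minus[OF Suc.prems(3) Tw] using solve[OF c[OF Tw] Az c[OF Suc.prems(3)]] .
    also have "\<dots> \<longleftrightarrow> (\<forall>\<alpha>\<in>indices N h. path_value T n h (path_vec n N h ?z \<alpha>) = b - T (Suc h) *\<^sub>v ?w)"
      by (rule Suc.IH[OF Tc]) (use Suc.prems(3) Tw in auto)
    also have "\<dots> \<longleftrightarrow> (\<forall>\<alpha>\<in>indices N h. path_value T n (Suc h) (path_vec n N (Suc h) z (Suc i # \<alpha>)) = b)"
    proof (rule ball_cong[OF refl])
      fix \<alpha> assume \<alpha>: "\<alpha> \<in> indices N h"
      have "vec_last (path_vec n N (Suc h) z (Suc i # \<alpha>)) (path_dim n h) = path_vec n N h ?z \<alpha>"
        by (simp only: path_vec.simps vec_last_append[OF path_vec_carrier[OF child_vec_carrier \<alpha>]])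
      moreover have "vec_first (path_vec n N (Suc h) z (Suc i # \<alpha>)) (n (Suc h)) = ?w"
        by (simp add: vec_first_app)
      ultimately show "path_value T n h (path_vec n N h ?z \<alpha>) = b - T (Suc h) *\<^sub>v ?w \<longleftrightarrow>
          path_value T n (Suc h) (path_vec n N (Suc h) z (Suc i # \<alpha>)) = b"
        using solve[OF Tw path_value_carrier[OF Tc] Suc.prems(3)] by simp
    qed
    finally show "repeat_vec (N ^ h) (T (Suc h) *\<^sub>v ?w) + ?A *\<^sub>v slice ?d ?u i = repeat_vec (N ^ h) b \<longleftrightarrow>
      (\<forall>\<alpha>\<in>indices N h. path_value T n (Suc h) (path_vec n N (Suc h) z (Suc i # \<alpha>)) = b)" .
  qed
  also have "\<dots> \<longleftrightarrow> (\<forall>\<alpha>\<in>indices N (Suc h). path_value T n (Suc h) (path_vec n N (Suc h) z \<alpha>) = b)"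
  proof -
    have "(\<forall>i<N. P (Suc i)) \<longleftrightarrow> (\<forall>i\<in>{1..N}. P i)" for P
      by (metis Suc_le_eq atLeastAtMost_iff One_nat_def Suc_le_D le_simps(3) Suc_le_mono le0)
    then show ?thesis unfolding ball_indices_Suc by simp
  qed
  finally show ?case .
qed

lemma path_vec_1:
  "z \<in> carrier_vec (path_dim n h) \<Longrightarrow> \<alpha> \<in> indices 1 h \<Longrightarrow> path_vec n 1 h z \<alpha> = z"
proof (induction h arbitrary: z \<alpha>)
  case (Suc h)
  obtain i \<beta> where \<alpha>: "\<alpha> = i # \<beta>" "i \<in> {1..1}" "\<beta> \<in> indices 1 h" using Suc.prems(2) unfolding indices_Suc by blast
  have z: "z \<in> carrier_vec (n (Suc h) + path_dim n h)" using Suc.prems(1) by (simp add: path_dim_Suc)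
  have "child_vec n 1 h z i = vec_last z (path_dim n h)"
    using z \<alpha>(2) by (intro eq_vecI) (auto simp: child_vec_def vec_last_def stage_dim_1)
  then show ?case unfolding \<alpha>(1) using Suc.IH[OF vec_last_carrier \<alpha>(3)] z by simp
qed simp

text \<open>For \<open>N = 1\<close> there is one full address, and its path vector is the whole vector.\<close>

lemma mat_kernel_1_iff:
  assumes T: "\<And>i. i \<le> h \<Longrightarrow> T i \<in> carrier_mat l (n i)"
  shows "v \<in> mat_kernel (stage_mat T h 1) \<longleftrightarrow> v \<in> carrier_vec (path_dim n h) \<and> path_value T n h v = 0\<^sub>v l"
proof -
  have A: "stage_mat T h 1 \<in> carrier_mat l (path_dim n h)"
    using stage_mat_dim[of h T l n 1] T by (simp add: stage_dim_1)
  have "stage_mat T h 1 *\<^sub>v v = 0\<^sub>v l \<longleftrightarrow> path_value T n h v = 0\<^sub>v l" if v: "v \<in> carrier_vec (path_dim n h)"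
  proof -
    have "stage_mat T h 1 *\<^sub>v v = 0\<^sub>v l \<longleftrightarrow>
        (\<forall>\<alpha>\<in>indices 1 h. path_value T n h (path_vec n 1 h v \<alpha>) = 0\<^sub>v l)"
      using stage_mat_mult_eq_iff[of h T l n v 1 "0\<^sub>v l"] T v
      by (simp add: stage_dim_1 repeat_vec_1 del: repeat_vec.simps)
    then show ?thesis using path_vec_1[OF v] indices_nonempty[of 1 h] by auto
  qed
  then show ?thesis using mat_kernel[OF A] by auto
qed

lemma mat_kernel_iff_paths:
  assumes T: "\<And>i. i \<le> h \<Longrightarrow> T i \<in> carrier_mat l (n i)" and z: "z \<in> carrier_vec (stage_dim n h N)"
  shows "z \<in> mat_kernel (stage_mat T h N) \<longleftrightarrow>
    (\<forall>\<alpha>\<in>indices N h. path_vec n N h z \<alpha> \<in> mat_kernel (stage_mat T h 1))"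
proof -
  have A: "stage_mat T h N \<in> carrier_mat (l * N ^ h) (stage_dim n h N)"
    using stage_mat_dim T by blast
  have "z \<in> mat_kernel (stage_mat T h N) \<longleftrightarrow> stage_mat T h N *\<^sub>v z = repeat_vec (N ^ h) (0\<^sub>v l)"
    using mat_kernel[OF A] z by (simp add: repeat_vec_zero mult.commute)
  also have "\<dots> \<longleftrightarrow> (\<forall>\<alpha>\<in>indices N h. path_value T n h (path_vec n N h z \<alpha>) = 0\<^sub>v l)"
    by (rule stage_mat_mult_eq_iff[OF T z]) auto
  finally show ?thesis
    using path_vec_carrier[OF z] mat_kernel_1_iff[of h T l n, OF T] by blast
qed

lemma zero_append_in_kernel_iff:
  assumes T: "\<And>i. i \<le> Suc h \<Longrightarrow> T i \<in> carrier_mat l (n i)" and v: "v \<in> carrier_vec (path_dim n h)"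
  shows "0\<^sub>v (n (Suc h)) @\<^sub>v v \<in> mat_kernel (stage_mat T (Suc h) 1) \<longleftrightarrow> v \<in> mat_kernel (stage_mat T h 1)"
proof -
  have T': "\<And>i. i \<le> h \<Longrightarrow> T i \<in> carrier_mat l (n i)" using T by simp
  have "T (Suc h) *\<^sub>v 0\<^sub>v (n (Suc h)) = 0\<^sub>v l" using T[of "Suc h"] by (intro eq_vecI) auto
  then have "path_value T n (Suc h) (0\<^sub>v (n (Suc h)) @\<^sub>v v) = path_value T n h v"
    using v path_value_carrier[of h T l n v] T' by (simp add: vec_first_app vec_last_append)
  moreover have "0\<^sub>v (n (Suc h)) @\<^sub>v v \<in> carrier_vec (path_dim n (Suc h))"
    using v by (simp add: path_dim_Suc)
  ultimately show ?thesis
    using mat_kernel_1_iff[of h T l n, OF T']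
      mat_kernel_1_iff[of "Suc h" T l n, OF T] v by auto
qed

section \<open>Spans of vector-trees\<close>

lemma paths_tree_of_vec:
  "N \<ge> 1 \<Longrightarrow> z \<in> carrier_vec (stage_dim n h N) \<Longrightarrow>
   paths (tree_of_vec n N h z) = path_vec n N h z ` indices N h"
proof (induction h arbitrary: z)
  case 0
  then have "vec_first z (n 0) = z" by (auto simp: vec_first_def stage_dim_0)
  then show ?case using paths_0[OF vector_tree_of_vec[OF 0(1), of n 0 z]] by (simp add: root_tree_of_vec indices_0)
next
  case (Suc h)
  have "paths (tree_of_vec n N (Suc h) z) =
      {vec_first z (n (Suc h)) @\<^sub>v p | i p. i \<in> {1..N} \<and> p \<in> paths (tree_of_vec n N h (child_vec n N h z i))}"
    unfolding paths_Suc[OF vector_tree_of_vec[OF Suc.prems(1)]] root_tree_of_vec subtrees_tree_of_vec by blast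
  also have "\<dots> = {path_vec n N (Suc h) z (i # \<alpha>) | i \<alpha>. i \<in> {1..N} \<and> \<alpha> \<in> indices N h}"
    unfolding Suc.IH[OF Suc.prems(1) child_vec_carrier] path_vec.simps by blast
  also have "\<dots> = path_vec n N (Suc h) z ` indices N (Suc h)"
    unfolding indices_Suc by blast
  finally show ?case .
qed

lemma tree_span_iff:
  "N \<ge> 1 \<Longrightarrow> z \<in> tree_span n h N S \<longleftrightarrow>
    z \<in> carrier_vec (stage_dim n h N) \<and> (\<forall>\<alpha>\<in>indices N h. path_vec n N h z \<alpha> \<in> paths S)"
  unfolding tree_span_def using paths_tree_of_vec[of N z n h] by auto

lemma tree_span_carrier: "z \<in> tree_span n h N S \<Longrightarrow> z \<in> carrier_vec (stage_dim n h N)"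
  by (simp add: tree_span_def)

lemma trees_span_carrier: "trees_span n h N G \<subseteq> carrier_vec (stage_dim n h N)"
  unfolding trees_span_def tree_span_def by blast

lemma tree_span_add:
  assumes K: "additive_subgroup (path_dim n h) K" and S: "tree_over n h K S" and U: "tree_over n h K U"
    and N: "N \<ge> 1" and z: "z \<in> tree_span n h N S" and y: "y \<in> tree_span n h N U"
  shows "z + y \<in> tree_span n h N (tree_add n h S U)"
proof -
  have c: "z \<in> carrier_vec (stage_dim n h N)" "y \<in> carrier_vec (stage_dim n h N)"
    using z y by (auto simp: tree_span_def)
  have "path_vec n N h (z + y) \<alpha> \<in> paths (tree_add n h S U)" if \<alpha>: "\<alpha> \<in> indices N h" for \<alpha>
    unfolding path_vec_add[OF c \<alpha>] tree_add_over(2)[OF K S U]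
    using y z \<alpha> tree_span_iff[OF N] by blast
  then show ?thesis unfolding tree_span_iff[OF N] using c by simp
qed

lemma tree_span_first:
  assumes "N \<ge> 1" "vector_tree n h S" "z \<in> tree_span n h N S"
  shows "vec_first z (n h) = tree_root S"
proof -
  obtain \<alpha> where \<alpha>: "\<alpha> \<in> indices N h" using indices_nonempty[OF assms(1)] by blast
  then have "path_vec n N h z \<alpha> \<in> paths S" using assms(3) tree_span_iff[OF assms(1)] by blast
  then show ?thesis
    using paths_first[OF assms(2)] path_vec_first[OF \<alpha> tree_span_carrier[OF assms(3)]] by simp
qed

text \<open>All paths of \<open>T(z\<^sub>(\<^sub>i\<^sub>))\<close> start with the same label, and by tightness only one child of the
  root of \<open>S\<close> carries it.\<close>

lemma tree_span_child:
  assumes N: "N \<ge> 1" and S: "vector_tree n (Suc h) S" "tight S"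
    and z: "z \<in> tree_span n (Suc h) N S" and i: "i \<in> {1..N}"
  obtains S' where "S' \<in> subtrees S" "child_vec n N h z i \<in> tree_span n h N S'"
proof -
  let ?y = "child_vec n N h z i"
  have ex: "\<exists>S'\<in>subtrees S. path_vec n N h ?y \<alpha> \<in> paths S'" if \<alpha>: "\<alpha> \<in> indices N h" for \<alpha>
  proof -
    have "i # \<alpha> \<in> indices N (Suc h)" using i \<alpha> by (auto simp: indices_Suc)
    then have "path_vec n N (Suc h) z (i # \<alpha>) \<in> paths S" using z tree_span_iff[OF N] by blast
    then obtain S' p where S': "S' \<in> subtrees S" "p \<in> paths S'"
        "vec_first z (n (Suc h)) @\<^sub>v path_vec n N h ?y \<alpha> = tree_root S @\<^sub>v p"
      unfolding paths_Suc[OF S(1)] by auto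
    then show ?thesis using append_vec_eq[OF vec_first_carrier vector_tree_root[OF S(1)]] by auto
  qed
  obtain \<alpha>0 where \<alpha>0: "\<alpha>0 \<in> indices N h" using indices_nonempty[OF N] by blast
  then obtain S0 where S0: "S0 \<in> subtrees S" "path_vec n N h ?y \<alpha>0 \<in> paths S0" using ex by blast
  have root: "tree_root S' = vec_first ?y (n h)"
    if "S' \<in> subtrees S" "path_vec n N h ?y \<alpha> \<in> paths S'" "\<alpha> \<in> indices N h" for S' \<alpha>
    using paths_first[OF vector_tree_subtree[OF S(1) that(1)] that(2)] path_vec_first[OF that(3) child_vec_carrier]
    by simp
  have "path_vec n N h ?y \<alpha> \<in> paths S0" if \<alpha>: "\<alpha> \<in> indices N h" for \<alpha>
  proof -
    obtain S' where S': "S' \<in> subtrees S" "path_vec n N h ?y \<alpha> \<in> paths S'" using ex[OF \<alpha>] by blast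
    have "S' = S0" using tight_subtree_unique[OF S(2) S'(1) S0(1)] root[OF S' \<alpha>] root[OF S0 \<alpha>0] by simp
    then show ?thesis using S'(2) by simp
  qed
  then have "?y \<in> tree_span n h N S0" unfolding tree_span_iff[OF N] by simp
  then show thesis using that S0(1) by blast
qed

text \<open>The vector \<open>y\<close> is built from the root downwards: each child of \<open>z\<close> lies in the span of some
  subtree of \<open>S\<close>, and reducibility provides a subtree of \<open>U\<close> that reduces it.\<close>

lemma tree_span_reduce:
  assumes N: "N \<ge> 1"
  shows "vector_tree n h S \<Longrightarrow> tight S \<Longrightarrow> vector_tree n h U \<Longrightarrow> reduces h U S \<Longrightarrow> z \<in> tree_span n h N S \<Longrightarrow>
    \<exists>y\<in>tree_span n h N U. y \<sqsubseteq>\<^sub>c z \<and> (\<forall>\<alpha>\<in>indices N h. path_vec n N h y \<alpha> \<sqsubseteq>\<^sub>c path_vec n N h z \<alpha>)"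
proof (induction h arbitrary: S U z)
  case 0
  have "z = tree_root S" using 0 paths_0[OF 0(1)] tree_span_iff[OF N] by (auto simp: indices_0)
  moreover have "tree_root U \<in> tree_span n 0 N U"
    using paths_0[OF 0(3)] vector_tree_root[OF 0(3)] unfolding tree_span_iff[OF N] by (simp add: indices_0 stage_dim_0)
  ultimately show ?case using 0(4) by (intro bexI[of _ "tree_root U"]) auto
next
  case (Suc h)
  have zc: "z \<in> carrier_vec (stage_dim n (Suc h) N)" using Suc.prems(5) by (rule tree_span_carrier)
  have "\<exists>y U'. U' \<in> subtrees U \<and> y \<in> tree_span n h N U' \<and> y \<sqsubseteq>\<^sub>c child_vec n N h z i \<and>
      (\<forall>\<alpha>\<in>indices N h. path_vec n N h y \<alpha> \<sqsubseteq>\<^sub>c path_vec n N h (child_vec n N h z i) \<alpha>)"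
    if i: "i \<in> {1..N}" for i
  proof -
    obtain S' where S': "S' \<in> subtrees S" "child_vec n N h z i \<in> tree_span n h N S'"
      using tree_span_child[OF N Suc.prems(1,2,5) i] by blast
    obtain U' where U': "U' \<in> subtrees U" "reduces h U' S'" using Suc.prems(4) S'(1) by auto
    show ?thesis
      using Suc.IH[OF vector_tree_subtree[OF Suc.prems(1) S'(1)] tight_subtree[OF Suc.prems(2) S'(1)]
          vector_tree_subtree[OF Suc.prems(3) U'(1)] U'(2) S'(2)] U'(1) by blast
  qed
  then obtain Y V where Y: "\<And>i. i \<in> {1..N} \<Longrightarrow> V i \<in> subtrees U \<and> Y i \<in> tree_span n h N (V i) \<and> Y i \<sqsubseteq>\<^sub>c child_vec n N h z i \<and>
      (\<forall>\<alpha>\<in>indices N h. path_vec n N h (Y i) \<alpha> \<sqsubseteq>\<^sub>c path_vec n N h (child_vec n N h z i) \<alpha>)"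
    by metis
  have Yc: "Y i \<in> carrier_vec (stage_dim n h N)" if "i \<in> {1..N}" for i
    using Y[OF that] tree_span_carrier by blast
  obtain y where y: "y \<in> carrier_vec (stage_dim n (Suc h) N)" "vec_first y (n (Suc h)) = tree_root U"
      "\<And>i. i \<in> {1..N} \<Longrightarrow> child_vec n N h y i = Y i"
    by (rule ex_vec_with_children[of "tree_root U" n h N Y])
      (use vector_tree_root[OF Suc.prems(3)] Yc in auto)
  have root: "tree_root U \<sqsubseteq>\<^sub>c vec_first z (n (Suc h))"
    using reduces_root[OF Suc.prems(4)] tree_span_first[OF N Suc.prems(1,5)] by simp
  have "y \<sqsubseteq>\<^sub>c z" by (rule conformal_if_children[OF zc y(1)]) (use y root Y in auto)
  moreover have "y \<in> tree_span n (Suc h) N U"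
    unfolding tree_span_iff[OF N] ball_indices_Suc
  proof (intro conjI ballI y(1))
    fix i \<alpha> assume i: "i \<in> {1..N}" and \<alpha>: "\<alpha> \<in> indices N h"
    have "path_vec n N h (Y i) \<alpha> \<in> paths (V i)" using Y[OF i] \<alpha> tree_span_iff[OF N] by blast
    then show "path_vec n N (Suc h) y (i # \<alpha>) \<in> paths U"
      unfolding path_vec.simps y(2) y(3)[OF i] paths_Suc[OF Suc.prems(3)] using Y[OF i] by blast
  qed
  moreover have "\<forall>\<alpha>\<in>indices N (Suc h). path_vec n N (Suc h) y \<alpha> \<sqsubseteq>\<^sub>c path_vec n N (Suc h) z \<alpha>"
    unfolding ball_indices_Suc
  proof (intro ballI)
    fix i \<alpha> assume i: "i \<in> {1..N}" and \<alpha>: "\<alpha> \<in> indices N h"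
    show "path_vec n N (Suc h) y (i # \<alpha>) \<sqsubseteq>\<^sub>c path_vec n N (Suc h) z (i # \<alpha>)"
      unfolding path_vec.simps y(2) y(3)[OF i]
      using Y[OF i] \<alpha> root conformal_append[OF vector_tree_root[OF Suc.prems(3)] vec_first_carrier] by blast
  qed
  ultimately show ?case by blast
qed

lemma tree_span_diff:
  assumes K: "additive_subgroup (path_dim n h) K" and S: "tree_over n h K S" and U: "tree_over n h K U"
    and red: "reduces h U S" and N: "N \<ge> 1" and z: "z \<in> tree_span n h N S"
  obtains y where "y \<in> tree_span n h N U" "y \<sqsubseteq>\<^sub>c z" "z - y \<in> tree_span n h N (tree_diff n h S U)"
proof -
  obtain y where y: "y \<in> tree_span n h N U" "y \<sqsubseteq>\<^sub>c z"
      "\<forall>\<alpha>\<in>indices N h. path_vec n N h y \<alpha> \<sqsubseteq>\<^sub>c path_vec n N h z \<alpha>"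
    using tree_span_reduce[OF N, of n h S U z] S U red z unfolding tree_over_def by blast
  note c = tree_span_carrier[OF z] tree_span_carrier[OF y(1)]
  have "path_vec n N h (z - y) \<alpha> \<in> paths (tree_diff n h S U)" if \<alpha>: "\<alpha> \<in> indices N h" for \<alpha>
    unfolding path_vec_minus[OF c \<alpha>] tree_diff_over(2)[OF K S U red]
    using y z \<alpha> tree_span_iff[OF N] by blast
  then have "z - y \<in> tree_span n h N (tree_diff n h S U)" unfolding tree_span_iff[OF N] using c by simp
  then show thesis using that y by blast
qed

section \<open>Invariant of the completion procedure\<close>

lemma nf_step_over:
  assumes K: "additive_subgroup (path_dim n h) K" and G: "\<forall>V\<in>G. tree_over n h K V"
    and step: "nf_step n h G S S'" and S: "tree_over n h K S"
  shows "tree_over n h K S'"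
  using step tree_diff_over(1)[OF K S] G unfolding nf_step_def by auto

lemma nf_steps_over:
  assumes K: "additive_subgroup (path_dim n h) K" and G: "\<forall>V\<in>G. tree_over n h K V"
    and steps: "(nf_step n h G)\<^sup>*\<^sup>* S U" and S: "tree_over n h K S"
  shows "tree_over n h K U"
  using steps
proof (induction rule: rtranclp_induct)
  case base
  show ?case by (rule S)
next
  case (step V W)
  show ?case by (rule nf_step_over[OF K G step(2) step(3)])
qed

text \<open>Each step of the normal form procedure splits off a member of \<open>X\<close> conformally, so
  decompositions can be pulled back from the normal form.\<close>

lemma nf_steps_conformal_sum:
  assumes K: "additive_subgroup (path_dim n h) K" and G: "\<forall>V\<in>G. tree_over n h K V"
    and X: "trees_span n h N G \<subseteq> X" and N: "N \<ge> 1"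
    and U: "\<And>u. u \<in> tree_span n h N U \<Longrightarrow> conformal_sum (stage_dim n h N) X u"
    and steps: "(nf_step n h G)\<^sup>*\<^sup>* S U"
  shows "tree_over n h K S \<Longrightarrow> z \<in> tree_span n h N S \<Longrightarrow> conformal_sum (stage_dim n h N) X z"
  using steps
proof (induction arbitrary: z rule: converse_rtranclp_induct)
  case base
  then show ?case using U by blast
next
  case (step S S')
  obtain V where V: "V \<in> G" "reduces h V S" "S' = tree_diff n h S V"
    using step.hyps(1) unfolding nf_step_def by blast
  have VG: "tree_over n h K V" using V(1) G by blast
  obtain y where y: "y \<in> tree_span n h N V" "y \<sqsubseteq>\<^sub>c z" "z - y \<in> tree_span n h N S'"
    using tree_span_diff[OF K step.prems(1) VG V(2) N step.prems(2)] V(3) by blast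
  have "y \<in> X" using y(1) V(1) X unfolding trees_span_def by blast
  then have "conformal_sum (stage_dim n h N) X y" by (rule conformal_sum_single)
  moreover have "conformal_sum (stage_dim n h N) X (z - y)"
    using step.IH[OF nf_step_over[OF K G step.hyps(1) step.prems(1)] y(3)] .
  ultimately show ?case using conformal_sum_split[OF tree_span_carrier[OF step.prems(2)] y(2)] by blast
qed

text \<open>The property of a sum that the completion procedure establishes when it removes that sum
  from \<open>C\<close>. The tree \<open>U\<close> is not required to be irreducible, so that the property persists when
  \<open>G\<close> grows.\<close>

definition resolves :: "(nat \<Rightarrow> nat) \<Rightarrow> nat \<Rightarrow> vtree set \<Rightarrow> vtree \<Rightarrow> bool" where
  "resolves n h G S \<longleftrightarrow> (\<exists>U. (nf_step n h G)\<^sup>*\<^sup>* S U \<and> (tree_root U = 0\<^sub>v (n h) \<or> U \<in> G))"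

lemma nf_step_mono: "G \<subseteq> G' \<Longrightarrow> nf_step n h G S S' \<Longrightarrow> nf_step n h G' S S'"
  unfolding nf_step_def by blast

lemma nf_steps_mono: "G \<subseteq> G' \<Longrightarrow> (nf_step n h G)\<^sup>*\<^sup>* S S' \<Longrightarrow> (nf_step n h G')\<^sup>*\<^sup>* S S'"
  by (rule rtranclp_mono[THEN predicate2D, rotated]) (auto intro: nf_step_mono)

lemma resolves_mono: "G \<subseteq> G' \<Longrightarrow> resolves n h G S \<Longrightarrow> resolves n h G' S"
  unfolding resolves_def using nf_steps_mono by blast

fun completion_inv ::
  "(nat \<Rightarrow> nat) \<Rightarrow> nat \<Rightarrow> int vec set \<Rightarrow> vtree set \<Rightarrow> vtree set \<times> vtree set \<Rightarrow> bool" where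
  "completion_inv n h K G0 (G, C) \<longleftrightarrow>
     G0 \<subseteq> G \<and> finite G \<and> finite C \<and> symmetric_trees n h G \<and>
     (\<forall>S\<in>G. tree_over n h K S) \<and> (\<forall>S\<in>C. tree_over n h K S) \<and>
     (\<forall>S\<in>G. \<forall>U\<in>G. tree_add n h S U \<in> C \<or> resolves n h G (tree_add n h S U))"

lemma completion_inv_init:
  assumes K: "additive_subgroup (path_dim n h) K" and fin: "finite G" and sym: "symmetric_trees n h G"
    and G: "\<forall>S\<in>G. tree_over n h K S"
  shows "completion_inv n h K G (completion_init n h G)"
proof -
  let ?C = "{tree_add n h S U | S U. S \<in> G \<and> U \<in> G}"
  have "?C = (\<lambda>(S, U). tree_add n h S U) ` (G \<times> G)" by auto
  then have "finite ?C" using fin by simp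
  moreover have "\<forall>S\<in>?C. tree_over n h K S" using tree_add_over(1)[OF K] G by blast
  ultimately show ?thesis unfolding completion_init_def completion_inv.simps using fin sym G by blast
qed

lemma completion_inv_step:
  assumes K: "additive_subgroup (path_dim n h) K"
    and step: "completion_step n h (G, C) (G', C')" and inv: "completion_inv n h K G0 (G, C)"
  shows "completion_inv n h K G0 (G', C')"
proof -
  have fin: "G0 \<subseteq> G" "finite G" "finite C" and sym: "symmetric_trees n h G"
    and G: "\<forall>S\<in>G. tree_over n h K S" and C: "\<forall>S\<in>C. tree_over n h K S"
    and pairs: "\<And>S U. S \<in> G \<Longrightarrow> U \<in> G \<Longrightarrow> tree_add n h S U \<in> C \<or> resolves n h G (tree_add n h S U)"
    using inv unfolding completion_inv.simps by blast+
  from step show ?thesis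
  proof cases
    case (discard S U)
    have "resolves n h G S" using discard unfolding resolves_def normal_form_def by blast
    then have "\<forall>S\<in>G. \<forall>U\<in>G. tree_add n h S U \<in> C' \<or> resolves n h G' (tree_add n h S U)"
      using pairs discard by blast
    then show ?thesis using discard fin sym G C unfolding completion_inv.simps by blast
  next
    case (enlarge S U)
    let ?U' = "tree_neg n h U"
    have "tree_over n h K S" using enlarge C by blast
    then have U: "tree_over n h K U"
      using nf_steps_over[OF K G] enlarge(2) unfolding normal_form_def by blast
    then have U': "tree_over n h K ?U'" by (rule tree_neg_over(1)[OF K])
    have sub: "G \<subseteq> G'" using enlarge by blast
    have G': "\<forall>S\<in>G'. tree_over n h K S" using G U U' enlarge by blast
    have "resolves n h G' S"
      using nf_steps_mono[OF sub] enlarge unfolding resolves_def normal_form_def by blast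
    then have old: "tree_add n h V W \<in> C' \<or> resolves n h G' (tree_add n h V W)" if "V \<in> G" "W \<in> G" for V W
      using pairs[OF that] resolves_mono[OF sub] enlarge by blast
    have new: "tree_add n h V W \<in> C'" if "V \<in> G'" "W \<in> {U, ?U'}" for V W
      using that enlarge by blast
    have new': "tree_add n h W V \<in> C'" if "V \<in> G'" "W \<in> {U, ?U'}" for V W
    proof -
      have "tree_add n h W V = tree_add n h V W" by (rule tree_add_commute) (use that G' U U' in auto)
      then show ?thesis using new[OF that] by simp
    qed
    have "\<forall>V\<in>G'. \<forall>W\<in>G'. tree_add n h V W \<in> C' \<or> resolves n h G' (tree_add n h V W)"
    proof (intro ballI)
      fix V W assume VW: "V \<in> G'" "W \<in> G'"
      then have "V \<in> {U, ?U'} \<or> W \<in> {U, ?U'} \<or> V \<in> G \<and> W \<in> G" using enlarge(4) by blast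
      then show "tree_add n h V W \<in> C' \<or> resolves n h G' (tree_add n h V W)"
        using new[OF VW(1)] new'[OF VW(2)] old by metis
    qed
    moreover have "finite G'" "finite C'" using fin enlarge by auto
    moreover have "symmetric_trees n h G'"
      using sym tree_neg_neg[OF K U] enlarge unfolding symmetric_trees_def by auto
    moreover have "\<forall>S\<in>C'. tree_over n h K S"
      using C tree_add_over(1)[OF K] G' U U' enlarge by auto
    ultimately show ?thesis using fin sub G' unfolding completion_inv.simps by blast
  qed
qed

lemma completion_inv_steps:
  assumes K: "additive_subgroup (path_dim n h) K"
    and steps: "(completion_step n h)\<^sup>*\<^sup>* s s'" and inv: "completion_inv n h K G0 s"
  shows "completion_inv n h K G0 s'"
  using steps
proof (induction rule: rtranclp_induct)
  case base
  show ?case by (rule inv)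
next
  case (step t u)
  then show ?case using completion_inv_step[OF K] by (cases t; cases u) blast
qed

section \<open>The completed set spans the Graver basis\<close>

lemma additive_subgroup_kernel:
  fixes A :: "int mat"
  assumes A: "A \<in> carrier_mat nr d"
  shows "additive_subgroup d (mat_kernel A)"
  unfolding additive_subgroup_def
proof (intro conjI ballI)
  show "mat_kernel A \<subseteq> carrier_vec d" by (rule mat_kernel_carrier[OF A])
  show "0\<^sub>v d \<in> mat_kernel A" using A by (intro mat_kernelI[OF A]) auto
  fix v assume v: "v \<in> mat_kernel A"
  note vc = mat_kernelD[OF A v]
  show "- v \<in> mat_kernel A" using mat_kernel_smult[OF A v, of "-1"] vc(1) by (simp add: uminus_l_inv_vec[symmetric] smult_vec_def uminus_vec_def)
  fix w assume w: "w \<in> mat_kernel A"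
  note wc = mat_kernelD[OF A w]
  show "v + w \<in> mat_kernel A"
    using mult_add_distrib_mat_vec[OF A vc(1) wc(1)] vc wc by (intro mat_kernelI[OF A]) auto
qed

text \<open>Integer multiples of generators are repeated additions of a generator or its negative.\<close>

lemma span_symmetric_induct:
  assumes gen: "generates d F M" and fin: "finite F" and Fc: "F \<subseteq> carrier_vec d" and sym: "symmetric_vecs F"
    and v: "v \<in> M" and zero: "P (0\<^sub>v d)"
    and step: "\<And>f w. f \<in> F \<Longrightarrow> w \<in> carrier_vec d \<Longrightarrow> P w \<Longrightarrow> P (f + w)"
  shows "P v"
proof -
  interpret vec_module "TYPE(int)" d .
  have mult: "P (of_nat m \<cdot>\<^sub>v f + w)" if "f \<in> F" "w \<in> carrier_vec d" "P w" for f w m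
  proof (induction m)
    case 0
    have "of_nat 0 \<cdot>\<^sub>v f + w = w" using that Fc by (intro eq_vecI) auto
    then show ?case using that by simp
  next
    case (Suc m)
    have f: "f \<in> carrier_vec d" using that Fc by auto
    have "of_nat (Suc m) \<cdot>\<^sub>v f + w = f + (of_nat m \<cdot>\<^sub>v f + w)"
      using f that by (intro eq_vecI) (auto simp: algebra_simps)
    then show ?case using step[OF that(1) _ Suc] f that(2) by simp
  qed
  have multi: "P (c \<cdot>\<^sub>v f + w)" if f: "f \<in> F" and w: "w \<in> carrier_vec d" "P w" for f w and c :: int
  proof (cases "c \<ge> 0")
    case True
    then show ?thesis using mult[OF f w, of "nat c"] by simp
  next
    case False
    have "c \<cdot>\<^sub>v f = of_nat (nat (- c)) \<cdot>\<^sub>v (- f)" using False by (intro eq_vecI) auto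
    moreover have "- f \<in> F" using f sym unfolding symmetric_vecs_def by blast
    ultimately show ?thesis using mult[OF _ w] by metis
  qed
  have "v \<in> span F" using v gen unfolding generates_def by blast
  then obtain a where a: "lincomb a F = v" using finite_in_span[OF fin] Fc by auto
  have "P (lincomb a A)" if "finite A" "A \<subseteq> F" for A
    using that
  proof (induction A rule: finite_induct)
    case empty
    have "lincomb a {} = 0\<^sub>v d" by (simp add: lincomb_def)
    then show ?case using zero by simp
  next
    case (insert f A)
    have Ac: "A \<subseteq> carrier_vec d" and f: "f \<in> F" "f \<in> carrier_vec d" using insert.prems Fc by auto
    have "lincomb a (A \<union> {f}) = a f \<cdot>\<^sub>v f + lincomb a A"
      using lincomb_insert[where S = A and a = a and v = f] insert.hyps Ac f by auto
    moreover have "lincomb a A \<in> carrier_vec d" using lincomb_closed[where S = A and a = a] Ac by auto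
    ultimately show ?case using multi[OF f(1)] insert by simp
  qed
  then show ?thesis using a fin by blast
qed

lemma path_kernel_subgroup:
  assumes "\<And>i. i \<le> h \<Longrightarrow> T i \<in> carrier_mat l (n i)"
  shows "additive_subgroup (path_dim n h) (mat_kernel (stage_mat T h 1))"
  using additive_subgroup_kernel[OF stage_mat_dim[of h T l n 1, OF assms]] by (simp add: stage_dim_1)

text \<open>These vectors realise \<open>\<langle>T(f)\<rangle>\<^sub>N\<close>: every path has label sequence \<open>f\<close>.\<close>

lemma ex_constant_vec:
  "f \<in> carrier_vec (path_dim n h) \<Longrightarrow>
   \<exists>c\<in>carrier_vec (stage_dim n h N). \<forall>\<alpha>\<in>indices N h. path_vec n N h c \<alpha> = f"
proof (induction h arbitrary: f)
  case 0
  then show ?case by (intro bexI[of _ f]) (auto simp: stage_dim_0 path_dim_def indices_0)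
next
  case (Suc h)
  have f: "f \<in> carrier_vec (n (Suc h) + path_dim n h)" using Suc.prems by (simp add: path_dim_Suc)
  obtain c where c: "c \<in> carrier_vec (stage_dim n h N)"
      "\<forall>\<alpha>\<in>indices N h. path_vec n N h c \<alpha> = vec_last f (path_dim n h)"
    using Suc.IH[OF vec_last_carrier] by blast
  obtain y where y: "y \<in> carrier_vec (stage_dim n (Suc h) N)" "vec_first y (n (Suc h)) = vec_first f (n (Suc h))"
      "\<And>i. i \<in> {1..N} \<Longrightarrow> child_vec n N h y i = c"
    by (rule ex_vec_with_children[of "vec_first f (n (Suc h))" n h N "\<lambda>_. c"]) (use c in auto)
  have "path_vec n N (Suc h) y (i # \<alpha>) = f" if "i \<in> {1..N}" "\<alpha> \<in> indices N h" for i \<alpha>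
    using y(2,3) c(2) that f by simp
  then show ?case using y(1) unfolding ball_indices_Suc by blast
qed

lemma tree_span_kernel:
  assumes T: "\<And>i. i \<le> h \<Longrightarrow> T i \<in> carrier_mat l (n i)"
    and S: "tree_over n h (mat_kernel (stage_mat T h 1)) S"
    and N: "N \<ge> 1" and z: "z \<in> tree_span n h N S"
  shows "z \<in> mat_kernel (stage_mat T h N)"
proof -
  have "\<forall>\<alpha>\<in>indices N h. path_vec n N h z \<alpha> \<in> mat_kernel (stage_mat T h 1)"
    using z S unfolding tree_span_iff[OF N] tree_over_def by blast
  then show ?thesis using mat_kernel_iff_paths[of h T l n, OF T tree_span_carrier[OF z]] by blast
qed

lemma mset_sum_of_add:
  assumes "x \<in> carrier_vec d" "w \<in> carrier_vec d" "mset_sum_of d M w"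
  shows "mset_sum_of d (add_mset x M) (x + w)"
  using assms unfolding mset_sum_of_def by simp

text \<open>Pottier's argument for \<open>X = \<langle>G\<rangle>\<^sub>N\<close>. Sums of two elements are decomposed by following the
  reduction of \<open>S + U\<close> down to a tree \<open>V\<close>. That \<open>X\<close> generates the kernel is shown by writing
  some path vector of \<open>z\<close> as a sum of generators in \<open>F\<close> and subtracting the constant vectors
  that belong to them.\<close>

lemma graver_subset_completed_span:
  assumes T: "\<And>i. i \<le> h \<Longrightarrow> T i \<in> carrier_mat l (n i)" and N: "N \<ge> 1"
    and inv: "completion_inv n h (mat_kernel (stage_mat T h 1)) G0 (G, {})"
    and F: "finite F" "symmetric_vecs F" "generates (path_dim n h) F (mat_kernel (stage_mat T h 1))"
    and FG: "\<And>f. f \<in> F \<Longrightarrow> tree_of_paths n h {f} \<in> G0"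
    and zero: "\<And>u. u \<in> mat_kernel (stage_mat T h N) \<Longrightarrow> vec_first u (n h) = 0\<^sub>v (n h) \<Longrightarrow>
      conformal_sum (stage_dim n h N) (trees_span n h N G0) u"
  shows "graver_basis (stage_mat T h N) \<subseteq> trees_span n h N G"
proof -
  let ?K = "mat_kernel (stage_mat T h 1)" and ?A = "stage_mat T h N" and ?d = "stage_dim n h N"
  let ?X = "trees_span n h N G"
  note A = stage_mat_dim[of h T l n N, OF T]
  have K: "additive_subgroup (path_dim n h) ?K" using path_kernel_subgroup[of h T l n] T by blast
  have G0: "G0 \<subseteq> G" and G: "\<forall>S\<in>G. tree_over n h ?K S"
    and pairs: "\<And>S U. S \<in> G \<Longrightarrow> U \<in> G \<Longrightarrow> resolves n h G (tree_add n h S U)"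
    using inv unfolding completion_inv.simps by blast+
  have Xc: "?X \<subseteq> carrier_vec ?d" by (rule trees_span_carrier)
  have Xk: "?X \<subseteq> mat_kernel ?A"
    using tree_span_kernel[of h T l n, OF T _ N] G unfolding trees_span_def by blast
  have G0X: "trees_span n h N G0 \<subseteq> ?X" using G0 unfolding trees_span_def by blast
  have zeroX: "conformal_sum ?d ?X u" if "u \<in> mat_kernel ?A" "vec_first u (n h) = 0\<^sub>v (n h)" for u
    using conformal_sum_mono[OF zero[OF that] G0X] .
  have pair_sum: "conformal_sum ?d ?X (x + y)" if xy: "x \<in> ?X" "y \<in> ?X" for x y
  proof -
    obtain S U where S: "S \<in> G" "x \<in> tree_span n h N S" and U: "U \<in> G" "y \<in> tree_span n h N U"
      using xy unfolding trees_span_def by blast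
    have SG: "tree_over n h ?K S" and UG: "tree_over n h ?K U" using S U G by auto
    obtain V where V: "(nf_step n h G)\<^sup>*\<^sup>* (tree_add n h S U) V" "tree_root V = 0\<^sub>v (n h) \<or> V \<in> G"
      using pairs[OF S(1) U(1)] unfolding resolves_def by blast
    have VG: "tree_over n h ?K V" using nf_steps_over[OF K G V(1) tree_add_over(1)[OF K SG UG]] .
    have "conformal_sum ?d ?X u" if u: "u \<in> tree_span n h N V" for u
      using V(2)
    proof
      assume "tree_root V = 0\<^sub>v (n h)"
      then have "vec_first u (n h) = 0\<^sub>v (n h)"
        using tree_span_first[OF N _ u] VG unfolding tree_over_def by simp
      then show ?thesis
        using zeroX tree_span_kernel[of h T l n, OF T VG N u] by blast
    next
      assume "V \<in> G"
      then show ?thesis using u by (intro conformal_sum_single) (auto simp: trees_span_def)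
    qed
    then show ?thesis
      using nf_steps_conformal_sum[OF K G subset_refl N _ V(1) tree_add_over(1)[OF K SG UG]
          tree_span_add[OF K SG UG N S(2) U(2)]] by blast
  qed
  have Kc: "?K \<subseteq> carrier_vec (path_dim n h)" using K unfolding additive_subgroup_def by blast
  have FK: "F \<subseteq> ?K" using F(3) unfolding generates_def by blast
  have Fc: "F \<subseteq> carrier_vec (path_dim n h)" using FK Kc by blast
  let ?sum = "\<lambda>z. \<exists>M. set_mset M \<subseteq> ?X \<and> mset_sum_of ?d M z"
  have first_sum: "\<forall>z\<in>mat_kernel ?A. vec_first z (n h) = vec_first v (n h) \<longrightarrow> ?sum z" if v: "v \<in> ?K" for v
  proof (rule span_symmetric_induct[OF F(3,1) Fc F(2) v])
    have "vec_first (0\<^sub>v (path_dim n h)) (n h) = 0\<^sub>v (n h)"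
      using path_dim_ge[of n h] by (auto simp: vec_first_def)
    then show "\<forall>z\<in>mat_kernel ?A. vec_first z (n h) = vec_first (0\<^sub>v (path_dim n h)) (n h) \<longrightarrow> ?sum z"
      using zeroX unfolding conformal_sum_def by metis
  next
    \<comment> \<open>Subtracting the constant vector \<open>c\<close> of \<open>f\<close> removes \<open>f\<close> from the first block.\<close>
    fix f w assume f: "f \<in> F" and w: "w \<in> carrier_vec (path_dim n h)"
      and IH: "\<forall>z\<in>mat_kernel ?A. vec_first z (n h) = vec_first w (n h) \<longrightarrow> ?sum z"
    show "\<forall>z\<in>mat_kernel ?A. vec_first z (n h) = vec_first (f + w) (n h) \<longrightarrow> ?sum z"
    proof (intro ballI impI)
      fix z assume z: "z \<in> mat_kernel ?A" and first: "vec_first z (n h) = vec_first (f + w) (n h)"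
      have zc: "z \<in> carrier_vec ?d" using mat_kernelD[OF A z] by simp
      have fc: "f \<in> carrier_vec (path_dim n h)" using f Fc by blast
      obtain c where c: "c \<in> carrier_vec ?d" "\<forall>\<alpha>\<in>indices N h. path_vec n N h c \<alpha> = f"
        using ex_constant_vec[OF fc] by blast
      have "paths (tree_of_paths n h {f}) = {f}"
        by (rule tree_of_paths_spec(3)) (use fc in auto)
      then have "c \<in> tree_span n h N (tree_of_paths n h {f})"
        unfolding tree_span_iff[OF N] using c by simp
      then have cX: "c \<in> ?X" using FG[OF f] G0 unfolding trees_span_def by blast
      have cf: "vec_first c (n h) = vec_first f (n h)"
        using indices_nonempty[OF N, of h] c path_vec_first[of _ N h c n] by auto
      have "vec_first (z - c) (n h) = vec_first w (n h)"
      proof -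
        have le: "n h \<le> ?d" using N by (cases h) (auto simp: stage_dim_0 stage_dim_Suc)
        have "vec_first (z - c) (n h) = vec_first f (n h) + vec_first w (n h) - vec_first f (n h)"
          using vec_first_minus[of z c "n h"] vec_first_add[of f w "n h"] zc c(1) fc w le path_dim_ge[of n h] first cf by simp
        also have "\<dots> = vec_first w (n h)" by (intro eq_vecI) (auto simp: vec_first_def)
        finally show ?thesis .
      qed
      moreover have "z - c \<in> mat_kernel ?A" using mat_kernel_minus[OF A z] cX Xk by blast
      ultimately obtain M where M: "set_mset M \<subseteq> ?X" "mset_sum_of ?d M (z - c)" using IH by blast
      have "mset_sum_of ?d (add_mset c M) (c + (z - c))" using mset_sum_of_add[OF c(1) _ M(2)] zc c(1) by simp
      moreover have "c + (z - c) = z" using zc c(1) by (intro eq_vecI) auto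
      ultimately show "?sum z" using M(1) cX by (intro exI[of _ "add_mset c M"]) simp
    qed
  qed
  show ?thesis
  proof
    fix z assume z: "z \<in> graver_basis ?A"
    then have zk: "z \<in> mat_kernel ?A" unfolding graver_basis_def by blast
    have zc: "z \<in> carrier_vec ?d" using mat_kernelD[OF A zk] by simp
    obtain \<alpha> where \<alpha>: "\<alpha> \<in> indices N h" using indices_nonempty[OF N] by blast
    have "path_vec n N h z \<alpha> \<in> ?K"
      using mat_kernel_iff_paths[of h T l n, OF T zc] zk \<alpha> by blast
    then obtain M where "set_mset M \<subseteq> ?X" "mset_sum_of ?d M z"
      using first_sum zk path_vec_first[OF \<alpha> zc] by metis
    then have "conformal_sum ?d ?X z" using conformal_sum_of_mset_sum[OF Xc pair_sum] by blast
    then show "z \<in> ?X" using graver_in_conformal_generators[OF A Xk z] by blast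
  qed
qed

section \<open>Termination\<close>

text \<open>Subtracting a non-zero conformal root decreases the norm of the root.\<close>

lemma nf_terminates:
  assumes K: "additive_subgroup (path_dim n h) K" and G: "\<forall>V\<in>G. tree_over n h K V"
    and S: "tree_over n h K S"
  shows "terminates_from (nf_step n h G) S"
  unfolding terminates_from_def
proof
  assume "\<exists>f. f 0 = S \<and> (\<forall>i. nf_step n h G (f i) (f (Suc i)))"
  then obtain f where f: "f 0 = S" "\<And>i. nf_step n h G (f i) (f (Suc i))" by blast
  have over: "tree_over n h K (f i)" for i
    by (induction i) (use f S nf_step_over[OF K G] in auto)
  have "vec_norm (tree_root (f (Suc i))) < vec_norm (tree_root (f i))" for i
  proof -
    obtain U where U: "U \<in> G" "reduces h U (f i)" "tree_root U \<noteq> 0\<^sub>v (n h)" "f (Suc i) = tree_diff n h (f i) U"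
      using f(2)[of i] unfolding nf_step_def by blast
    have "tree_over n h K U" using U(1) G by blast
    then have "tree_root (f (Suc i)) = tree_root (f i) - tree_root U"
      using tree_diff_over(3)[OF K over _ U(2)] U(4) by simp
    moreover have "tree_root (f i) \<in> carrier_vec (n h)"
      using over[of i] vector_tree_root unfolding tree_over_def by blast
    ultimately show ?thesis using vec_norm_diff_less reduces_root[OF U(2)] U(3) by simp
  qed
  then show False
    using wf_less_than[unfolded wf_iff_no_infinite_down_chain, simplified, rule_format,
        of "\<lambda>i. vec_norm (tree_root (f i))"] by blast
qed

lemma completion_step_cases:
  assumes "completion_step n h (G, C) (G', C')"
  shows "(G' = G \<and> (\<exists>S\<in>C. C' = C - {S})) \<or>
    (\<exists>U S. S \<in> C \<and> normal_form n h S G U \<and> tree_root U \<noteq> 0\<^sub>v (n h) \<and> U \<in> G' \<and> G \<subseteq> G')"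
  using assms by cases blast+

text \<open>If only finitely many steps add a tree, then the finite set \<open>C\<close> shrinks in all later steps.
  Otherwise the added trees form an infinite sequence in which no tree is reducible by an
  earlier one.\<close>

lemma completion_steps_terminate:
  assumes K: "additive_subgroup (path_dim n h) K" and inv: "completion_inv n h K G0 s"
  shows "terminates_from (completion_step n h) s"
  unfolding terminates_from_def
proof
  assume "\<exists>f. f 0 = s \<and> (\<forall>i. completion_step n h (f i) (f (Suc i)))"
  then obtain f where f: "f 0 = s" "\<And>i. completion_step n h (f i) (f (Suc i))" by blast
  define G where "G i = fst (f i)" for i
  define C where "C i = snd (f i)" for i
  have step: "completion_step n h (G i, C i) (G (Suc i), C (Suc i))" for i using f(2) by (simp add: G_def C_def)
  have "completion_inv n h K G0 (G i, C i)" for i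
    by (induction i) (use f(1) inv completion_inv_step[OF K step] in \<open>auto simp: G_def C_def\<close>)
  then have finC: "finite (C i)" and GK: "\<forall>S\<in>G i. tree_over n h K S" for i
    unfolding completion_inv.simps by blast+
  have mono: "G i \<subseteq> G j" if "i \<le> j" for i j
  proof -
    have "G i \<subseteq> G (Suc i)" for i using completion_step_cases[OF step[of i]] by blast
    then show ?thesis using lift_Suc_mono_le[of G i j] that by blast
  qed
  define I where "I = {i. \<exists>U S. S \<in> C i \<and> normal_form n h S (G i) U \<and> tree_root U \<noteq> 0\<^sub>v (n h) \<and> U \<in> G (Suc i)}"
  show False
  proof (cases "finite I")
    case True
    then obtain m where m: "\<And>i. i \<in> I \<Longrightarrow> i < m" using True[unfolded finite_nat_set_iff_bounded] by auto
    have "card (C (Suc i)) < card (C i)" if "i \<ge> m" for i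
    proof -
      have "i \<notin> I" using m[of i] that by auto
      then have "\<exists>S\<in>C i. C (Suc i) = C i - {S}" 
        using completion_step_cases[OF step[of i]] unfolding I_def mem_Collect_eq by meson
      then obtain S where "S \<in> C i" "C (Suc i) = C i - {S}" by blast
      then show ?thesis using card_Diff1_less[OF finC[of i], of S] by simp
    qed
    then have "card (C (m + Suc i)) < card (C (m + i))" for i using le_add1[of m i] by simp
    then show False
      using wf_less_than[unfolded wf_iff_no_infinite_down_chain, simplified, rule_format, of "\<lambda>i. card (C (m + i))"]
      by blast
  next
    case False
    define e where "e = enumerate I"
    have e: "e i \<in> I" "i < j \<Longrightarrow> e i < e j" for i j
      using enumerate_in_set[OF False] enumerate_mono[OF _ False] by (auto simp: e_def)
    have "\<forall>i. \<exists>U S. S \<in> C (e i) \<and> normal_form n h S (G (e i)) U \<and> tree_root U \<noteq> 0\<^sub>v (n h) \<and> U \<in> G (Suc (e i))"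
      using e(1) unfolding I_def mem_Collect_eq by meson
    then obtain U S where U: "\<And>i. S i \<in> C (e i)" "\<And>i. normal_form n h (S i) (G (e i)) (U i)"
        "\<And>i. tree_root (U i) \<noteq> 0\<^sub>v (n h)" "\<And>i. U i \<in> G (Suc (e i))"
      by metis
    have "vector_tree n h (U i)" for i using U(4)[of i] GK unfolding tree_over_def by blast
    then obtain i j where ij: "i < j" "reduces h (U i) (U j)" using reduces_good_sequence[of n h U] by blast
    \<comment> \<open>The tree \<open>U i\<close> was available when \<open>U j\<close> was computed, so \<open>U j\<close> was not a normal form.\<close>
    have "U i \<in> G (e j)" using U(4)[of i] mono[of "Suc (e i)" "e j"] e(2)[OF ij(1)] by auto
    then have "nf_step n h (G (e j)) (U j) (tree_diff n h (U j) (U i))"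
      using ij(2) U(3)[of i] unfolding nf_step_def by blast
    then show False using U(2)[of j] unfolding normal_form_def by blast
  qed
qed

lemma completion_terminates_if_inv:
  assumes K: "additive_subgroup (path_dim n h) K" and inv: "completion_inv n h K G0 (completion_init n h G)"
  shows "completion_terminates n h G"
  unfolding completion_terminates_def
proof (intro conjI allI impI)
  show "terminates_from (completion_step n h) (completion_init n h G)"
    by (rule completion_steps_terminate[OF K inv])
  fix G' C' S assume "(completion_step n h)\<^sup>*\<^sup>* (completion_init n h G) (G', C')" "S \<in> C'"
  then have "completion_inv n h K G0 (G', C')" using completion_inv_steps[OF K _ inv] by blast
  then show "terminates_from (nf_step n h G') S"
    using nf_terminates[OF K] \<open>S \<in> C'\<close> unfolding completion_inv.simps by blast
qed

section \<open>Kernel vectors with zero root\<close>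

lemma path_vec_zero:
  assumes "\<alpha> \<in> indices N h"
  shows "path_vec n N h (0\<^sub>v (stage_dim n h N)) \<alpha> = 0\<^sub>v (path_dim n h)"
proof -
  let ?z = "0\<^sub>v (stage_dim n h N) :: int vec"
  have "path_vec n N h (?z - ?z) \<alpha> = path_vec n N h ?z \<alpha> - path_vec n N h ?z \<alpha>"
    by (rule path_vec_minus) (use assms in auto)
  also have "\<dots> = 0\<^sub>v (path_dim n h)"
    using path_vec_carrier[OF _ assms, of ?z n] by auto
  finally show ?thesis by simp
qed

lemma zero_root_kernel_iff:
  assumes T: "\<And>i. i \<le> Suc h \<Longrightarrow> T i \<in> carrier_mat l (n i)"
    and z: "z \<in> carrier_vec (stage_dim n (Suc h) N)" and zero: "vec_first z (n (Suc h)) = 0\<^sub>v (n (Suc h))"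
  shows "z \<in> mat_kernel (stage_mat T (Suc h) N) \<longleftrightarrow>
    (\<forall>i\<in>{1..N}. child_vec n N h z i \<in> mat_kernel (stage_mat T h N))"
proof -
  have T': "\<And>i. i \<le> h \<Longrightarrow> T i \<in> carrier_mat l (n i)" using T by simp
  have "(0\<^sub>v (n (Suc h)) @\<^sub>v path_vec n N h (child_vec n N h z i) \<alpha> \<in> mat_kernel (stage_mat T (Suc h) 1)) \<longleftrightarrow>
      path_vec n N h (child_vec n N h z i) \<alpha> \<in> mat_kernel (stage_mat T h 1)" if "\<alpha> \<in> indices N h" for i \<alpha>
    using zero_append_in_kernel_iff[of h T l n, OF T path_vec_carrier[OF child_vec_carrier that]] .
  moreover have "z \<in> mat_kernel (stage_mat T (Suc h) N) \<longleftrightarrow>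
      (\<forall>\<alpha>\<in>indices N (Suc h). path_vec n N (Suc h) z \<alpha> \<in> mat_kernel (stage_mat T (Suc h) 1))"
    by (rule mat_kernel_iff_paths[OF T z])
  moreover have "child_vec n N h z i \<in> mat_kernel (stage_mat T h N) \<longleftrightarrow>
      (\<forall>\<alpha>\<in>indices N h. path_vec n N h (child_vec n N h z i) \<alpha> \<in> mat_kernel (stage_mat T h 1))" for i
    by (rule mat_kernel_iff_paths[OF T' child_vec_carrier])
  ultimately show ?thesis unfolding ball_indices_Suc path_vec.simps zero by blast
qed

text \<open>With first block \<open>0\<close> the children are independent of each other. Replacing a child by a
  conformal non-zero kernel vector and all other children by \<open>0\<close> gives a conformal non-zero
  kernel vector, so by minimality it is the original one.\<close>

lemma graver_zero_root:
  assumes T: "\<And>i. i \<le> Suc h \<Longrightarrow> T i \<in> carrier_mat l (n i)"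
    and g: "g \<in> graver_basis (stage_mat T (Suc h) N)" and zero: "vec_first g (n (Suc h)) = 0\<^sub>v (n (Suc h))"
  obtains i where "i \<in> {1..N}" "child_vec n N h g i \<in> graver_basis (stage_mat T h N)"
    "\<And>j. j \<in> {1..N} \<Longrightarrow> j \<noteq> i \<Longrightarrow> child_vec n N h g j = 0\<^sub>v (stage_dim n h N)"
proof -
  let ?m = "n (Suc h)" and ?d = "stage_dim n h N" and ?D = "stage_dim n (Suc h) N"
  let ?A = "stage_mat T h N" and ?B = "stage_mat T (Suc h) N"
  have A: "?A \<in> carrier_mat (l * N ^ h) ?d" by (rule stage_mat_dim) (use T in auto)
  have B: "?B \<in> carrier_mat (l * N ^ Suc h) ?D" by (rule stage_mat_dim) (use T in auto)
  have dims: "dim_col ?A = ?d" "dim_col ?B = ?D" using A B by auto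
  have gk: "g \<in> mat_kernel ?B" "g \<noteq> 0\<^sub>v ?D"
    and min: "\<And>y. y \<in> mat_kernel ?B \<Longrightarrow> y \<noteq> 0\<^sub>v ?D \<Longrightarrow> y \<sqsubseteq>\<^sub>c g \<Longrightarrow> y = g"
    using g unfolding graver_basis_def dims by blast+
  have gc: "g \<in> carrier_vec ?D" using mat_kernelD[OF B gk(1)] by simp
  have kids: "\<And>i. i \<in> {1..N} \<Longrightarrow> child_vec n N h g i \<in> mat_kernel ?A"
    using zero_root_kernel_iff[of h T l n, OF T gc zero] gk(1) by blast
  have zero_refl: "0\<^sub>v k \<sqsubseteq>\<^sub>c v" if "v \<in> carrier_vec k" for v k using that by (auto simp: conformal_def)
  have embed: "\<exists>y. y = g \<and> child_vec n N h y i = x \<and> (\<forall>j\<in>{1..N}. j \<noteq> i \<longrightarrow> child_vec n N h y j = 0\<^sub>v ?d)"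
    if i: "i \<in> {1..N}" and x: "x \<in> mat_kernel ?A" "x \<noteq> 0\<^sub>v ?d" "x \<sqsubseteq>\<^sub>c child_vec n N h g i" for i x
  proof -
    have xc: "x \<in> carrier_vec ?d" using mat_kernelD[OF A x(1)] by simp
    obtain y where y: "y \<in> carrier_vec ?D" "vec_first y ?m = 0\<^sub>v ?m"
        "\<And>j. j \<in> {1..N} \<Longrightarrow> child_vec n N h y j = (if j = i then x else 0\<^sub>v ?d)"
      by (rule ex_vec_with_children[of "0\<^sub>v ?m" n h N "\<lambda>j. if j = i then x else 0\<^sub>v ?d"]) (use xc in auto)
    have "0\<^sub>v ?d \<in> mat_kernel ?A" using additive_subgroup_kernel[OF A] unfolding additive_subgroup_def by blast
    then have "y \<in> mat_kernel ?B"
      using zero_root_kernel_iff[of h T l n, OF T y(1,2)] y(3) x(1) by simp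
    moreover have "y \<noteq> 0\<^sub>v ?D"
    proof
      assume "y = 0\<^sub>v ?D"
      then have "child_vec n N h y i = 0\<^sub>v ?d"
        using coordinate_bound[OF i] by (intro eq_vecI) (auto simp: child_vec_def stage_dim_Suc add.assoc)
      then show False using y(3)[OF i] x(2) by simp
    qed
    moreover have "y \<sqsubseteq>\<^sub>c g"
    proof (rule conformal_if_children[OF gc y(1)])
      show "vec_first y ?m \<sqsubseteq>\<^sub>c vec_first g ?m" unfolding y(2) zero by (simp add: conformal_def)
      show "child_vec n N h y j \<sqsubseteq>\<^sub>c child_vec n N h g j" if "j \<in> {1..N}" for j
        using y(3)[OF that] x(3) zero_refl[OF child_vec_carrier] by auto
    qed
    ultimately have "y = g" using min by blast
    then show ?thesis using y(3) i by auto
  qed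
  have "\<exists>i\<in>{1..N}. child_vec n N h g i \<noteq> 0\<^sub>v ?d"
  proof (rule ccontr)
    assume none: "\<not> ?thesis"
    have z0: "child_vec n N h (0\<^sub>v ?D) i = 0\<^sub>v ?d" if i: "i \<in> {1..N}" for i
      using coordinate_bound[OF i] by (intro eq_vecI) (auto simp: child_vec_def stage_dim_Suc add.assoc)
    have "vec_first (0\<^sub>v ?D) ?m = 0\<^sub>v ?m" by (auto simp: vec_first_def stage_dim_Suc)
    then have "0\<^sub>v ?D = g"
      by (intro stage_vec_eqI[OF gc]) (use z0 none zero in auto)
    then show False using gk(2) by simp
  qed
  then obtain i where i: "i \<in> {1..N}" "child_vec n N h g i \<noteq> 0\<^sub>v ?d" by blast
  have "child_vec n N h g i \<sqsubseteq>\<^sub>c child_vec n N h g i" by (simp add: conformal_def)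
  then have others: "\<forall>j\<in>{1..N}. j \<noteq> i \<longrightarrow> child_vec n N h g j = 0\<^sub>v ?d"
    using embed[OF i(1) kids[OF i(1)] i(2)] by blast
  have "child_vec n N h g i \<in> graver_basis ?A"
    unfolding graver_basis_def dims using kids[OF i(1)] i(2) embed[OF i(1)] by blast
  then show thesis using that i(1) others by blast
qed

section \<open>The stages of the algorithm\<close>

text \<open>What the correctness of a stage needs to know about its input. The last condition is where
  the previous stage enters.\<close>

definition admissible_input :: "(nat \<Rightarrow> int mat) \<Rightarrow> (nat \<Rightarrow> nat) \<Rightarrow> nat \<Rightarrow> vtree set \<Rightarrow> bool" where
  "admissible_input T n h G \<longleftrightarrow> finite G \<and> symmetric_trees n h G \<and>
     (\<forall>S\<in>G. tree_over n h (mat_kernel (stage_mat T h 1)) S) \<and>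
     (\<exists>F. finite F \<and> symmetric_vecs F \<and> generates (path_dim n h) F (mat_kernel (stage_mat T h 1)) \<and>
        (\<forall>f\<in>F. tree_of_paths n h {f} \<in> G)) \<and>
     (\<forall>N\<ge>1. \<forall>u\<in>mat_kernel (stage_mat T h N). vec_first u (n h) = 0\<^sub>v (n h) \<longrightarrow>
        conformal_sum (stage_dim n h N) (trees_span n h N G) u)"

definition stage_correct :: "(nat \<Rightarrow> int mat) \<Rightarrow> (nat \<Rightarrow> nat) \<Rightarrow> nat \<Rightarrow> vtree set \<Rightarrow> bool" where
  "stage_correct T n h G \<longleftrightarrow> finite G \<and> symmetric_trees n h G \<and>
     (\<forall>S\<in>G. tree_over n h (mat_kernel (stage_mat T h 1)) S) \<and>
     (\<forall>N\<ge>1. graver_basis (stage_mat T h N) \<subseteq> trees_span n h N G)"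

lemma completion_correct:
  assumes T: "\<And>i. i \<le> h \<Longrightarrow> T i \<in> carrier_mat l (n i)" and G: "admissible_input T n h G"
  shows "completion_terminates n h G" "completion_output n h G G' \<Longrightarrow> stage_correct T n h G'"
proof -
  let ?K = "mat_kernel (stage_mat T h 1)"
  have K: "additive_subgroup (path_dim n h) ?K" using path_kernel_subgroup[of h T l n] T by blast
  have fin: "finite G" and sym: "symmetric_trees n h G" and over: "\<forall>S\<in>G. tree_over n h ?K S"
    using G unfolding admissible_input_def by blast+
  have inv: "completion_inv n h ?K G (completion_init n h G)" by (rule completion_inv_init[OF K fin sym over])
  then show "completion_terminates n h G" by (rule completion_terminates_if_inv[OF K])
  assume "completion_output n h G G'"
  then have inv': "completion_inv n h ?K G (G', {})"
    using completion_inv_steps[OF K _ inv] unfolding completion_output_def by blast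
  obtain F where F: "finite F" "symmetric_vecs F" "generates (path_dim n h) F ?K"
      "\<And>f. f \<in> F \<Longrightarrow> tree_of_paths n h {f} \<in> G"
    using G unfolding admissible_input_def by blast
  have "graver_basis (stage_mat T h N) \<subseteq> trees_span n h N G'" if N: "N \<ge> 1" for N
    by (rule graver_subset_completed_span[of h T l n, OF T N inv' F])
      (use G N in \<open>auto simp: admissible_input_def\<close>)
  then show "stage_correct T n h G'"
    using inv' unfolding stage_correct_def completion_inv.simps by blast
qed

lemma singleton_trees:
  assumes K: "additive_subgroup (path_dim n h) K" and F: "F \<subseteq> K" "symmetric_vecs F"
  defines "G \<equiv> {tree_of_paths n h {v} | v. v \<in> F}"
  shows "\<forall>S\<in>G. tree_over n h K S" "symmetric_trees n h G"
proof -
  have over: "tree_over n h K (tree_of_paths n h {v})" "paths (tree_of_paths n h {v}) = {v}" if "v \<in> F" for v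
    by (rule tree_over_tree_of_paths[OF K]; use that F in auto)+
  then show "\<forall>S\<in>G. tree_over n h K S" unfolding G_def by blast
  have "tree_neg n h (tree_of_paths n h {v}) = tree_of_paths n h {- v}" if "v \<in> F" for v
    unfolding tree_neg_def over(2)[OF that] by simp
  then show "symmetric_trees n h G"
    using F(2) unfolding symmetric_trees_def symmetric_vecs_def G_def by auto
qed

text \<open>In height \<open>0\<close> a vector with zero root is zero.\<close>

lemma stage_input_0_admissible:
  assumes T: "\<And>i. i \<le> 0 \<Longrightarrow> T i \<in> carrier_mat l (n i)" and input: "stage_input T n 0 G' G"
  shows "admissible_input T n 0 G"
proof -
  let ?K = "mat_kernel (stage_mat T 0 1)"
  have K: "additive_subgroup (path_dim n 0) ?K" using path_kernel_subgroup[of 0 T l n] T by blast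
  obtain F where F: "finite F" "symmetric_vecs F" "generates (path_dim n 0) F ?K"
      and G: "G = {tree_of_paths n 0 {v} | v. v \<in> F}"
    using input by auto
  have FK: "F \<subseteq> ?K" using F(3) unfolding generates_def by blast
  have "conformal_sum (stage_dim n 0 N) (trees_span n 0 N G) u"
    if u: "u \<in> mat_kernel (stage_mat T 0 N)" "vec_first u (n 0) = 0\<^sub>v (n 0)" for N u
  proof -
    have "u \<in> carrier_vec (n 0)" using u(1) mat_kernelD[OF T[of 0]] by simp
    then have "u = vec_first u (n 0)" by (auto simp: vec_first_def)
    then have "u = 0\<^sub>v (n 0)" using u(2) by simp
    then show ?thesis using conformal_sum_zero by (simp add: stage_dim_0)
  qed
  moreover have "finite G" unfolding G using F(1) by simp
  ultimately show ?thesis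
    unfolding admissible_input_def using singleton_trees[OF K FK F(2)] F G by blast
qed

text \<open>The tree \<open>T\<^sub>0\<close> has as paths \<open>(0, v)\<close> for \<open>v = 0\<close> and the paths \<open>v\<close> of the previous stage. It
  describes the Graver basis elements with first block \<open>0\<close>, since these have one non-zero
  child, which is in the Graver basis of the previous stage.\<close>

lemma stage_input_Suc_admissible:
  assumes T: "\<And>i. i \<le> Suc h \<Longrightarrow> T i \<in> carrier_mat l (n i)" and G': "stage_correct T n h G'"
    and input: "stage_input T n (Suc h) G' G"
  shows "admissible_input T n (Suc h) G"
proof -
  let ?K = "mat_kernel (stage_mat T (Suc h) 1)" and ?L = "mat_kernel (stage_mat T h 1)" and ?m = "n (Suc h)"
  have K: "additive_subgroup (path_dim n (Suc h)) ?K"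
    using path_kernel_subgroup[of "Suc h" T l n] T by blast
  have L: "additive_subgroup (path_dim n h) ?L"
    using path_kernel_subgroup[of h T l n] T by simp
  have G'fin: "finite G'" and G'sym: "symmetric_trees n h G'" and G'over: "\<And>S. S \<in> G' \<Longrightarrow> tree_over n h ?L S"
    and G'span: "\<And>N. N \<ge> 1 \<Longrightarrow> graver_basis (stage_mat T h N) \<subseteq> trees_span n h N G'"
    using G' unfolding stage_correct_def by blast+
  define P where "P = insert (0\<^sub>v (path_dim n h)) (\<Union>S\<in>G'. paths S)"
  define V where "V = (\<lambda>v. 0\<^sub>v ?m @\<^sub>v v) ` P"
  define T0 where "T0 = tree_of_paths n (Suc h) V"
  have Veq: "V = {0\<^sub>v ?m @\<^sub>v v | v. v = 0\<^sub>v (path_dim n h) \<or> (\<exists>S\<in>G'. v \<in> paths S)}"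
    unfolding V_def P_def by blast
  obtain F where F: "finite F" "symmetric_vecs F" "generates (path_dim n (Suc h)) F ?K"
      and G: "G = {T0} \<union> {tree_of_paths n (Suc h) {v} | v. v \<in> F}"
    using input unfolding stage_input.simps T0_def Veq by blast
  have FK: "F \<subseteq> ?K" using F(3) unfolding generates_def by blast
  have PL: "P \<subseteq> ?L" "finite P"
    using G'over G'fin L unfolding P_def tree_over_def additive_subgroup_def by auto
  have Pc: "P \<subseteq> carrier_vec (path_dim n h)" using PL(1) L unfolding additive_subgroup_def by blast
  have VK: "V \<subseteq> ?K"
    using PL(1) Pc zero_append_in_kernel_iff[of h T l n, OF T]
    unfolding V_def by blast
  have T0: "tree_over n (Suc h) ?K T0" "paths T0 = V"
    unfolding T0_def
    by (rule tree_over_tree_of_paths[OF K _ _ VK, where r = "0\<^sub>v ?m"];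
        use PL(2) in \<open>auto simp: V_def P_def vec_first_app\<close>)+
  have Psym: "- v \<in> P" if v: "v \<in> P" for v
  proof (cases "v = 0\<^sub>v (path_dim n h)")
    case True
    then have "- v = 0\<^sub>v (path_dim n h)" by auto
    then show ?thesis by (simp add: P_def)
  next
    case False
    then obtain S where S: "S \<in> G'" "v \<in> paths S" using v unfolding P_def by blast
    then have "- v \<in> paths (tree_neg n h S)" using tree_neg_over(2)[OF L G'over] by blast
    moreover have "tree_neg n h S \<in> G'" using G'sym S(1) unfolding symmetric_trees_def by blast
    ultimately show ?thesis unfolding P_def by blast
  qed
  have neg: "- (0\<^sub>v ?m @\<^sub>v v) = 0\<^sub>v ?m @\<^sub>v - v" for v :: "int vec" by (intro eq_vecI) auto
  have "uminus ` V = V"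
  proof -
    have "uminus ` V \<subseteq> V" using Psym neg unfolding V_def by auto
    moreover have "V \<subseteq> uminus ` V"
    proof
      fix x assume "x \<in> V"
      then have "- x \<in> V" "x = - (- x)" using \<open>uminus ` V \<subseteq> V\<close> by auto
      then show "x \<in> uminus ` V" by blast
    qed
    ultimately show ?thesis by blast
  qed
  moreover have "{- v | v. v \<in> V} = uminus ` V" by blast
  ultimately have negT0: "tree_neg n (Suc h) T0 = T0"
    unfolding tree_neg_def T0(2) by (simp add: T0_def)
  have sym: "symmetric_trees n (Suc h) G"
    using singleton_trees(2)[OF K FK F(2)] negT0 unfolding symmetric_trees_def G by blast
  have over: "\<forall>S\<in>G. tree_over n (Suc h) ?K S"
    using singleton_trees(1)[OF K FK F(2)] T0(1) unfolding G by blast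
  have fin: "finite G" unfolding G using F(1) by simp
  have zero: "conformal_sum (stage_dim n (Suc h) N) (trees_span n (Suc h) N G) u"
    if N: "N \<ge> 1" and u: "u \<in> mat_kernel (stage_mat T (Suc h) N)" "vec_first u ?m = 0\<^sub>v ?m" for N u
  proof -
    let ?B = "stage_mat T (Suc h) N" and ?D = "stage_dim n (Suc h) N"
    have B: "?B \<in> carrier_mat (l * N ^ Suc h) ?D" by (rule stage_mat_dim) (use T in auto)
    have uc: "u \<in> carrier_vec ?D" using mat_kernelD[OF B u(1)] by simp
    have gc: "graver_basis ?B \<subseteq> carrier_vec ?D"
      using mat_kernel_carrier[OF B] unfolding graver_basis_def by blast
    have "g \<in> trees_span n (Suc h) N G" if g: "g \<in> graver_basis ?B" "g \<sqsubseteq>\<^sub>c u" for g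
    proof -
      have gD: "g \<in> carrier_vec ?D" using g(1) gc by blast
      have g0: "vec_first g ?m = 0\<^sub>v ?m"
      proof (rule eq_vecI)
        fix j assume "j < dim_vec (0\<^sub>v ?m :: int vec)"
        then have j: "j < ?m" by simp
        then have "u $ j = 0" using u(2) vec_first_index[OF j, of u] by simp
        moreover have "j < dim_vec g" using j gD by (simp add: stage_dim_Suc)
        ultimately have "g $ j = 0" using g(2) unfolding conformal_def by fastforce
        then show "vec_first g ?m $ j = 0\<^sub>v ?m $ j" using j by (simp add: vec_first_index)
      qed simp
      obtain i where i: "i \<in> {1..N}" "child_vec n N h g i \<in> graver_basis (stage_mat T h N)"
          "\<And>j. j \<in> {1..N} \<Longrightarrow> j \<noteq> i \<Longrightarrow> child_vec n N h g j = 0\<^sub>v (stage_dim n h N)"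
        using graver_zero_root[of h T l n, OF T g(1) g0] by blast
      obtain S where S: "S \<in> G'" "child_vec n N h g i \<in> tree_span n h N S"
        using G'span[OF N] i(2) unfolding trees_span_def by blast
      have "path_vec n N h (child_vec n N h g j) \<alpha> \<in> P" if "j \<in> {1..N}" "\<alpha> \<in> indices N h" for j \<alpha>
      proof (cases "j = i")
        case True
        then show ?thesis using S that(2) unfolding tree_span_iff[OF N] P_def by blast
      next
        case False
        then show ?thesis using i(3)[OF that(1)] path_vec_zero[OF that(2)] unfolding P_def by simp
      qed
      then have "g \<in> tree_span n (Suc h) N T0"
        unfolding tree_span_iff[OF N] T0(2) ball_indices_Suc path_vec.simps g0 V_def using gD by blast
      then show ?thesis unfolding trees_span_def G by blast
    qed
    then have "{x \<in> graver_basis ?B. x \<sqsubseteq>\<^sub>c u} \<subseteq> trees_span n (Suc h) N G" by blast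
    then show ?thesis
      using conformal_sum_restrict[OF gc uc conformal_sum_graver[OF B u(1)]] conformal_sum_mono by blast
  qed
  show ?thesis
    unfolding admissible_input_def using fin sym over zero F G by blast
qed

lemma stages_correct:
  assumes "stages_computed T n m Gs" "i < m" "\<And>s. s \<le> i \<Longrightarrow> T s \<in> carrier_mat l (n s)"
  shows "stage_correct T n i (Gs i)"
  using assms(2,3)
proof (induction i)
  case 0
  obtain G where G: "stage_input T n 0 (Gs (0 - 1)) G" "completion_output n 0 G (Gs 0)"
    using assms(1) 0(1) unfolding stages_computed_def by blast
  have T: "\<And>s. s \<le> 0 \<Longrightarrow> T s \<in> carrier_mat l (n s)" using 0(2) .
  show ?case
    using completion_correct(2)[of 0 T l n, OF T
        stage_input_0_admissible[of T l n, OF T G(1)] G(2)] .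
next
  case (Suc i)
  obtain G where G: "stage_input T n (Suc i) (Gs i) G" "completion_output n (Suc i) G (Gs (Suc i))"
    using assms(1)[unfolded stages_computed_def, rule_format, OF Suc.prems(1)]
    unfolding diff_Suc_1 by blast
  have T: "\<And>s. s \<le> Suc i \<Longrightarrow> T s \<in> carrier_mat l (n s)" using Suc.prems(2) .
  have "stage_correct T n i (Gs i)" using Suc by simp
  then show ?case
    using completion_correct(2)[of "Suc i" T l n, OF T
        stage_input_Suc_admissible[of i T l n, OF T _ G(1)] G(2)] by blast
qed

lemma stage_input_admissible:
  assumes "stages_computed T n i Gs" "\<And>s. s \<le> i \<Longrightarrow> T s \<in> carrier_mat l (n s)"
    "stage_input T n i (Gs (i - 1)) G"
  shows "admissible_input T n i G"
proof (cases i)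
  case 0
  then show ?thesis using stage_input_0_admissible[of T l n] assms(2,3) by blast
next
  case (Suc h)
  then have "stage_correct T n h (Gs h)" using stages_correct[OF assms(1), of h l] assms(2) by simp
  then show ?thesis using stage_input_Suc_admissible[of h T l n] assms(2,3) Suc by simp
qed

section \<open>Building blocks as labels\<close>

text \<open>The component of a path at distance \<open>s\<close> from the root.\<close>

fun level_label :: "(nat \<Rightarrow> nat) \<Rightarrow> nat \<Rightarrow> nat \<Rightarrow> int vec \<Rightarrow> int vec" where
  "level_label n h 0 p = vec_first p (n h)"
| "level_label n (Suc h) (Suc s) p = level_label n h s (vec_last p (path_dim n h))"
| "level_label n 0 (Suc s) p = 0\<^sub>v 0"

lemma level_label_in_labels_at:
  "vector_tree n h S \<Longrightarrow> p \<in> paths S \<Longrightarrow> s \<le> h \<Longrightarrow> level_label n h s p \<in> labels_at s S"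
proof (induction n h s p arbitrary: S rule: level_label.induct)
  case (1 n h p)
  then show ?case using paths_first by simp
next
  case (2 n h s p)
  obtain S' q where S': "S' \<in> subtrees S" "q \<in> paths S'" "p = tree_root S @\<^sub>v q"
    using 2(3) unfolding paths_Suc[OF 2(2)] by blast
  have "vector_tree n h S'" using vector_tree_subtree[OF 2(2) S'(1)] .
  then have "level_label n h s q \<in> labels_at s S'" "q \<in> carrier_vec (path_dim n h)"
    using 2(1)[of S'] S'(2,3) 2(4) paths_carrier[of n h S' q] vec_last_append[of q "path_dim n h" "tree_root S"] by auto
  then show ?case using S'(1) vec_last_append[of q "path_dim n h" "tree_root S"] unfolding S'(3) by auto
qed simp

text \<open>The block at \<open>\<alpha>\<close> is seen on every path through \<open>\<alpha>\<close>.\<close>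

lemma block_eq_level_label:
  "z \<in> carrier_vec (stage_dim n h N) \<Longrightarrow> \<alpha> \<in> indices N s \<Longrightarrow> \<alpha> @ \<beta> \<in> indices N h \<Longrightarrow>
   block n N h z \<alpha> = level_label n h s (path_vec n N h z (\<alpha> @ \<beta>))"
proof (induction \<alpha> arbitrary: h s z)
  case Nil
  then have "s = 0" by (simp add: indices_def)
  then show ?case using path_vec_first Nil by simp
next
  case (Cons i \<alpha>)
  obtain s' where s: "s = Suc s'" "\<alpha> \<in> indices N s'" using Cons.prems(2) by (auto simp: indices_def)
  obtain h' where h: "h = Suc h'" "\<alpha> @ \<beta> \<in> indices N h'" using Cons.prems(3) by (cases h) (auto simp: indices_def)
  show ?case
    unfolding h(1) s(1) block_Cons append_Cons path_vec.simps level_label.simps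
      vec_last_append[OF path_vec_carrier[OF child_vec_carrier h(2)]]
    by (rule Cons.IH[OF child_vec_carrier s(2) h(2)])
qed

lemma block_in_labels_at:
  assumes N: "N \<ge> 1" and S: "vector_tree n h S" and z: "z \<in> tree_span n h N S"
    and s: "s \<le> h" and \<alpha>: "\<alpha> \<in> indices N s"
  shows "block n N h z \<alpha> \<in> labels_at s S"
proof -
  \<comment> \<open>Since \<open>N \<ge> 1\<close>, some path of \<open>T(z)\<close> passes through \<open>\<alpha>\<close>.\<close>
  have ext: "\<alpha> @ replicate (h - s) 1 \<in> indices N h" using \<alpha> s N by (auto simp: indices_def)
  have "path_vec n N h z (\<alpha> @ replicate (h - s) 1) \<in> paths S" using z ext tree_span_iff[OF N] by blast
  then show ?thesis
    using block_eq_level_label[OF tree_span_carrier[OF z] \<alpha> ext] level_label_in_labels_at[OF S _ s] by simp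
qed

theorem theorem9p9:
  fixes T :: "nat \<Rightarrow> int mat" and n :: "nat \<Rightarrow> nat" and k l :: nat
  assumes "l \<ge> 1"
    and "\<And>s. s \<le> k \<Longrightarrow> n s \<ge> 1"
    and "\<And>s. s \<le> k \<Longrightarrow> T s \<in> carrier_mat l (n s)"
  shows "algorithm_terminates T n k \<and>
    (\<forall>Gs. algorithm_output T n k Gs \<longrightarrow>
      (\<forall>i\<le>k. finite (Gs i) \<and> symmetric_trees n i (Gs i) \<and>
        (\<forall>S\<in>Gs i. vector_tree n i S \<and> finite_tree S) \<and>
        (\<forall>N\<ge>1. graver_basis (stage_mat T i N) \<subseteq> trees_span n i N (Gs i))) \<and>
      H_inf T n k \<subseteq> tree_blocks (Gs k))"
proof (intro conjI allI impI)
  show "algorithm_terminates T n k"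
    unfolding algorithm_terminates_def
  proof (intro allI impI)
    fix i Gs G assume i: "i \<le> k" and "stages_computed T n i Gs" "stage_input T n i (Gs (i - 1)) G"
    have Ti: "\<And>s. s \<le> i \<Longrightarrow> T s \<in> carrier_mat l (n s)" using assms(3) i by simp
    have "admissible_input T n i G"
      using stage_input_admissible[where T = T and n = n and l = l, OF \<open>stages_computed T n i Gs\<close> Ti \<open>stage_input T n i (Gs (i - 1)) G\<close>] .
    then show "completion_terminates n i G"
      using completion_correct(1)[of i T l n, OF Ti] by blast
  qed
next
  fix Gs assume "algorithm_output T n k Gs"
  then have comp: "stages_computed T n (Suc k) Gs" unfolding algorithm_output_def .
  have correct: "stage_correct T n i (Gs i)" if "i \<le> k" for i
    using stages_correct[OF comp, of i l] assms(3) that by simp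
  {
    fix i assume i: "i \<le> k"
    note c = correct[OF i, unfolded stage_correct_def]
    show "finite (Gs i)" "symmetric_trees n i (Gs i)" using c by blast+
    show "\<forall>S\<in>Gs i. vector_tree n i S \<and> finite_tree S"
      using c finite_tree_of_finite_paths unfolding tree_over_def by blast
    fix N :: nat assume "N \<ge> 1"
    then show "graver_basis (stage_mat T i N) \<subseteq> trees_span n i N (Gs i)" using c by blast
  }
  show "H_inf T n k \<subseteq> tree_blocks (Gs k)"
  proof
    fix x assume "x \<in> H_inf T n k"
    then obtain s N z \<alpha> where s: "s \<le> k" and x: "x = (s, block n N k z \<alpha>)" and N: "N \<ge> 1"
      and z: "z \<in> graver_basis (stage_mat T k N)" and \<alpha>: "\<alpha> \<in> indices N s"
      unfolding H_inf_def blocks_at_def by auto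
    obtain S where S: "S \<in> Gs k" "z \<in> tree_span n k N S"
      using correct[of k] N z unfolding stage_correct_def trees_span_def by blast
    have "vector_tree n k S" using correct[of k] S(1) unfolding stage_correct_def tree_over_def by blast
    then have "block n N k z \<alpha> \<in> labels_at s S" using block_in_labels_at[OF N _ S(2) s \<alpha>] by blast
    then show "x \<in> tree_blocks (Gs k)" unfolding x tree_blocks_def using S(1) by blast
  qed
qed

end
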